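(* Let $\Omega\subset\mathbb{R}^d$ ($d=2,3$) be a Lipschitz polygon/polyhedron and let $s\in(1/2,1]$ be such that for every $f\in L^2(\Omega)$ the solution $u\in H^1_0(\Omega)$ of $-\Delta u=f$ belongs to $H^{1+s}(\Omega)$. Let $\Sigma_h\subset\mathbf{H}(\mathrm{div};\Omega)$ and $U_h\subset H^1_0(\Omega)$ be families of finite dimensional (finite element) spaces indexed by $h>0$, and assume that there is a constant $C$ independent of $h$ such that $$\inf_{\boldsymbol{\tau}\in\Sigma_h}\|\boldsymbol{\chi}-\boldsymbol{\tau}\|_{\mathbf{H}(\mathrm{div};\Omega)}\le Ch^s\big(\|\boldsymbol{\chi}\|_{\mathbf{H}^s(\Omega)}+\|\mathrm{div}\,\boldsymbol{\chi}\|_{H^{1+s}(\Omega)}\big),\qquad \inf_{v\in U_h}\|p-v\|_{H^1(\Omega)}\le Ch^s\|p\|_{H^{1+s}(\Omega)}$$ for all $\boldsymbol{\chi}\in\mathbf{H}^s(\Omega)$ with $\mathrm{div}\,\boldsymbol{\chi}\in H^{1+s}(\Omega)$ and all $p\in H^{1+s}(\Omega)\cap H^1_0(\Omega)$. Then there is a constant $C$ independent of $h$ and $f$ such that for every $f\in L^2(\Omega)$, if $(\boldsymbol{\sigma},u)$ is the solution of the first order least-squares source problem with datum $f$ and $(\boldsymbol{\sigma}_h,u_h)\in\Sigma_h\times U_h$ is its Galerkin approximation (both defined in the context), then $$\|u-u_h\|_{L^2(\Omega)}\le Ch^s\big(\|\boldsymbol{\sigma}-\boldsymbol{\sigma}_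h\|_{\mathbf{H}(\mathrm{div};\Omega)}+\|u-u_h\|_{H^1(\Omega)}\big).$$
   Context: $(\cdot,\cdot)$ is the $L^2(\Omega)$ (or $L^2(\Omega)^d$) inner product; $\mathbf{H}(\mathrm{div};\Omega)=\{\boldsymbol{\tau}\in L^2(\Omega)^d:\mathrm{div}\,\boldsymbol{\tau}\in L^2(\Omega)\}$ with the graph norm; $\mathbf{H}^s(\Omega)=H^s(\Omega)^d$. The source problem with datum $f\in L^2(\Omega)$ is: find $\boldsymbol{\sigma}\in\mathbf{H}(\mathrm{div};\Omega)$ and $u\in H^1_0(\Omega)$ such that $$\begin{cases}(\boldsymbol{\sigma},\boldsymbol{\tau})+(\mathrm{div}\,\boldsymbol{\sigma},\mathrm{div}\,\boldsymbol{\tau})-(\nabla u,\boldsymbol{\tau})=-(f,\mathrm{div}\,\boldsymbol{\tau})&\forall\boldsymbol{\tau}\in\mathbf{H}(\mathrm{div};\Omega)\\ -(\boldsymbol{\sigma},\nabla v)+(\nabla u,\nabla v)=0&\forall v\in H^1_0(\Omega).\end{cases}$$ Its Galerkin approximation $(\boldsymbol{\sigma}_h,u_h)\in\Sigma_h\times U_h$ satisfies the same equations with $\boldsymbol{\sigma},u$ replaced by $\boldsymbol{\sigma}_h,u_h$ and with test functions $\boldsymbol{\tau}\in\Sigma_h$, $v\in U_h$. *)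

theory Defs
  imports "HOL-Analysis.Analysis"
begin

text \<open>Near each boundary point, in coordinates whose last axis is the unit vector \<open>\<nu>\<close>, the set
  lies strictly above the graph of a Lipschitz function defined on the hyperplane orthogonal
  to \<open>\<nu>\<close>.\<close>

definition lipschitz_boundary :: "(real ^ 'n) set \<Rightarrow> bool" where
  "lipschitz_boundary \<Omega> \<longleftrightarrow>
     (\<forall>x \<in> frontier \<Omega>. \<exists>r > 0. \<exists>\<nu> L \<gamma>. norm \<nu> = 1 \<and> L-lipschitz_on {z. z \<bullet> \<nu> = 0} \<gamma> \<and>
        \<Omega> \<inter> ball x r = {y \<in> ball x r. y \<bullet> \<nu> > \<gamma> (y - (y \<bullet> \<nu>) *\<^sub>R \<nu>)})"

definition lipschitz_polyhedral_domain :: "(real ^ 'n) set \<Rightarrow> bool" where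
  "lipschitz_polyhedral_domain \<Omega> \<longleftrightarrow>
     open \<Omega> \<and> connected \<Omega> \<and> bounded \<Omega> \<and> \<Omega> \<noteq> {} \<and> lipschitz_boundary \<Omega> \<and>
     (\<exists>\<P>. finite \<P> \<and> (\<forall>P \<in> \<P>. polytope P) \<and> closure \<Omega> = \<Union>\<P>)"

text \<open>Elements of \<open>L\<^sup>2(\<Omega>)\<close> are represented by functions on the whole space; their values outside
  \<open>\<Omega>\<close> and on null sets are irrelevant. Vector fields are covered by taking values
  in \<open>real ^ 'n\<close>.\<close>

definition L2_space :: "(real ^ 'n) set \<Rightarrow> (real ^ 'n \<Rightarrow> 'b :: euclidean_space) set" where
  "L2_space \<Omega> = {f \<in> borel_measurable (lebesgue_on \<Omega>).
                   integrable (lebesgue_on \<Omega>) (\<lambda>x. (norm (f x))\<^sup>2)}"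

definition L2_inner ::
  "(real ^ 'n) set \<Rightarrow> (real ^ 'n \<Rightarrow> 'b :: euclidean_space) \<Rightarrow> (real ^ 'n \<Rightarrow> 'b) \<Rightarrow> real" where
  "L2_inner \<Omega> f g = (LINT x | lebesgue_on \<Omega>. f x \<bullet> g x)"

definition L2_norm :: "(real ^ 'n) set \<Rightarrow> (real ^ 'n \<Rightarrow> 'b :: euclidean_space) \<Rightarrow> real" where
  "L2_norm \<Omega> f = sqrt (L2_inner \<Omega> f f)"

definition grad :: "(real ^ 'n \<Rightarrow> real) \<Rightarrow> real ^ 'n \<Rightarrow> real ^ 'n" where
  "grad \<phi> x = (\<chi> i. frechet_derivative \<phi> (at x) (axis i 1))"

fun C_k :: "nat \<Rightarrow> (real ^ 'n \<Rightarrow> real) \<Rightarrow> bool" where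
  "C_k 0 \<phi> \<longleftrightarrow> continuous_on UNIV \<phi>"
| "C_k (Suc k) \<phi> \<longleftrightarrow> (\<forall>x. \<phi> differentiable (at x)) \<and> (\<forall>i. C_k k (\<lambda>x. grad \<phi> x $ i))"

definition test_functions :: "(real ^ 'n) set \<Rightarrow> (real ^ 'n \<Rightarrow> real) set" where
  "test_functions \<Omega> =
     {\<phi>. (\<forall>k. C_k k \<phi>) \<and> compact (closure {x. \<phi> x \<noteq> 0}) \<and> closure {x. \<phi> x \<noteq> 0} \<subseteq> \<Omega>}"

definition has_weak_grad ::
  "(real ^ 'n) set \<Rightarrow> (real ^ 'n \<Rightarrow> real) \<Rightarrow> (real ^ 'n \<Rightarrow> real ^ 'n) \<Rightarrow> bool" where
  "has_weak_grad \<Omega> u g \<longleftrightarrow> u \<in> L2_space \<Omega> \<and> g \<in> L2_space \<Omega> \<and>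
     (\<forall>\<phi> \<in> test_functions \<Omega>.
        (LINT x | lebesgue_on \<Omega>. u x *\<^sub>R grad \<phi> x) = - (LINT x | lebesgue_on \<Omega>. \<phi> x *\<^sub>R g x))"

definition has_weak_div ::
  "(real ^ 'n) set \<Rightarrow> (real ^ 'n \<Rightarrow> real ^ 'n) \<Rightarrow> (real ^ 'n \<Rightarrow> real) \<Rightarrow> bool" where
  "has_weak_div \<Omega> \<tau> w \<longleftrightarrow> \<tau> \<in> L2_space \<Omega> \<and> w \<in> L2_space \<Omega> \<and>
     (\<forall>\<phi> \<in> test_functions \<Omega>. L2_inner \<Omega> \<tau> (grad \<phi>) = - L2_inner \<Omega> w \<phi>)"

text \<open>Weak derivatives are unique up to null sets of \<open>\<Omega>\<close>, so the choice below is immaterial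
  whenever a weak derivative exists; otherwise the value is unspecified.\<close>

definition weak_grad :: "(real ^ 'n) set \<Rightarrow> (real ^ 'n \<Rightarrow> real) \<Rightarrow> real ^ 'n \<Rightarrow> real ^ 'n" where
  "weak_grad \<Omega> u = (SOME g. has_weak_grad \<Omega> u g)"

definition weak_div :: "(real ^ 'n) set \<Rightarrow> (real ^ 'n \<Rightarrow> real ^ 'n) \<Rightarrow> real ^ 'n \<Rightarrow> real" where
  "weak_div \<Omega> \<tau> = (SOME w. has_weak_div \<Omega> \<tau> w)"

definition Hdiv :: "(real ^ 'n) set \<Rightarrow> (real ^ 'n \<Rightarrow> real ^ 'n) set" where
  "Hdiv \<Omega> = {\<tau>. \<exists>w. has_weak_div \<Omega> \<tau> w}"

definition Hdiv_norm :: "(real ^ 'n) set \<Rightarrow> (real ^ 'n \<Rightarrow> real ^ 'n) \<Rightarrow> real" where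
  "Hdiv_norm \<Omega> \<tau> = sqrt ((L2_norm \<Omega> \<tau>)\<^sup>2 + (L2_norm \<Omega> (weak_div \<Omega> \<tau>))\<^sup>2)"

text \<open>Square of the Slobodeckij (Gagliardo) seminorm of order \<open>\<theta> \<in> (0,1)\<close>.\<close>

definition slobodeckij :: "(real ^ 'n) set \<Rightarrow> real \<Rightarrow> (real ^ 'n \<Rightarrow> real) \<Rightarrow> ennreal" where
  "slobodeckij \<Omega> \<theta> u =
     (\<integral>\<^sup>+ x. (\<integral>\<^sup>+ y. ennreal ((u x - u y)\<^sup>2 / norm (x - y) powr (real CARD('n) + 2 * \<theta>))
        \<partial>lebesgue_on \<Omega>) \<partial>lebesgue_on \<Omega>)"

text \<open>The order is \<open>m + \<theta>\<close> with \<open>m\<close> a natural number and \<open>\<theta> \<in> [0,1)\<close>, so \<open>sobolev \<Omega> 1\<close> is the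
  usual \<open>H\<^sup>1(\<Omega>)\<close> and \<open>sobolev \<Omega> 2\<close> the usual \<open>H\<^sup>2(\<Omega>)\<close>, with the full Hessian matrix in the norm.\<close>

fun sobolev_mem :: "(real ^ 'n) set \<Rightarrow> nat \<Rightarrow> real \<Rightarrow> (real ^ 'n \<Rightarrow> real) \<Rightarrow> bool" where
  "sobolev_mem \<Omega> 0 \<theta> u \<longleftrightarrow> u \<in> L2_space \<Omega> \<and> (\<theta> > 0 \<longrightarrow> slobodeckij \<Omega> \<theta> u < \<infinity>)"
| "sobolev_mem \<Omega> (Suc m) \<theta> u \<longleftrightarrow>
     (\<exists>g. has_weak_grad \<Omega> u g) \<and> (\<forall>i. sobolev_mem \<Omega> m \<theta> (\<lambda>x. weak_grad \<Omega> u x $ i))"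

fun sobolev_normsq :: "(real ^ 'n) set \<Rightarrow> nat \<Rightarrow> real \<Rightarrow> (real ^ 'n \<Rightarrow> real) \<Rightarrow> real" where
  "sobolev_normsq \<Omega> 0 \<theta> u =
     (L2_norm \<Omega> u)\<^sup>2 + (if \<theta> > 0 then enn2real (slobodeckij \<Omega> \<theta> u) else 0)"
| "sobolev_normsq \<Omega> (Suc m) \<theta> u =
     (L2_norm \<Omega> u)\<^sup>2 + (\<Sum>i\<in>UNIV. sobolev_normsq \<Omega> m \<theta> (\<lambda>x. weak_grad \<Omega> u x $ i))"

definition sobolev :: "(real ^ 'n) set \<Rightarrow> real \<Rightarrow> (real ^ 'n \<Rightarrow> real) set" where
  "sobolev \<Omega> r = {u. sobolev_mem \<Omega> (nat \<lfloor>r\<rfloor>) (frac r) u}"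

definition sobolev_norm :: "(real ^ 'n) set \<Rightarrow> real \<Rightarrow> (real ^ 'n \<Rightarrow> real) \<Rightarrow> real" where
  "sobolev_norm \<Omega> r u = sqrt (sobolev_normsq \<Omega> (nat \<lfloor>r\<rfloor>) (frac r) u)"

definition sobolev_vec :: "(real ^ 'n) set \<Rightarrow> real \<Rightarrow> (real ^ 'n \<Rightarrow> real ^ 'n) set" where
  "sobolev_vec \<Omega> r = {\<tau>. \<forall>i. (\<lambda>x. \<tau> x $ i) \<in> sobolev \<Omega> r}"

definition sobolev_vec_norm :: "(real ^ 'n) set \<Rightarrow> real \<Rightarrow> (real ^ 'n \<Rightarrow> real ^ 'n) \<Rightarrow> real" where
  "sobolev_vec_norm \<Omega> r \<tau> = sqrt (\<Sum>i\<in>UNIV. (sobolev_norm \<Omega> r (\<lambda>x. \<tau> x $ i))\<^sup>2)"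

definition H10 :: "(real ^ 'n) set \<Rightarrow> (real ^ 'n \<Rightarrow> real) set" where
  "H10 \<Omega> = {u \<in> sobolev \<Omega> 1.
     \<forall>\<epsilon> > 0. \<exists>\<phi> \<in> test_functions \<Omega>. sobolev_norm \<Omega> 1 (\<lambda>x. u x - \<phi> x) < \<epsilon>}"

definition poisson_solution ::
  "(real ^ 'n) set \<Rightarrow> (real ^ 'n \<Rightarrow> real) \<Rightarrow> (real ^ 'n \<Rightarrow> real) \<Rightarrow> bool" where
  "poisson_solution \<Omega> f u \<longleftrightarrow> u \<in> H10 \<Omega> \<and>
     (\<forall>v \<in> H10 \<Omega>. L2_inner \<Omega> (weak_grad \<Omega> u) (weak_grad \<Omega> v) = L2_inner \<Omega> f v)"

text \<open>The first order least-squares system with trial and test spaces \<open>S\<close> and \<open>V\<close>: the source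
  problem for \<open>S = Hdiv \<Omega>\<close> and \<open>V = H10 \<Omega>\<close>, its Galerkin approximation for finite dimensional
  subspaces of these.\<close>

definition fosls_solution ::
  "(real ^ 'n) set \<Rightarrow> (real ^ 'n \<Rightarrow> real ^ 'n) set \<Rightarrow> (real ^ 'n \<Rightarrow> real) set \<Rightarrow>
   (real ^ 'n \<Rightarrow> real) \<Rightarrow> (real ^ 'n \<Rightarrow> real ^ 'n) \<Rightarrow> (real ^ 'n \<Rightarrow> real) \<Rightarrow> bool" where
  "fosls_solution \<Omega> S V f \<sigma> u \<longleftrightarrow> \<sigma> \<in> S \<and> u \<in> V \<and>
     (\<forall>\<tau> \<in> S. L2_inner \<Omega> \<sigma> \<tau> + L2_inner \<Omega> (weak_div \<Omega> \<sigma>) (weak_div \<Omega> \<tau>)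
                - L2_inner \<Omega> (weak_grad \<Omega> u) \<tau> = - L2_inner \<Omega> f (weak_div \<Omega> \<tau>)) \<and>
     (\<forall>v \<in> V. - L2_inner \<Omega> \<sigma> (weak_grad \<Omega> v)
                + L2_inner \<Omega> (weak_grad \<Omega> u) (weak_grad \<Omega> v) = 0)"

definition finite_dim_space :: "('a \<Rightarrow> 'b :: real_vector) set \<Rightarrow> bool" where
  "finite_dim_space V \<longleftrightarrow>
     (\<exists>(n :: nat) b. V = {f. \<exists>c :: nat \<Rightarrow> real. f = (\<lambda>x. \<Sum>i<n. c i *\<^sub>R b i x)})"

end

theory Submission imports Defs "HOL-Library.Function_Algebras"
begin

text \<open>Aubin--Nitsche duality. Write \<open>B\<close> for the symmetric bilinear form of the least-squares system.
  For \<open>g = u - u\<^sub>h\<close> the dual problem \<open>B((\<eta>, p), (\<tau>, v)) = (g, v)\<close> decouples into two Poisson problems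
  \<open>- \<Delta>\<psi> = g\<close> and \<open>- \<Delta>q = \<psi>\<close>, with \<open>\<eta> = \<nabla>q\<close>, \<open>p = q + \<psi>\<close> and \<open>div \<eta> = - \<psi>\<close>. Hence
  \<open>\<parallel>g\<parallel>\<^sup>2 = B((\<eta>, p), (\<sigma> - \<sigma>\<^sub>h, u - u\<^sub>h))\<close>, and by Galerkin orthogonality \<open>(\<eta>, p)\<close> may be replaced by its
  error of best approximation, which is \<open>O(h\<^sup>s) \<parallel>g\<parallel>\<close>. The regularity hypothesis gives only that
  solutions belong to \<open>H\<^sup>1\<^sup>+\<^sup>s\<close>; the norm bound \<open>\<parallel>u\<parallel> \<le> C \<parallel>f\<parallel>\<close> in that space comes from a Baire category
  argument on \<open>L\<^sup>2\<close>, using that the \<open>H\<^sup>1\<^sup>+\<^sup>s\<close> norm is lower semicontinuous (by Fatou's lemma for \<open>s < 1\<close>,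
  by duality with test functions for \<open>s = 1\<close>).\<close>

section \<open>Semi-Hilbert spaces\<close>

text \<open>The approximation hypothesis asks three things of the dual solution:
  \<open>\<eta>\<close> in H^s, its divergence in H^(1+s) and \<open>p\<close> in H^(1+s). The
  decoupling supplies all of them because \<open>q\<close>, \<open>- \<psi>\<close> and
  \<open>q + \<psi>\<close> each solve a Poisson problem of their own, with data
  \<open>\<psi>\<close>, \<open>- g\<close> and \<open>\<psi> + g\<close>. One estimate thus serves
  three times, and \<open>\<eta>\<close> inherits its regularity from the derivatives of
  \<open>q\<close>. A second obstacle is that the spaces consist of functions and not of classes
  modulo null sets, and that \<open>weak_grad\<close> and \<open>weak_div\<close> are arbitrary
  choices. Norms are therefore only seminorms, the solution operator is linear only almost
  everywhere, and identities between weak derivatives must be read inside integrals. Hence the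
  Hilbert space theory for semidefinite forms on a carrier set, and the many lemmas that transport a
  property along equality almost everywhere.\<close>

instantiation "fun" :: (type, scaleR) scaleR
begin
definition "scaleR c f = (\<lambda>x. c *\<^sub>R f x)"
instance ..
end

lemma scaleR_fun_apply [simp]: "(c *\<^sub>R f) x = c *\<^sub>R f x"
  by (simp add: scaleR_fun_def)

instance "fun" :: (type, real_vector) real_vector
  by standard (auto simp: fun_eq_iff algebra_simps)

text \<open>The carrier is a set because the function spaces depend on the domain, which no type can
  record. Nothing forces a vector with \<open>ip x x = 0\<close> to vanish, so limits and
  representing vectors are determined only up to null vectors.\<close>

locale semi_inner =
  fixes X :: "'v::real_vector set" and ip :: "'v \<Rightarrow> 'v \<Rightarrow> real"
  assumes subspace: "subspace X"
    and add_left: "x \<in> X \<Longrightarrow> y \<in> X \<Longrightarrow> z \<in> X \<Longrightarrow> ip (x + y) z = ip x z + ip y z"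
    and scale_left: "x \<in> X \<Longrightarrow> z \<in> X \<Longrightarrow> ip (c *\<^sub>R x) z = c * ip x z"
    and commute: "x \<in> X \<Longrightarrow> y \<in> X \<Longrightarrow> ip x y = ip y x"
    and nonneg: "x \<in> X \<Longrightarrow> 0 \<le> ip x x"
begin

definition nrm :: "'v \<Rightarrow> real" where
  "nrm x = sqrt (ip x x)"

lemma mem [intro, simp]:
  "x \<in> X \<Longrightarrow> y \<in> X \<Longrightarrow> x + y \<in> X" "x \<in> X \<Longrightarrow> y \<in> X \<Longrightarrow> x - y \<in> X"
  "x \<in> X \<Longrightarrow> c *\<^sub>R x \<in> X" "0 \<in> X" "x \<in> X \<Longrightarrow> - x \<in> X"
  using subspace
  by (auto simp: subspace_add subspace_diff subspace_scale subspace_0 subspace_neg)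

lemma minus_left: "x \<in> X \<Longrightarrow> z \<in> X \<Longrightarrow> ip (- x) z = - ip x z"
  using scale_left[of x z "-1"] by simp

lemma diff_left: "x \<in> X \<Longrightarrow> y \<in> X \<Longrightarrow> z \<in> X \<Longrightarrow> ip (x - y) z = ip x z - ip y z"
  using add_left[of x "- y" z] by (simp add: minus_left)

lemma add_right: "x \<in> X \<Longrightarrow> y \<in> X \<Longrightarrow> z \<in> X \<Longrightarrow> ip z (x + y) = ip z x + ip z y"
  by (simp add: add_left commute[of z])

lemma diff_right: "x \<in> X \<Longrightarrow> y \<in> X \<Longrightarrow> z \<in> X \<Longrightarrow> ip z (x - y) = ip z x - ip z y"
  by (simp add: diff_left commute[of z])

lemma scale_right: "x \<in> X \<Longrightarrow> z \<in> X \<Longrightarrow> ip z (c *\<^sub>R x) = c * ip z x"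
  by (simp add: scale_left commute[of z])

lemmas bilinear = add_left diff_left scale_left add_right diff_right scale_right

lemma nrm_nonneg [simp]: "x \<in> X \<Longrightarrow> 0 \<le> nrm x"
  by (simp add: nrm_def nonneg)

lemma nrm_sq: "x \<in> X \<Longrightarrow> (nrm x)\<^sup>2 = ip x x"
  by (simp add: nrm_def nonneg)

lemma nrm_scale: "x \<in> X \<Longrightarrow> nrm (c *\<^sub>R x) = \<bar>c\<bar> * nrm x"
  unfolding nrm_def by (simp add: bilinear real_sqrt_mult power2_eq_square flip: mult.assoc)

lemma nrm_zero [simp]: "nrm 0 = 0"
  using nrm_scale[of 0 0] by simp

lemma nrm_minus_commute: "x \<in> X \<Longrightarrow> y \<in> X \<Longrightarrow> nrm (x - y) = nrm (y - x)"
  using nrm_scale[of "y - x" "-1"] by simp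

lemma quadratic_nonneg:
  assumes "x \<in> X" "y \<in> X"
  shows "0 \<le> ip x x + 2 * t * ip x y + t\<^sup>2 * ip y y"
proof -
  have "ip (x + t *\<^sub>R y) (x + t *\<^sub>R y) = ip x x + 2 * t * ip x y + t\<^sup>2 * ip y y"
    using assms by (simp add: bilinear commute[of y x] power2_eq_square algebra_simps)
  with nonneg[of "x + t *\<^sub>R y"] show ?thesis using assms by simp
qed

lemma Cauchy_Schwarz:
  assumes x: "x \<in> X" and y: "y \<in> X"
  shows "\<bar>ip x y\<bar> \<le> nrm x * nrm y"
proof -
  have "(ip x y)\<^sup>2 \<le> ip x x * ip y y"
  proof (cases "ip y y = 0")
    case True
    have "ip x y = 0"
    proof (rule ccontr)
      assume n: "ip x y \<noteq> 0"
      \<comment> \<open>For a null \<open>y\<close> the quadratic is affine in its parameter; this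
        parameter gives it the value -1.\<close>
      have "0 \<le> ip x x + 2 * (- (ip x x + 1) / (2 * ip x y)) * ip x y"
        using quadratic_nonneg[OF x y, of "- (ip x x + 1) / (2 * ip x y)"] True by simp
      then show False using n by (simp add: field_simps)
    qed
    then show ?thesis using True by simp
  next
    case False
    then have p: "ip y y > 0" using nonneg[OF y] by simp
    have "0 \<le> ip x x + 2 * (- ip x y / ip y y) * ip x y + (- ip x y / ip y y)\<^sup>2 * ip y y"
      by (rule quadratic_nonneg[OF x y])
    also have "\<dots> = ip x x - (ip x y)\<^sup>2 / ip y y"
      using p by (simp add: power2_eq_square field_simps)
    finally show ?thesis using p by (simp add: field_simps)
  qed
  then have "sqrt ((ip x y)\<^sup>2) \<le> sqrt (ip x x * ip y y)" by (rule real_sqrt_le_mono)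
  then show ?thesis by (simp add: nrm_def real_sqrt_mult)
qed

lemma nrm_triangle:
  assumes x: "x \<in> X" and y: "y \<in> X"
  shows "nrm (x + y) \<le> nrm x + nrm y"
proof (rule power2_le_imp_le)
  have "(nrm (x + y))\<^sup>2 = (nrm x)\<^sup>2 + 2 * ip x y + (nrm y)\<^sup>2"
    using x y by (simp add: nrm_sq bilinear commute[of y x])
  also have "\<dots> \<le> (nrm x + nrm y)\<^sup>2"
    using Cauchy_Schwarz[OF x y] by (simp add: power2_sum)
  finally show "(nrm (x + y))\<^sup>2 \<le> (nrm x + nrm y)\<^sup>2" .
qed (use x y in auto)

lemma nrm_triangle_diff:
  assumes "x \<in> X" "y \<in> X" "z \<in> X"
  shows "nrm (x - z) \<le> nrm (x - y) + nrm (y - z)"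
  using nrm_triangle[of "x - y" "y - z"] assms by simp

lemma nrm_diff_le:
  assumes "x \<in> X" "y \<in> X"
  shows "\<bar>nrm x - nrm y\<bar> \<le> nrm (x - y)"
  using nrm_triangle[of "x - y" y] nrm_triangle[of "y - x" x] nrm_minus_commute[of x y] assms
  by auto

lemma tendsto_ip:
  assumes "\<And>n. f n \<in> X" "x \<in> X" "y \<in> X" "(\<lambda>n. nrm (f n - x)) \<longlonglongrightarrow> 0"
  shows "(\<lambda>n. ip (f n) y) \<longlonglongrightarrow> ip x y"
proof (rule LIM_zero_cancel, rule Lim_null_comparison[where g = "\<lambda>n. nrm (f n - x) * nrm y"])
  show "\<forall>\<^sub>F n in sequentially. norm (ip (f n) y - ip x y) \<le> nrm (f n - x) * nrm y"
    using Cauchy_Schwarz[of "f _ - x" y] assms by (simp add: bilinear)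
qed (use tendsto_mult_left_zero[OF assms(4)] in auto)

lemma tendsto_nrm:
  assumes "\<And>n. f n \<in> X" "x \<in> X" "(\<lambda>n. nrm (f n - x)) \<longlonglongrightarrow> 0"
  shows "(\<lambda>n. nrm (f n)) \<longlonglongrightarrow> nrm x"
proof (rule LIM_zero_cancel, rule Lim_null_comparison[where g = "\<lambda>n. nrm (f n - x)"])
  show "\<forall>\<^sub>F n in sequentially. norm (nrm (f n) - nrm x) \<le> nrm (f n - x)"
    using nrm_diff_le assms by simp
qed (use assms in auto)

end

locale semi_hilbert = semi_inner +
  assumes complete:
    "\<And>f :: nat \<Rightarrow> 'a. (\<And>n. f n \<in> X) \<Longrightarrow>
       (\<And>e. e > 0 \<Longrightarrow> \<exists>N. \<forall>m\<ge>N. \<forall>n\<ge>N. sqrt (ip (f m - f n) (f m - f n)) < e) \<Longrightarrow>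
       \<exists>x\<in>X. (\<lambda>n. sqrt (ip (f n - x) (f n - x))) \<longlonglongrightarrow> 0"
begin

lemma complete_nrm:
  fixes f :: "nat \<Rightarrow> 'a"
  assumes "\<And>n. f n \<in> X" and "\<And>e. e > 0 \<Longrightarrow> \<exists>N. \<forall>m\<ge>N. \<forall>n\<ge>N. nrm (f m - f n) < e"
  obtains x where "x \<in> X" "(\<lambda>n. nrm (f n - x)) \<longlonglongrightarrow> 0"
  using complete[of f] assms unfolding nrm_def by blast

text \<open>The representing vector is the limit in \<open>X\<close> of a minimising sequence in \<open>M\<close> of
  \<open>m \<mapsto> \<parallel>m\<parallel>\<^sup>2 - 2 F m\<close>; the subspace \<open>M\<close> need not be closed.\<close>

lemma Riesz_representation:
  assumes M: "subspace M" "M \<subseteq> X"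
    and F_add: "\<And>x y. x \<in> M \<Longrightarrow> y \<in> M \<Longrightarrow> F (x + y) = F x + F y"
    and F_scale: "\<And>c x. x \<in> M \<Longrightarrow> F (c *\<^sub>R x) = c * F x"
    and bound: "\<And>x. x \<in> M \<Longrightarrow> \<bar>F x\<bar> \<le> c * nrm x"
  obtains z where "z \<in> X" "\<And>x. x \<in> M \<Longrightarrow> ip z x = F x" "nrm z \<le> \<bar>c\<bar>"
proof -
  define J where "J m = (nrm m)\<^sup>2 - 2 * F m" for m
  define d where "d = (INF m\<in>M. J m)"
  have MX: "m \<in> X" if "m \<in> M" for m using that M by auto
  have M0: "0 \<in> M" using M subspace_0 by blast
  \<comment> \<open>Completing the square: \<open>J m\<close> is at least the square of
    \<open>nrm m\<close> minus \<open>2 * c * nrm m\<close>.\<close>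
  have J_lb: "- c\<^sup>2 \<le> J m" if "m \<in> M" for m
  proof -
    have "0 \<le> (nrm m - c)\<^sup>2" by simp
    then show ?thesis using bound[OF that] unfolding J_def power2_diff by (simp add: algebra_simps)
  qed
  then have bdd: "bdd_below (J ` M)" by (auto intro!: bdd_belowI)
  have d_le: "d \<le> J m" if "m \<in> M" for m unfolding d_def using bdd that by (rule cINF_lower)
  have "\<exists>m\<in>M. J m < d + 1 / real (Suc k)" for k
    using cINF_less_iff[OF _ bdd, of "d + 1 / real (Suc k)"] M0 unfolding d_def by auto
  then obtain m where m: "\<And>k. m k \<in> M" and Jm: "\<And>k. J (m k) < d + 1 / real (Suc k)"
    by metis
  have mX: "m k \<in> X" for k using m MX by blast
  \<comment> \<open>The midpoint of \<open>m i\<close> and \<open>m j\<close> lies in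
    \<open>M\<close>, so \<open>J\<close> is at least \<open>d\<close> there; the parallelogram law
    turns this into a bound on the distance.\<close>
  have cauchy: "(nrm (m i - m j))\<^sup>2 \<le> 2 / real (Suc i) + 2 / real (Suc j)" for i j
  proof -
    have "(1/2) *\<^sub>R (m i + m j) \<in> M" using m M by (simp add: subspace_add subspace_scale)
    then have "d \<le> J ((1/2) *\<^sub>R (m i + m j))" by (rule d_le)
    moreover have "(nrm (m i - m j))\<^sup>2 = 2 * J (m i) + 2 * J (m j) - 4 * J ((1/2) *\<^sub>R (m i + m j))"
    proof -
      have "F ((1/2) *\<^sub>R (m i + m j)) = (F (m i) + F (m j)) / 2"
        using m M F_scale[of "m i + m j" "1/2"] by (simp add: F_add subspace_add)
      moreover have "(nrm ((1/2) *\<^sub>R (m i + m j)))\<^sup>2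
          = (ip (m i) (m i) + 2 * ip (m i) (m j) + ip (m j) (m j)) / 4"
      proof -
        have "(nrm ((1/2) *\<^sub>R (m i + m j)))\<^sup>2 = (1/2)\<^sup>2 * ip (m i + m j) (m i + m j)"
          using mX by (simp add: nrm_scale nrm_sq power_mult_distrib power_divide)
        also have "ip (m i + m j) (m i + m j) = ip (m i) (m i) + 2 * ip (m i) (m j) + ip (m j) (m j)"
          using mX by (simp add: bilinear commute[of "m j" "m i"])
        finally show ?thesis by (simp add: power_divide)
      qed
      moreover have "(nrm (m i - m j))\<^sup>2 = ip (m i) (m i) - 2 * ip (m i) (m j) + ip (m j) (m j)"
        using mX by (simp add: nrm_sq bilinear commute[of "m j" "m i"])
      ultimately show ?thesis unfolding J_def nrm_sq[OF mX] by argo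
    qed
    ultimately show ?thesis using Jm[of i] Jm[of j] by simp
  qed
  have "\<exists>N. \<forall>i\<ge>N. \<forall>j\<ge>N. nrm (m i - m j) < e" if "e > 0" for e
  proof -
    obtain N where N: "4 / e\<^sup>2 < real N" using reals_Archimedean2 by blast
    have "nrm (m i - m j) < e" if "i \<ge> N" "j \<ge> N" for i j
    proof (rule power2_less_imp_less)
      have N0: "0 < real N" using N \<open>e > 0\<close> by (meson divide_nonneg_nonneg less_le_trans not_le zero_le_numeral zero_le_power2)
      have "(nrm (m i - m j))\<^sup>2 \<le> 2 / real (Suc i) + 2 / real (Suc j)" by (rule cauchy)
      also have "\<dots> \<le> 2 / real N + 2 / real N"
        using that N0 by (intro add_mono divide_left_mono) auto
      also have "\<dots> < e\<^sup>2" using N N0 \<open>e > 0\<close> by (simp add: field_simps)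
      finally show "(nrm (m i - m j))\<^sup>2 < e\<^sup>2" .
    qed (use \<open>e > 0\<close> in auto)
    then show ?thesis by blast
  qed
  then obtain z where z: "z \<in> X" and lim: "(\<lambda>k. nrm (m k - z)) \<longlonglongrightarrow> 0"
    using complete_nrm[of m] mX by blast
  have rep: "ip z x = F x" if x: "x \<in> M" for x
  proof -
    \<comment> \<open>\<open>q\<close> majorises \<open>ip x x\<close> and is positive even for a
      null \<open>x\<close>. Below, \<open>a k\<close> is half the slope of \<open>J\<close> at
      \<open>m k\<close> in the direction \<open>x\<close>; the step \<open>t\<close> that minimises
      the majorant cannot lower \<open>J (m k)\<close> by more than its excess over
      \<open>d\<close>.\<close>
    define q where "q = ip x x + 1"
    define a where "a k = ip (m k) x - F x" for k
    have q: "q > 0" "ip x x \<le> q" using nonneg[OF MX[OF x]] by (auto simp: q_def)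
    have a_sq: "(a k)\<^sup>2 \<le> q / real (Suc k)" for k
    proof -
      define t where "t = - a k / q"
      have "m k + t *\<^sub>R x \<in> M" using m x M by (simp add: subspace_add subspace_scale)
      then have "d \<le> J (m k + t *\<^sub>R x)" by (rule d_le)
      also have "\<dots> = J (m k) + 2 * t * a k + t\<^sup>2 * ip x x"
      proof -
        have "(nrm (m k + t *\<^sub>R x))\<^sup>2 = (nrm (m k))\<^sup>2 + 2 * t * ip (m k) x + t\<^sup>2 * ip x x"
          using mX MX[OF x] by (simp add: nrm_sq bilinear commute[of x "m k"])
            (simp add: power2_eq_square algebra_simps)
        moreover have "F (m k + t *\<^sub>R x) = F (m k) + t * F x"
          using m x M by (simp add: F_add F_scale subspace_scale)
        ultimately show ?thesis by (simp add: J_def a_def algebra_simps)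
      qed
      also have "\<dots> \<le> J (m k) + 2 * t * a k + t\<^sup>2 * q"
        using q by (simp add: mult_left_mono)
      also have "\<dots> = J (m k) - (a k)\<^sup>2 / q"
        using q by (simp add: t_def power2_eq_square field_simps)
      finally have "(a k)\<^sup>2 / q < 1 / real (Suc k)" using Jm[of k] by simp
      then show ?thesis using q by (simp add: field_simps)
    qed
    have "(\<lambda>k. q / real (Suc k)) \<longlonglongrightarrow> 0"
      using tendsto_mult_right_zero[OF LIMSEQ_inverse_real_of_nat, of q] by (simp add: divide_inverse)
    then have "(\<lambda>k. (a k)\<^sup>2) \<longlonglongrightarrow> 0"
      by (rule Lim_null_comparison[rotated]) (use a_sq in auto)
    then have "a \<longlonglongrightarrow> 0" by (simp add: tendsto_null_power)
    then have "(\<lambda>k. ip (m k) x) \<longlonglongrightarrow> F x" unfolding a_def by (rule LIM_zero_cancel)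
    with tendsto_ip[OF mX z MX[OF x] lim] show ?thesis by (rule LIMSEQ_unique[THEN sym, rotated]) 
  qed
  \<comment> \<open>\<open>z\<close> need not lie in \<open>M\<close>, so the bound on
    \<open>F\<close> is used along the minimising sequence.\<close>
  have "ip z z \<le> \<bar>c\<bar> * nrm z"
  proof (rule LIMSEQ_le)
    show "(\<lambda>k. ip (m k) z) \<longlonglongrightarrow> ip z z" by (rule tendsto_ip[OF mX z z lim])
    show "(\<lambda>k. \<bar>c\<bar> * nrm (m k)) \<longlonglongrightarrow> \<bar>c\<bar> * nrm z"
      by (intro tendsto_intros tendsto_nrm mX z lim)
    have "ip (m k) z \<le> \<bar>c\<bar> * nrm (m k)" for k
    proof -
      have "ip (m k) z = F (m k)" using rep[OF m] commute[OF mX z] by simp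
      also have "\<dots> \<le> c * nrm (m k)" using bound[OF m, of k] by simp
      also have "\<dots> \<le> \<bar>c\<bar> * nrm (m k)" using mX by (intro mult_right_mono) auto
      finally show ?thesis .
    qed
    then show "\<exists>N. \<forall>n\<ge>N. ip (m n) z \<le> \<bar>c\<bar> * nrm (m n)" by blast
  qed
  then have "nrm z * nrm z \<le> \<bar>c\<bar> * nrm z" using nrm_sq[OF z] by (simp add: power2_eq_square)
  then have "nrm z \<le> \<bar>c\<bar>" using z nrm_nonneg[OF z] by (cases "nrm z = 0") (auto simp: mult_le_cancel_right)
  with z rep that show thesis by blast
qed

text \<open>On \<open>M\<close> the functional \<open>ip z\<close> has a representative
  \<open>y\<close> of norm at most \<open>\<bar>c\<bar>\<close>, and \<open>z - y\<close> is
  orthogonal to \<open>M\<close>, hence null. Density is phrased through the orthogonal complement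
  because this is the form in which the fundamental lemma of the calculus of variations provides
  it.\<close>

lemma nrm_le_of_dense:
  assumes M: "subspace M" "M \<subseteq> X"
    and dense: "\<And>x. x \<in> X \<Longrightarrow> (\<And>m. m \<in> M \<Longrightarrow> ip x m = 0) \<Longrightarrow> nrm x = 0"
    and z: "z \<in> X" and bound: "\<And>m. m \<in> M \<Longrightarrow> \<bar>ip z m\<bar> \<le> c * nrm m"
  shows "nrm z \<le> \<bar>c\<bar>"
proof -
  have MX: "m \<in> X" if "m \<in> M" for m using that M by auto
  obtain y where y: "y \<in> X" "\<And>m. m \<in> M \<Longrightarrow> ip y m = ip z m" "nrm y \<le> \<bar>c\<bar>"
    by (rule Riesz_representation[OF M, of "ip z" c])
      (use z MX in \<open>auto simp: bilinear intro: bound\<close>)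
  have "nrm (z - y) = 0" by (rule dense) (use y z MX in \<open>auto simp: bilinear\<close>)
  then show ?thesis using nrm_triangle[of "z - y" y] y z by auto
qed

text \<open>A version of Gelfand's lemma. A lower semicontinuous, everywhere finite \<open>Q\<close> which failed to
  be bounded on every ball would be larger than \<open>k\<close> on the \<open>k\<close>-th of a sequence of shrinking nested
  balls, hence infinite at their common point.\<close>

lemma lower_semicontinuous_quadratic_bounded:
  fixes Q :: "'a \<Rightarrow> real"
  assumes Q_nonneg: "\<And>x. x \<in> X \<Longrightarrow> 0 \<le> Q x"
    and Q_diff: "\<And>x y. x \<in> X \<Longrightarrow> y \<in> X \<Longrightarrow> Q (x - y) \<le> 2 * (Q x + Q y)"
    and Q_scale: "\<And>c x. x \<in> X \<Longrightarrow> Q (c *\<^sub>R x) = c\<^sup>2 * Q x"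
    and lsc: "\<And>f x c. (\<And>n. f n \<in> X) \<Longrightarrow> x \<in> X \<Longrightarrow> (\<lambda>n. nrm (f n - x)) \<longlonglongrightarrow> 0 \<Longrightarrow>
                (\<And>n. Q (f n) \<le> c) \<Longrightarrow> Q x \<le> c"
  obtains C where "C \<ge> 0" "\<And>x. x \<in> X \<Longrightarrow> Q x \<le> C * (nrm x)\<^sup>2"
proof -
  \<comment> \<open>Lower semicontinuity means that the sets where \<open>Q\<close> exceeds
    \<open>k\<close> are open.\<close>
  have opn: "\<exists>r>0. \<forall>y\<in>X. nrm (y - x) \<le> r \<longrightarrow> k < Q y" if x: "x \<in> X" "k < Q x" for x k
  proof (rule ccontr)
    assume "\<not> ?thesis"
    then have "\<forall>n::nat. \<exists>y. y \<in> X \<and> nrm (y - x) \<le> 1 / real (Suc n) \<and> Q y \<le> k"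
      by (metis not_le of_nat_0_less_iff zero_less_Suc zero_less_divide_1_iff)
    then obtain y where y: "\<And>n. y n \<in> X" "\<And>n. nrm (y n - x) \<le> 1 / real (Suc n)" "\<And>n. Q (y n) \<le> k"
      by metis
    have "(\<lambda>n. nrm (y n - x)) \<longlonglongrightarrow> 0"
      by (rule Lim_null_comparison[OF _ LIMSEQ_inverse_real_of_nat])
        (use y x in \<open>auto simp: inverse_eq_divide\<close>)
    from lsc[OF y(1) x(1) this y(3)] show False using x by simp
  qed
  obtain x0 r M where x0: "x0 \<in> X" and r: "r > 0"
    and M: "\<And>y. y \<in> X \<Longrightarrow> nrm (y - x0) \<le> r \<Longrightarrow> Q y \<le> M"
  proof (rule ccontr)
    assume "\<not> thesis"
    then have unb: "\<exists>y\<in>X. nrm (y - x) \<le> r \<and> M < Q y" if "x \<in> X" "r > 0" for x r M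
      using that not_le \<open>\<not> thesis\<close> \<open>\<And>x0 r M. \<lbrakk>x0 \<in> X; r > 0; \<And>y. y \<in> X \<Longrightarrow> nrm (y - x0) \<le> r \<Longrightarrow> Q y \<le> M\<rbrakk> \<Longrightarrow> thesis\<close>
      by metis
    \<comment> \<open>The pair \<open>p\<close> is a closed ball, given by centre and radius, on
      which \<open>Q\<close> exceeds \<open>k\<close>; the radius is capped so that the centres
      become a Cauchy sequence.\<close>
    define P where "P k p \<longleftrightarrow> fst p \<in> X \<and> 0 < snd p \<and> snd p \<le> 1 / real (Suc k)
        \<and> (\<forall>w\<in>X. nrm (w - fst p) \<le> snd p \<longrightarrow> real k < Q w)" for k :: nat and p :: "'a \<times> real"
    have step: "\<exists>q. P k q \<and> nrm (fst q - x) + snd q \<le> \<rho>" if x: "x \<in> X" "\<rho> > 0" for x \<rho> k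
    proof -
      obtain y where y: "y \<in> X" "nrm (y - x) \<le> \<rho> / 2" "real k < Q y"
        using unb[OF x(1), of "\<rho> / 2" "real k"] x by auto
      obtain s where s: "s > 0" "\<forall>w\<in>X. nrm (w - y) \<le> s \<longrightarrow> real k < Q w"
        using opn[OF y(1) y(3)] by blast
      have "P k (y, min s (min (\<rho> / 2) (1 / real (Suc k))))"
        unfolding P_def using y s x by auto
      moreover have "nrm (y - x) + min s (min (\<rho> / 2) (1 / real (Suc k))) \<le> \<rho>" using y by linarith
      ultimately show ?thesis by (metis fst_conv snd_conv)
    qed
    have "\<exists>p. \<forall>k. P k (p k) \<and> nrm (fst (p (Suc k)) - fst (p k)) + snd (p (Suc k)) \<le> snd (p k)"
    proof (rule dependent_nat_choice)
      show "\<exists>p. P 0 p" using step[of 0 1 0] by auto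
      show "\<exists>q. P (Suc k) q \<and> nrm (fst q - fst p) + snd q \<le> snd p" if "P k p" for p k
        using that step[of "fst p" "snd p" "Suc k"] unfolding P_def by blast
    qed
    then obtain p where p: "\<And>k. P k (p k)"
      and nest: "\<And>k. nrm (fst (p (Suc k)) - fst (p k)) + snd (p (Suc k)) \<le> snd (p k)" by blast
    define c where "c k = fst (p k)" for k
    define \<rho> where "\<rho> k = snd (p k)" for k
    have c: "c k \<in> X" and \<rho>: "0 < \<rho> k" "\<rho> k \<le> 1 / real (Suc k)"
      and big: "\<And>w. w \<in> X \<Longrightarrow> nrm (w - c k) \<le> \<rho> k \<Longrightarrow> real k < Q w" for k
      using p[of k] by (auto simp: P_def c_def \<rho>_def)
    \<comment> \<open>Distance of the centres plus the later radius telescopes; the inequality says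
      that the later ball lies inside the earlier one.\<close>
    have dist: "nrm (c (m + j) - c m) + \<rho> (m + j) \<le> \<rho> m" for m j
    proof (induction j)
      case 0
      then show ?case by simp
    next
      case (Suc j)
      then show ?case
        using nest[of "m + j"] nrm_triangle_diff[of "c (Suc (m + j))" "c (m + j)" "c m"] c
        by (fastforce simp: c_def \<rho>_def)
    qed
    then have dist': "nrm (c n - c m) \<le> \<rho> m" if "m \<le> n" for m n
      using \<rho>(1)[of n] that dist[of m "n - m"] by auto
    have "\<exists>N. \<forall>m\<ge>N. \<forall>n\<ge>N. nrm (c m - c n) < e" if "e > 0" for e
    proof -
      obtain N where N: "2 / e < real N" using reals_Archimedean2 by blast
      have "\<rho> N < e / 2"
      proof -
        have "2 < e * real N" using N that by (simp add: field_simps)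
        then have "1 / real (Suc N) < e / 2" using that by (simp add: field_simps)
        then show ?thesis using \<rho>(2)[of N] by simp
      qed
      then have "nrm (c m - c n) < e" if "m \<ge> N" "n \<ge> N" for m n
        using nrm_triangle_diff[of "c m" "c N" "c n"] nrm_minus_commute[of "c N" "c n"] c
          dist'[OF that(1)] dist'[OF that(2)] by fastforce
      then show ?thesis by blast
    qed
    then obtain x where x: "x \<in> X" and lim: "(\<lambda>k. nrm (c k - x)) \<longlonglongrightarrow> 0"
      using complete_nrm[of c] c by blast
    have "real k < Q x" for k
    proof (rule big[OF x])
      have "nrm (x - c k) \<le> nrm (c n - x) + \<rho> k" if "n \<ge> k" for n
        using nrm_triangle_diff[of x "c n" "c k"] nrm_minus_commute[of "c n" x] c x dist'[OF that]
        by fastforce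
      moreover have "(\<lambda>n. nrm (c n - x) + \<rho> k) \<longlonglongrightarrow> 0 + \<rho> k"
        by (intro tendsto_intros lim)
      ultimately show "nrm (x - c k) \<le> \<rho> k"
        using LIMSEQ_le_const[of "\<lambda>n. nrm (c n - x) + \<rho> k" "\<rho> k" "nrm (x - c k)"] by auto
    qed
    then show False using reals_Archimedean2[of "Q x"] by (meson less_asym)
  qed
  have M0: "0 \<le> M" using M[of x0] Q_nonneg[of x0] x0 r by simp
  \<comment> \<open>Writing \<open>y\<close> as \<open>(x0 + y) - x0\<close> moves the bound from
    the ball around \<open>x0\<close> to the one around the origin; \<open>Q_diff\<close> with two
    values at most \<open>M\<close> gives \<open>4 * M\<close>.\<close>
  have ball: "Q y \<le> 4 * M" if "y \<in> X" "nrm y \<le> r" for y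
    using Q_diff[of "x0 + y" x0] M[of "x0 + y"] M[of x0] that x0 r by auto
  show thesis
  proof (rule that)
    show "0 \<le> 4 * M / r\<^sup>2" using M0 by simp
    show "Q x \<le> 4 * M / r\<^sup>2 * (nrm x)\<^sup>2" if x: "x \<in> X" for x
    proof (cases "nrm x = 0")
      case True
      \<comment> \<open>All multiples of a null \<open>x\<close> stay in the ball, while
        \<open>Q\<close> grows quadratically along them.\<close>
      have small: "t\<^sup>2 * Q x \<le> 4 * M" for t
        using ball[of "t *\<^sub>R x"] x r by (simp add: nrm_scale True Q_scale)
      have "Q x = 0"
      proof (rule ccontr)
        assume "Q x \<noteq> 0"
        then have pos: "Q x > 0" using Q_nonneg[OF x] by simp
        then show False using small[of "sqrt ((4 * M + 1) / Q x)"] M0 by simp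
      qed
      then show ?thesis using M0 by simp
    next
      case False
      then have pos: "nrm x > 0" using nrm_nonneg[OF x] by linarith
      have "(r / nrm x)\<^sup>2 * Q x \<le> 4 * M"
        using ball[of "(r / nrm x) *\<^sub>R x"] x r pos by (simp add: nrm_scale Q_scale)
      then show ?thesis using r pos by (simp add: field_simps power2_eq_square)
    qed
  qed
qed

end

section \<open>The space of square integrable functions\<close>

lemma L2_spaceD:
  assumes "f \<in> L2_space \<Omega>"
  shows "f \<in> borel_measurable (lebesgue_on \<Omega>)" "integrable (lebesgue_on \<Omega>) (\<lambda>x. (norm (f x))\<^sup>2)"
  using assms by (auto simp: L2_space_def)

lemma L2_spaceI_bound:
  assumes "f \<in> borel_measurable (lebesgue_on \<Omega>)" "integrable (lebesgue_on \<Omega>) k"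
    and "AE x in lebesgue_on \<Omega>. (norm (f x))\<^sup>2 \<le> k x"
  shows "f \<in> L2_space \<Omega>"
proof -
  have "integrable (lebesgue_on \<Omega>) (\<lambda>x. (norm (f x))\<^sup>2)"
    by (rule Bochner_Integration.integrable_bound[OF assms(2)]) (use assms in \<open>auto elim!: AE_mp\<close>)
  then show ?thesis using assms by (simp add: L2_space_def)
qed

lemma subspace_L2_space: "subspace (L2_space \<Omega> :: (real ^ 'n \<Rightarrow> 'b :: euclidean_space) set)"
proof (rule subspaceI)
  show "0 \<in> (L2_space \<Omega> :: (real ^ 'n \<Rightarrow> 'b) set)" by (simp add: L2_space_def zero_fun_def)
next
  fix f g :: "real ^ 'n \<Rightarrow> 'b"
  assume fg: "f \<in> L2_space \<Omega>" "g \<in> L2_space \<Omega>"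
  have "(norm (f x + g x))\<^sup>2 \<le> 2 * (norm (f x))\<^sup>2 + 2 * (norm (g x))\<^sup>2" for x
  proof -
    have "(norm (f x + g x))\<^sup>2 \<le> (norm (f x) + norm (g x))\<^sup>2"
      by (intro power_mono norm_triangle_ineq norm_ge_zero)
    also have "\<dots> \<le> 2 * (norm (f x))\<^sup>2 + 2 * (norm (g x))\<^sup>2"
      using sum_squares_bound[of "norm (f x)" "norm (g x)"] by (simp add: power2_sum)
    finally show ?thesis .
  qed
  then show "f + g \<in> L2_space \<Omega>"
    using fg by (intro L2_spaceI_bound[where k = "\<lambda>x. 2 * (norm (f x))\<^sup>2 + 2 * (norm (g x))\<^sup>2"])
      (use L2_spaceD[OF fg(1)] L2_spaceD[OF fg(2)] in \<open>auto simp: plus_fun_def intro!: AE_I2\<close>)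
next
  fix c and f :: "real ^ 'n \<Rightarrow> 'b"
  assume f: "f \<in> L2_space \<Omega>"
  then show "c *\<^sub>R f \<in> L2_space \<Omega>"
    by (auto simp: L2_space_def scaleR_fun_def power_mult_distrib)
qed

lemma integrable_L2_inner:
  fixes f g :: "real ^ 'n \<Rightarrow> 'b :: euclidean_space"
  assumes f: "f \<in> L2_space \<Omega>" and g: "g \<in> L2_space \<Omega>"
  shows "integrable (lebesgue_on \<Omega>) (\<lambda>x. f x \<bullet> g x)"
proof (rule Bochner_Integration.integrable_bound)
  show "integrable (lebesgue_on \<Omega>) (\<lambda>x. (norm (f x))\<^sup>2 + (norm (g x))\<^sup>2)"
    using L2_spaceD[OF f] L2_spaceD[OF g] by simp
  have "\<bar>f x \<bullet> g x\<bar> \<le> (norm (f x))\<^sup>2 + (norm (g x))\<^sup>2" for x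
  proof -
    have "2 * (norm (f x) * norm (g x)) \<le> (norm (f x))\<^sup>2 + (norm (g x))\<^sup>2"
      using sum_squares_bound[of "norm (f x)" "norm (g x)"] by simp
    moreover have "0 \<le> norm (f x) * norm (g x)" by simp
    ultimately show ?thesis using Cauchy_Schwarz_ineq2[of "f x" "g x"] by linarith
  qed
  then show "AE x in lebesgue_on \<Omega>. norm (f x \<bullet> g x) \<le> norm ((norm (f x))\<^sup>2 + (norm (g x))\<^sup>2)"
    by (intro AE_I2) (auto intro: order_trans[OF _ abs_ge_self])
qed (use L2_spaceD[OF f] L2_spaceD[OF g] in auto)

text \<open>Valid for an arbitrary set \<open>\<Omega>\<close>. Completeness uses a domain of finite
  measure and is added separately by \<open>semi_hilbert_L2\<close>.\<close>

interpretation L2: semi_inner "L2_space \<Omega> :: (real ^ 'n \<Rightarrow> 'b :: euclidean_space) set" "L2_inner \<Omega>"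
  rewrites "semi_inner.nrm (L2_inner \<Omega>) = L2_norm \<Omega>"
proof -
  show *: "semi_inner (L2_space \<Omega> :: (real ^ 'n \<Rightarrow> 'b) set) (L2_inner \<Omega>)"
    by unfold_locales
      (auto simp: L2_inner_def subspace_L2_space inner_add_left integrable_L2_inner,
        simp add: inner_commute)
  show "semi_inner.nrm (L2_inner \<Omega>) = (L2_norm \<Omega> :: (real ^ 'n \<Rightarrow> 'b) \<Rightarrow> real)"
    by (auto simp: fun_eq_iff L2_norm_def semi_inner.nrm_def[OF *])
qed

lemma L2_norm_sq: "(L2_norm \<Omega> f)\<^sup>2 = (LINT x | lebesgue_on \<Omega>. (norm (f x))\<^sup>2)"
  unfolding L2_norm_def L2_inner_def by (simp add: power2_norm_eq_inner)

lemma L2_inner_cong_AE: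
  assumes "f \<in> borel_measurable (lebesgue_on \<Omega>)" "f' \<in> borel_measurable (lebesgue_on \<Omega>)"
    "g \<in> borel_measurable (lebesgue_on \<Omega>)" "g' \<in> borel_measurable (lebesgue_on \<Omega>)"
    and "AE x in lebesgue_on \<Omega>. f x = f' x" "AE x in lebesgue_on \<Omega>. g x = g' x"
  shows "L2_inner \<Omega> f g = L2_inner \<Omega> f' g'"
  unfolding L2_inner_def by (rule integral_cong_AE) (use assms in auto)

lemma L2_norm_cong_AE:
  assumes "f \<in> borel_measurable (lebesgue_on \<Omega>)" "f' \<in> borel_measurable (lebesgue_on \<Omega>)"
    and "AE x in lebesgue_on \<Omega>. f x = f' x"
  shows "L2_norm \<Omega> f = L2_norm \<Omega> f'"
  unfolding L2_norm_def using L2_inner_cong_AE[OF assms(1,2,1,2,3,3)] by simp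

lemma L2_norm_eq_0_AE:
  assumes f: "f \<in> L2_space \<Omega>" and "L2_norm \<Omega> f = 0"
  shows "AE x in lebesgue_on \<Omega>. f x = 0"
  using assms L2_norm_sq[of \<Omega> f] L2_spaceD[OF f]
  by (simp add: integral_nonneg_eq_0_iff_AE)

lemma L2_norm_component_sum:
  fixes f :: "real ^ 'n \<Rightarrow> real ^ 'm"
  assumes f: "f \<in> L2_space \<Omega>"
  shows "(L2_norm \<Omega> f)\<^sup>2 = (\<Sum>i\<in>UNIV. (L2_norm \<Omega> (\<lambda>x. f x $ i))\<^sup>2)"
    and "(\<lambda>x. f x $ i) \<in> L2_space \<Omega>"
proof -
  have comp: "(\<lambda>x. f x $ i) \<in> L2_space \<Omega>" for i
  proof (rule L2_spaceI_bound)
    show "AE x in lebesgue_on \<Omega>. (norm (f x $ i))\<^sup>2 \<le> (norm (f x))\<^sup>2"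
      by (intro AE_I2 power_mono) (auto intro: component_le_norm_cart)
    show "(\<lambda>x. f x $ i) \<in> borel_measurable (lebesgue_on \<Omega>)"
      using L2_spaceD(1)[OF f] by (simp add: cart_eq_inner_axis)
  qed (use L2_spaceD[OF f] in auto)
  show "(\<lambda>x. f x $ i) \<in> L2_space \<Omega>" by (rule comp)
  show "(L2_norm \<Omega> f)\<^sup>2 = (\<Sum>i\<in>UNIV. (L2_norm \<Omega> (\<lambda>x. f x $ i))\<^sup>2)"
    unfolding L2_norm_sq using L2_spaceD(2)[OF comp]
    by (simp add: norm_vec_def L2_set_def sum_nonneg)
qed

text \<open>Square integrability of the limit is a conclusion here: this is how
  \<open>L2_complete\<close> places its pointwise limit in the space.\<close>

lemma L2_Fatou:
  fixes f :: "nat \<Rightarrow> real ^ 'n \<Rightarrow> 'b :: euclidean_space"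
  assumes f: "\<And>k. f k \<in> L2_space \<Omega>" and F: "F \<in> borel_measurable (lebesgue_on \<Omega>)"
    and lim: "AE x in lebesgue_on \<Omega>. (\<lambda>k. f k x) \<longlonglongrightarrow> F x"
    and bound: "\<And>k. L2_norm \<Omega> (f k) \<le> c"
  shows "F \<in> L2_space \<Omega>" "L2_norm \<Omega> F \<le> c"
proof -
  let ?M = "lebesgue_on \<Omega>"
  have c: "0 \<le> c" using bound[of 0] L2.nrm_nonneg[OF f[of 0]] by linarith
  have meas [measurable]: "f k \<in> borel_measurable ?M" for k using f by (rule L2_spaceD)
  note F [measurable]
  have "(\<integral>\<^sup>+x. ennreal ((norm (F x))\<^sup>2) \<partial>?M) = (\<integral>\<^sup>+x. liminf (\<lambda>k. ennreal ((norm (f k x))\<^sup>2)) \<partial>?M)"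
  proof (rule nn_integral_cong_AE, use lim in eventually_elim)
    case (elim x)
    then have "(\<lambda>k. ennreal ((norm (f k x))\<^sup>2)) \<longlonglongrightarrow> ennreal ((norm (F x))\<^sup>2)"
      by (intro tendsto_intros)
    then show ?case by (rule lim_imp_Liminf[OF trivial_limit_sequentially, symmetric])
  qed
  also have "\<dots> \<le> liminf (\<lambda>k. \<integral>\<^sup>+x. ennreal ((norm (f k x))\<^sup>2) \<partial>?M)"
    by (rule nn_integral_liminf) measurable
  also have "\<dots> \<le> ennreal (c\<^sup>2)"
  proof -
    have "(\<integral>\<^sup>+x. ennreal ((norm (f k x))\<^sup>2) \<partial>?M) \<le> ennreal (c\<^sup>2)" for k
    proof -
      have "(\<integral>\<^sup>+x. ennreal ((norm (f k x))\<^sup>2) \<partial>?M) = ennreal ((L2_norm \<Omega> (f k))\<^sup>2)"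
        unfolding L2_norm_sq using L2_spaceD(2)[OF f] by (intro nn_integral_eq_integral) auto
      also have "\<dots> \<le> ennreal (c\<^sup>2)"
        using bound f by (intro ennreal_leI power_mono) auto
      finally show ?thesis .
    qed
    then have "liminf (\<lambda>k. \<integral>\<^sup>+x. ennreal ((norm (f k x))\<^sup>2) \<partial>?M) \<le> liminf (\<lambda>k::nat. ennreal (c\<^sup>2))"
      by (intro Liminf_mono always_eventually allI)
    then show ?thesis by (simp add: Liminf_const)
  qed
  finally have le: "(\<integral>\<^sup>+x. ennreal ((norm (F x))\<^sup>2) \<partial>?M) \<le> ennreal (c\<^sup>2)" .
  then have int: "integrable ?M (\<lambda>x. (norm (F x))\<^sup>2)"
    by (intro integrableI_bounded) (auto intro: le_less_trans)
  with F show "F \<in> L2_space \<Omega>" by (simp add: L2_space_def)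
  have "ennreal ((L2_norm \<Omega> F)\<^sup>2) \<le> ennreal (c\<^sup>2)"
    unfolding L2_norm_sq using le int by (subst (asm) nn_integral_eq_integral) auto
  then have "(L2_norm \<Omega> F)\<^sup>2 \<le> c\<^sup>2" by simp
  then show "L2_norm \<Omega> F \<le> c" using c by (rule power2_le_imp_le)
qed

text \<open>Cauchy-Schwarz against the constant 1, whose norm is the root of the measure.
  Convergence in L2 thereby becomes convergence in L1, from which almost everywhere convergent
  subsequences are extracted.\<close>

lemma L2_imp_integrable:
  fixes f :: "real ^ 'n \<Rightarrow> 'b :: euclidean_space"
  assumes \<Omega>: "\<Omega> \<in> lmeasurable" and f: "f \<in> L2_space \<Omega>"
  shows "integrable (lebesgue_on \<Omega>) f"
    and "(LINT x | lebesgue_on \<Omega>. norm (f x)) \<le> L2_norm \<Omega> f * sqrt (measure lebesgue \<Omega>)"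
proof -
  interpret finite_measure "lebesgue_on \<Omega>" by (rule finite_measure_lebesgue_on[OF \<Omega>])
  have one: "(\<lambda>x. 1 :: real) \<in> L2_space \<Omega>" by (simp add: L2_space_def)
  have nf: "(\<lambda>x. norm (f x)) \<in> L2_space \<Omega>" using L2_spaceD[OF f] by (auto simp: L2_space_def)
  have "integrable (lebesgue_on \<Omega>) (\<lambda>x. norm (f x) \<bullet> 1)" by (rule integrable_L2_inner[OF nf one])
  then show "integrable (lebesgue_on \<Omega>) f"
    using L2_spaceD(1)[OF f] by (simp add: integrable_norm_iff)
  have "L2_inner \<Omega> (\<lambda>x. norm (f x)) (\<lambda>x. 1)
      \<le> L2_norm \<Omega> (\<lambda>x. norm (f x)) * L2_norm \<Omega> (\<lambda>x. 1 :: real)"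
    using L2.Cauchy_Schwarz[OF nf one] by simp
  moreover have "L2_norm \<Omega> (\<lambda>x. norm (f x)) = L2_norm \<Omega> f"
    by (simp add: L2_norm_def L2_inner_def power2_norm_eq_inner flip: power2_eq_square)
  moreover have "L2_norm \<Omega> (\<lambda>x. 1 :: real) = sqrt (measure lebesgue \<Omega>)"
    using \<Omega> by (simp add: L2_norm_def L2_inner_def measure_restrict_space fmeasurableD)
  ultimately show "(LINT x | lebesgue_on \<Omega>. norm (f x)) \<le> L2_norm \<Omega> f * sqrt (measure lebesgue \<Omega>)"
    by (simp add: L2_inner_def)
qed

lemma L2_tendsto_AE_subseq:
  fixes f :: "nat \<Rightarrow> real ^ 'n \<Rightarrow> 'b :: euclidean_space"
  assumes \<Omega>: "\<Omega> \<in> lmeasurable" and f: "\<And>k. f k \<in> L2_space \<Omega>" "F \<in> L2_space \<Omega>"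
    and lim: "(\<lambda>k. L2_norm \<Omega> (f k - F)) \<longlonglongrightarrow> 0"
  obtains r :: "nat \<Rightarrow> nat" where "strict_mono r" "AE x in lebesgue_on \<Omega>. (\<lambda>k. f (r k) x) \<longlonglongrightarrow> F x"
proof -
  have d: "f k - F \<in> L2_space \<Omega>" for k using f by simp
  have "(\<lambda>k. LINT x | lebesgue_on \<Omega>. norm ((f k - F) x)) \<longlonglongrightarrow> 0"
  proof (rule Lim_null_comparison)
    show "\<forall>\<^sub>F k in sequentially. norm (LINT x | lebesgue_on \<Omega>. norm ((f k - F) x))
        \<le> L2_norm \<Omega> (f k - F) * sqrt (measure lebesgue \<Omega>)"
      using L2_imp_integrable(2)[OF \<Omega> d] by simp
  qed (use tendsto_mult_left_zero[OF lim] in auto)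
  from tendsto_L1_AE_subseq[OF L2_imp_integrable(1)[OF \<Omega> d] this]
  obtain r :: "nat \<Rightarrow> nat" where "strict_mono r" "AE x in lebesgue_on \<Omega>. (\<lambda>k. (f (r k) - F) x) \<longlonglongrightarrow> 0"
    by blast
  then show thesis using that[of r] by (auto simp: LIM_zero_iff)
qed

text \<open>The Riesz-Fischer argument. Along a fast subsequence the increments have norm at most
  \<open>(1/2) ^ k\<close>, so they are summable almost everywhere and the subsequence converges
  pointwise; Fatou's lemma then carries the Cauchy estimate over to the limit.\<close>

lemma L2_complete:
  fixes f :: "nat \<Rightarrow> real ^ 'n \<Rightarrow> 'b :: euclidean_space"
  assumes \<Omega>: "\<Omega> \<in> lmeasurable" and f: "\<And>k. f k \<in> L2_space \<Omega>"
    and cauchy: "\<And>e. e > 0 \<Longrightarrow> \<exists>N. \<forall>m\<ge>N. \<forall>n\<ge>N. L2_norm \<Omega> (f m - f n) < e"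
  obtains F where "F \<in> L2_space \<Omega>" "(\<lambda>k. L2_norm \<Omega> (f k - F)) \<longlonglongrightarrow> 0"
proof -
  let ?M = "lebesgue_on \<Omega>"
  have meas [measurable]: "f k \<in> borel_measurable ?M" for k using f by (rule L2_spaceD)
  obtain N where N: "\<And>e m n. e > 0 \<Longrightarrow> m \<ge> N e \<Longrightarrow> n \<ge> N e \<Longrightarrow> L2_norm \<Omega> (f m - f n) < e"
    using cauchy by metis
  \<comment> \<open>Summing all thresholds up to \<open>k\<close> makes \<open>r\<close> monotone
    and at least the \<open>k\<close>-th threshold; the extra summand \<open>k\<close> makes it
    unbounded.\<close>
  define r where "r k = k + (\<Sum>j\<le>k. N ((1/2) ^ j))" for k
  have r_ge: "N ((1/2) ^ k) \<le> r k" for k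
    unfolding r_def by (rule trans_le_add2) (auto intro: member_le_sum)
  have r_mono: "r k \<le> r (Suc k)" for k by (simp add: r_def)
  have r_id: "k \<le> r k" for k by (simp add: r_def)
  define g where "g k x = f (r (Suc k)) x - f (r k) x" for k x
  have g_L2: "g k \<in> L2_space \<Omega>" and g_norm: "L2_norm \<Omega> (g k) \<le> (1/2) ^ k" for k
  proof -
    have eq: "g k = f (r (Suc k)) - f (r k)" by (simp add: fun_eq_iff g_def)
    show "g k \<in> L2_space \<Omega>" unfolding eq using f by simp
    show "L2_norm \<Omega> (g k) \<le> (1/2) ^ k"
      unfolding eq using N[of "(1/2) ^ k" "r (Suc k)" "r k"] r_ge[of k] r_mono[of k] by simp
  qed
  have [measurable]: "g k \<in> borel_measurable ?M" for k using g_L2 by (rule L2_spaceD)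
  have AE_summable: "AE x in ?M. summable (\<lambda>k. norm (g k x))"
  proof -
    let ?c = "sqrt (measure lebesgue \<Omega>)"
    have "(\<integral>\<^sup>+x. (\<Sum>k. ennreal (norm (g k x))) \<partial>?M) = (\<Sum>k. \<integral>\<^sup>+x. ennreal (norm (g k x)) \<partial>?M)"
      by (rule nn_integral_suminf) measurable
    also have "\<dots> \<le> (\<Sum>k. ennreal ((1/2) ^ k * ?c))"
    proof (rule suminf_le)
      fix k
      have "(\<integral>\<^sup>+x. ennreal (norm (g k x)) \<partial>?M) = ennreal (LINT x | ?M. norm (g k x))"
        using L2_imp_integrable(1)[OF \<Omega> g_L2] by (intro nn_integral_eq_integral) auto
      also have "(LINT x | ?M. norm (g k x)) \<le> (1/2) ^ k * ?c"
        by (rule order_trans[OF L2_imp_integrable(2)[OF \<Omega> g_L2]])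
          (intro mult_right_mono g_norm, simp)
      finally show "(\<integral>\<^sup>+x. ennreal (norm (g k x)) \<partial>?M) \<le> ennreal ((1/2) ^ k * ?c)"
        by (simp add: ennreal_leI)
    qed auto
    also have "\<dots> < \<infinity>"
      by (subst suminf_ennreal2) (auto intro!: summable_mult2 summable_geometric)
    finally have "AE x in ?M. (\<Sum>k. ennreal (norm (g k x))) \<noteq> \<infinity>"
      by (intro nn_integral_noteq_infinite) auto
    then show ?thesis by eventually_elim (auto intro: summable_suminf_not_top)
  qed
  define F where "F x = lim (\<lambda>k. f (r k) x)" for x
  have F_meas [measurable]: "F \<in> borel_measurable ?M" unfolding F_def by measurable
  have F_lim: "AE x in ?M. (\<lambda>k. f (r k) x) \<longlonglongrightarrow> F x"
    using AE_summable
  proof eventually_elim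
    case (elim x)
    then have "summable (\<lambda>k. g k x)" by (rule summable_norm_cancel)
    then have "convergent (\<lambda>n. f (r 0) x + (\<Sum>k<n. g k x))"
      by (intro convergent_add convergent_const) (simp add: summable_iff_convergent)
    moreover have "f (r 0) x + (\<Sum>k<n. g k x) = f (r n) x" for n
      using sum_lessThan_telescope[of "\<lambda>k. f (r k) x" n] by (simp add: g_def)
    ultimately show ?case unfolding F_def by (simp add: convergent_LIMSEQ_iff)
  qed
  \<comment> \<open>\<open>n\<close> stays fixed while the other index runs to infinity along the
    subsequence, starting where it already exceeds \<open>N e\<close>.\<close>
  have key: "f n - F \<in> L2_space \<Omega> \<and> L2_norm \<Omega> (f n - F) \<le> e" if "e > 0" "n \<ge> N e" for n e
  proof -
    let ?h = "\<lambda>k. f n - f (r (N e + k))"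
    have h: "?h k \<in> L2_space \<Omega>" for k using f by simp
    have lim: "AE x in ?M. (\<lambda>k. ?h k x) \<longlonglongrightarrow> (f n - F) x"
      using F_lim
    proof eventually_elim
      case (elim x)
      then have "(\<lambda>k. f (r (k + N e)) x) \<longlonglongrightarrow> F x" by (rule LIMSEQ_ignore_initial_segment)
      then show ?case by (auto simp: add.commute intro!: tendsto_intros)
    qed
    have m: "f n - F \<in> borel_measurable ?M" by (simp add: fun_diff_def)
    have b: "L2_norm \<Omega> (?h k) \<le> e" for k
      using N[OF that(1,2), of "r (N e + k)"] r_id[of "N e + k"] by simp
    show ?thesis using L2_Fatou[OF h m lim b] by blast
  qed
  have "F = f (N 1) - (f (N 1) - F)" by simp
  then have F_L2: "F \<in> L2_space \<Omega>" using key[of 1 "N 1"] f L2.mem(2) by (metis order_refl zero_less_one)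
  have "(\<lambda>k. L2_norm \<Omega> (f k - F)) \<longlonglongrightarrow> 0"
  proof (rule LIMSEQ_I)
    fix e :: real assume "e > 0"
    then show "\<exists>no. \<forall>n\<ge>no. norm (L2_norm \<Omega> (f n - F) - 0) < e"
      using key[of "e / 2"] f F_L2 by (intro exI[of _ "N (e / 2)"]) fastforce
  qed
  with F_L2 that show thesis by blast
qed

lemma semi_hilbert_L2:
  assumes "\<Omega> \<in> lmeasurable"
  shows "semi_hilbert (L2_space \<Omega> :: (real ^ 'n \<Rightarrow> 'b :: euclidean_space) set) (L2_inner \<Omega>)"
proof unfold_locales
  fix f :: "nat \<Rightarrow> real ^ 'n \<Rightarrow> 'b"
  assume f: "\<And>k. f k \<in> L2_space \<Omega>"
    and "\<And>e. e > 0 \<Longrightarrow> \<exists>N. \<forall>m\<ge>N. \<forall>n\<ge>N. sqrt (L2_inner \<Omega> (f m - f n) (f m - f n)) < e"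
  then obtain F where "F \<in> L2_space \<Omega>" "(\<lambda>k. L2_norm \<Omega> (f k - F)) \<longlonglongrightarrow> 0"
    using L2_complete[OF assms, of f] unfolding L2_norm_def by blast
  then show "\<exists>F\<in>L2_space \<Omega>. (\<lambda>k. sqrt (L2_inner \<Omega> (f k - F) (f k - F))) \<longlonglongrightarrow> 0"
    unfolding L2_norm_def by blast
qed

section \<open>Smooth functions\<close>

lemma has_derivative_grad:
  fixes \<phi> :: "real ^ 'n \<Rightarrow> real"
  assumes "\<phi> differentiable (at x)"
  shows "(\<phi> has_derivative (\<lambda>v. grad \<phi> x \<bullet> v)) (at x)"
proof -
  let ?D = "frechet_derivative \<phi> (at x)"
  have D: "(\<phi> has_derivative ?D) (at x)" using assms by (simp add: frechet_derivative_works)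
  then have lin: "linear ?D" by (rule has_derivative_linear)
  have "?D v = grad \<phi> x \<bullet> v" for v
  proof -
    have "?D v = ?D (\<Sum>i\<in>UNIV. (v $ i) *\<^sub>R axis i 1)"
      using basis_expansion[of v] by (simp add: scalar_mult_eq_scaleR)
    also have "\<dots> = (\<Sum>i\<in>UNIV. v $ i * ?D (axis i 1))"
      using lin by (simp add: linear_sum linear_scale)
    also have "\<dots> = grad \<phi> x \<bullet> v"
      by (simp add: grad_def inner_vec_def mult.commute)
    finally show ?thesis .
  qed
  then have "?D = (\<lambda>v. grad \<phi> x \<bullet> v)" by auto
  with D show ?thesis by simp
qed

lemma grad_eqI:
  fixes \<phi> :: "real ^ 'n \<Rightarrow> real"
  assumes "(\<phi> has_derivative (\<lambda>v. g \<bullet> v)) (at x)"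
  shows "grad \<phi> x = g"
  using frechet_derivative_at[OF assms]
  by (simp add: grad_def vec_eq_iff flip: cart_eq_inner_axis)
    (metis cart_eq_inner_axis)

lemma grad_linear:
  assumes "\<phi> differentiable (at x)" "\<psi> differentiable (at x)"
  shows "grad (\<lambda>x. a * \<phi> x + b * \<psi> x) x = a *\<^sub>R grad \<phi> x + b *\<^sub>R grad \<psi> x"
  by (rule grad_eqI)
    (use assms in \<open>auto intro!: derivative_eq_intros has_derivative_grad simp: inner_add_left\<close>)

lemma grad_mult:
  assumes "\<phi> differentiable (at x)" "\<psi> differentiable (at x)"
  shows "grad (\<lambda>x. \<phi> x * \<psi> x) x = \<phi> x *\<^sub>R grad \<psi> x + \<psi> x *\<^sub>R grad \<phi> x"
  by (rule grad_eqI)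
    (use assms in \<open>auto intro!: derivative_eq_intros has_derivative_grad simp: inner_add_left\<close>)

lemma grad_const [simp]: "grad (\<lambda>_. c) x = 0"
  by (rule grad_eqI) (auto intro!: derivative_eq_intros)

lemma grad_eq_0_outside:
  assumes "closed K" "\<And>x. x \<notin> K \<Longrightarrow> \<phi> x = 0" "x \<notin> K"
  shows "grad \<phi> x = 0"
proof (rule grad_eqI)
  have "((\<lambda>_. 0) has_derivative (\<lambda>v. 0 \<bullet> v)) (at x)" by (auto intro!: derivative_eq_intros)
  then show "(\<phi> has_derivative (\<lambda>v. 0 \<bullet> v)) (at x)"
    by (rule has_derivative_transform_within_open[where s = "- K"]) (use assms in auto)
qed

lemma C_k_const [simp]: "C_k k (\<lambda>_. c)"
  by (induction k arbitrary: c) auto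

lemma C_k_linear:
  assumes "C_k k \<phi>" "C_k k \<psi>"
  shows "C_k k (\<lambda>x. a * \<phi> x + b * \<psi> x)"
  using assms
proof (induction k arbitrary: \<phi> \<psi>)
  case 0
  then show ?case by (auto intro!: continuous_intros)
next
  case (Suc k)
  then have "(\<lambda>x. grad (\<lambda>x. a * \<phi> x + b * \<psi> x) x $ i) = (\<lambda>x. a * grad \<phi> x $ i + b * grad \<psi> x $ i)" for i
    by (simp add: grad_linear)
  with Suc show ?case by (auto intro!: derivative_intros)
qed

lemma C_k_Suc: "C_k (Suc k) \<phi> \<Longrightarrow> C_k k \<phi>"
proof (induction k arbitrary: \<phi>)
  case 0
  then show ?case
    by (auto simp: continuous_on_eq_continuous_at intro: differentiable_imp_continuous_within)
next
  case (Suc k)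
  then show ?case by (metis C_k.simps(2))
qed

lemma C_k_mult:
  assumes "C_k k \<phi>" "C_k k \<psi>"
  shows "C_k k (\<lambda>x. \<phi> x * \<psi> x)"
  using assms
proof (induction k arbitrary: \<phi> \<psi>)
  case 0
  then show ?case by (auto intro!: continuous_intros)
next
  case (Suc k)
  \<comment> \<open>The factors 1 bring the product rule into the shape of
    \<open>C_k_linear\<close>.\<close>
  have "(\<lambda>x. grad (\<lambda>x. \<phi> x * \<psi> x) x $ i)
      = (\<lambda>x. 1 * (\<phi> x * grad \<psi> x $ i) + 1 * (\<psi> x * grad \<phi> x $ i))" for i
    using Suc.prems by (simp add: grad_mult)
  moreover have "C_k k (\<lambda>x. 1 * (\<phi> x * grad \<psi> x $ i) + 1 * (\<psi> x * grad \<phi> x $ i))" for i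
    by (rule C_k_linear; rule Suc.IH)
      (use Suc.prems C_k_Suc[OF Suc.prems(1)] C_k_Suc[OF Suc.prems(2)] in \<open>simp_all del: C_k.simps(2), simp_all\<close>)
  ultimately show ?case using Suc.prems by (auto intro!: derivative_intros)
qed

lemma C_k_prod:
  assumes "finite I" "\<And>i. i \<in> I \<Longrightarrow> C_k k (f i)"
  shows "C_k k (\<lambda>x. \<Prod>i\<in>I. f i x)"
  using assms by (induction I rule: finite_induct) (simp_all add: C_k_mult)

lemma C_k_component: "C_k k (\<lambda>x. x $ i)"
proof (cases k)
  case (Suc m)
  have "grad (\<lambda>x. x $ i) x = axis i 1" for x :: "real ^ 'a"
    by (rule grad_eqI) (auto intro!: derivative_eq_intros bounded_linear.has_derivative[OF bounded_linear_vec_nth]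
        simp: inner_commute cart_eq_inner_axis)
  with Suc show ?thesis by (auto intro!: bounded_linear_imp_differentiable bounded_linear_vec_nth)
qed (auto intro!: continuous_intros)

text \<open>The derivatives of \<open>t \<mapsto> exp (- 1 / t)\<close>, extended by zero to \<open>t \<le> 0\<close>, are linear
  combinations of the functions \<open>flat k\<close>.\<close>

definition flat :: "nat \<Rightarrow> real \<Rightarrow> real" where
  "flat k t = (if t > 0 then inverse t ^ k * exp (- inverse t) else 0)"

lemma flat_tendsto_0: "(flat k \<longlongrightarrow> 0) (at 0)"
proof (rule filterlim_split_at)
  show "(flat k \<longlongrightarrow> 0) (at_left 0)"
    by (rule tendsto_eventually) (auto simp: flat_def eventually_at_filter)
  have "((\<lambda>t :: real. inverse t ^ k / exp (inverse t)) \<longlongrightarrow> 0) (at_right 0)"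
    using filterlim_compose[OF tendsto_power_div_exp_0[of k] filterlim_inverse_at_top_right] by simp
  then show "(flat k \<longlongrightarrow> 0) (at_right 0)"
    by (rule Lim_transform_eventually)
      (auto simp: flat_def exp_minus divide_inverse eventually_at_filter)
qed

lemma has_real_derivative_flat:
  "(flat k has_real_derivative flat (k + 2) t - real k * flat (k + 1) t) (at t)"
proof (cases t "0 :: real" rule: linorder_cases)
  case less
  have "((\<lambda>_. 0) has_real_derivative 0) (at t)" by simp
  then have "(flat k has_real_derivative 0) (at t)"
    by (rule has_field_derivative_transform_within_open[where S = "{..<0}"])
      (use less in \<open>auto simp: flat_def\<close>)
  then show ?thesis using less by (simp add: flat_def)
next
  case equal
  \<comment> \<open>At 0 the difference quotient of \<open>flat k\<close> is
    \<open>flat (Suc k)\<close>, which tends to 0.\<close>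
  have "((\<lambda>h. (flat k (0 + h) - flat k 0) / h) \<longlongrightarrow> 0) (at 0)"
    by (rule Lim_transform_eventually[OF flat_tendsto_0[of "Suc k"]])
      (auto simp: flat_def divide_inverse eventually_at_filter)
  then have "(flat k has_real_derivative 0) (at 0)" by (simp add: DERIV_def)
  then show ?thesis using equal by (simp add: flat_def)
next
  case greater
  have "((\<lambda>t. inverse t ^ k * exp (- inverse t)) has_real_derivative
      inverse t ^ (k + 2) * exp (- inverse t) - real k * (inverse t ^ (k + 1) * exp (- inverse t))) (at t)"
  proof (rule DERIV_cong)
    have "((\<lambda>t. - inverse t) has_real_derivative (inverse t)\<^sup>2) (at t)"
      using greater by (auto intro!: derivative_eq_intros simp: power2_eq_square)
    then show "((\<lambda>t. inverse t ^ k * exp (- inverse t)) has_real_derivative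
        (real k * (- (inverse t)\<^sup>2 * inverse t ^ (k - Suc 0))) * exp (- inverse t)
        + (exp (- inverse t) * (inverse t)\<^sup>2) * inverse t ^ k) (at t)"
      using greater
      by (intro DERIV_mult DERIV_power DERIV_fun_exp) (auto intro!: derivative_eq_intros simp: power2_eq_square)
    show "(real k * (- (inverse t)\<^sup>2 * inverse t ^ (k - Suc 0))) * exp (- inverse t)
        + (exp (- inverse t) * (inverse t)\<^sup>2) * inverse t ^ k
      = inverse t ^ (k + 2) * exp (- inverse t) - real k * (inverse t ^ (k + 1) * exp (- inverse t))"
      by (cases k) (simp_all add: power2_eq_square algebra_simps)
  qed
  then have "(flat k has_real_derivative
      inverse t ^ (k + 2) * exp (- inverse t) - real k * (inverse t ^ (k + 1) * exp (- inverse t))) (at t)"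
    by (rule has_field_derivative_transform_within_open[where S = "{0<..}"])
      (use greater in \<open>auto simp: flat_def\<close>)
  then show ?thesis using greater by (simp add: flat_def)
qed

text \<open>The induction generalises over \<open>k\<close>: differentiating \<open>flat k\<close>
  produces \<open>flat (k + 1)\<close> and \<open>flat (k + 2)\<close>, so only the linear span of
  the whole family is closed under differentiation.\<close>

lemma C_k_flat: "C_k m (\<lambda>x. flat k (a * x $ i + c))"
proof (induction m arbitrary: k)
  case 0
  have "continuous_on UNIV (flat k)"
    by (rule DERIV_continuous_on) (rule has_real_derivative_flat)
  then show ?case
    unfolding C_k.simps by (rule continuous_on_compose2) (auto intro!: continuous_intros)
next
  case (Suc m)
  have der: "((\<lambda>x. flat k (a * x $ i + c)) has_derivative
      (\<lambda>v. (((flat (k + 2) (a * x $ i + c) - real k * flat (k + 1) (a * x $ i + c)) * a) *\<^sub>R axis i 1) \<bullet> v)) (at x)"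
    for x :: "real ^ 'a"
    by (rule has_derivative_eq_rhs,
        rule has_derivative_compose[OF _ has_real_derivative_flat[unfolded has_field_derivative_def]])
      (auto intro!: derivative_eq_intros bounded_linear.has_derivative[OF bounded_linear_vec_nth]
        simp: inner_axis' fun_eq_iff)
  have "(\<lambda>x. grad (\<lambda>x. flat k (a * x $ i + c)) x $ j) =
      (\<lambda>x. (a * axis i 1 $ j) * flat (k + 2) (a * x $ i + c)
         + (- a * real k * axis i 1 $ j) * flat (k + 1) (a * x $ i + c))" for j
    by (simp only: grad_eqI[OF der]) (simp add: fun_eq_iff algebra_simps)
  moreover have "C_k m (\<lambda>x. (a * axis i 1 $ j) * flat (k + 2) (a * x $ i + c)
         + (- a * real k * axis i 1 $ j) * flat (k + 1) (a * x $ i + c))" for j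
    by (rule C_k_linear; rule Suc.IH)
  ultimately show ?case using der by (auto simp: differentiable_def)
qed

text \<open>Each coordinate contributes exp (-1 / (m t)) for the signed distances t to the two
  opposite faces of the box, replaced by 0 where t \<le> 0. Inside the box these factors tend to 1
  as m grows, so smooth functions approach the indicator from below without mollifiers. The
  arguments are written as affine functions to match \<open>C_k_flat\<close>.\<close>

definition bump :: "real ^ 'n \<Rightarrow> real ^ 'n \<Rightarrow> real \<Rightarrow> real ^ 'n \<Rightarrow> real" where
  "bump a b m x = (\<Prod>i\<in>UNIV. flat 0 (m * x $ i + - m * a $ i) * flat 0 (- m * x $ i + m * b $ i))"

lemma flat_0_bounds: "0 \<le> flat 0 t" "flat 0 t \<le> 1"
  by (auto simp: flat_def)

lemma bump_bounds: "0 \<le> bump a b m x" "bump a b m x \<le> 1"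
  unfolding bump_def
  by (auto intro!: prod_nonneg prod_le_1 mult_nonneg_nonneg mult_le_one simp: flat_0_bounds)

lemma bump_eq_0: "x \<notin> box a b \<Longrightarrow> m > 0 \<Longrightarrow> bump a b m x = 0"
proof -
  assume x: "x \<notin> box a b" and m: "m > 0"
  then obtain i where "\<not> (a $ i < x $ i \<and> x $ i < b $ i)" by (auto simp: mem_box_cart)
  then have "m * x $ i + - m * a $ i \<le> 0 \<or> - m * x $ i + m * b $ i \<le> 0"
    using m by (auto simp: not_less)
  then show ?thesis unfolding bump_def by (auto intro!: prod_zero exI[of _ i] simp: flat_def)
qed

lemma bump_tendsto: "(\<lambda>k. bump a b (real (Suc k)) x) \<longlonglongrightarrow> indicator (box a b) x"
proof (cases "x \<in> box a b")
  case True
  have one: "(\<lambda>k. flat 0 (real (Suc k) * c)) \<longlonglongrightarrow> 1" if "c > 0" for c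
  proof -
    have "(\<lambda>k. exp (- (inverse (real (Suc k)) * inverse c))) \<longlonglongrightarrow> exp (- (0 * inverse c))"
      by (intro tendsto_intros LIMSEQ_inverse_real_of_nat)
    then show ?thesis using that by (simp add: flat_def)
  qed
  have "(\<lambda>k. bump a b (real (Suc k)) x) \<longlonglongrightarrow> (\<Prod>i\<in>(UNIV :: 'a set). 1 * 1)"
    unfolding bump_def
  proof (intro tendsto_intros)
    fix i
    show "(\<lambda>k. flat 0 (real (Suc k) * x $ i + - real (Suc k) * a $ i)) \<longlonglongrightarrow> 1"
      using one[of "x $ i - a $ i"] True by (simp add: mem_box_cart algebra_simps)
    show "(\<lambda>k. flat 0 (- real (Suc k) * x $ i + real (Suc k) * b $ i)) \<longlonglongrightarrow> 1"
      using one[of "b $ i - x $ i"] True by (simp add: mem_box_cart algebra_simps)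
  qed
  then show ?thesis using True by simp
qed (simp add: bump_eq_0)

lemma bump_test_function:
  assumes "cbox a b \<subseteq> \<Omega>" "m > 0"
  shows "bump a b m \<in> test_functions \<Omega>"
proof -
  have C_k: "C_k k (bump a b m)" for k
    unfolding bump_def[abs_def] by (intro C_k_prod C_k_mult C_k_flat) auto
  have sub: "closure {x. bump a b m x \<noteq> 0} \<subseteq> cbox a b"
    using bump_eq_0[OF _ assms(2)] by (intro closure_minimal) (auto intro: box_subset_cbox[THEN subsetD])
  then have "compact (closure {x. bump a b m x \<noteq> 0})"
    by (meson bounded_cbox bounded_subset closed_closure compact_eq_bounded_closed)
  with sub assms(1) C_k show ?thesis unfolding test_functions_def by blast
qed

section \<open>Integration by parts\<close>

lemma continuous_compact_support_bounded:
  fixes f :: "'a::metric_space \<Rightarrow> 'b::real_normed_vector"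
  assumes "continuous_on UNIV f" "compact K" "\<And>x. x \<notin> K \<Longrightarrow> f x = 0"
  obtains B where "B \<ge> 0" "\<And>x. norm (f x) \<le> B"
proof -
  have "bounded (f ` K)"
    using assms by (intro compact_imp_bounded compact_continuous_image) (auto intro: continuous_on_subset)
  then obtain B where "B > 0" "\<And>x. x \<in> K \<Longrightarrow> norm (f x) \<le> B"
    by (auto simp: bounded_pos)
  then show thesis using that[of B] assms(3) by (metis norm_zero less_imp_le)
qed

lemma continuous_on_grad: "C_k (Suc 0) \<phi> \<Longrightarrow> continuous_on UNIV (grad \<phi>)"
  using continuous_on_vec_lambda[where f = "\<lambda>i x. grad \<phi> x $ i"] by simp

lemma integrable_continuous_compact_support:
  fixes f :: "real ^ 'n \<Rightarrow> real"
  assumes f: "continuous_on UNIV f" and K: "compact K" "\<And>x. x \<notin> K \<Longrightarrow> f x = 0"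
  shows "integrable lborel f"
proof -
  have "integrable lborel (\<lambda>x. indicator K x *\<^sub>R f x)"
    using K f by (intro borel_integrable_compact) (auto intro: continuous_on_subset)
  moreover have "(\<lambda>x. indicator K x *\<^sub>R f x) = f" using K by (force simp: indicator_def fun_eq_iff)
  ultimately show ?thesis by simp
qed

text \<open>The difference quotients of \<open>\<phi>\<close> have integral zero by translation invariance.\<close>

lemma integral_grad_eq_0:
  fixes \<phi> :: "real ^ 'n \<Rightarrow> real"
  assumes \<phi>: "C_k (Suc 0) \<phi>" and K: "compact K" "\<And>x. x \<notin> K \<Longrightarrow> \<phi> x = 0"
  shows "(LINT x | lborel. grad \<phi> x $ i) = 0"
proof -
  have diff: "\<phi> differentiable (at x)" for x using \<phi> by simp
  have cont: "continuous_on UNIV \<phi>" using C_k_Suc[OF \<phi>] by simp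
  have grad0: "grad \<phi> x = 0" if "x \<notin> K" for x
    using K that by (intro grad_eq_0_outside[of K]) (auto intro: compact_imp_closed)
  obtain B where B: "B \<ge> 0" "\<And>x. norm (grad \<phi> x) \<le> B"
    using continuous_compact_support_bounded[OF continuous_on_grad[OF \<phi>] K(1) grad0] by blast
  have lip: "norm (\<phi> x - \<phi> y) \<le> B * norm (x - y)" for x y
  proof (rule differentiable_bound[where S = UNIV])
    show "(\<phi> has_derivative (\<lambda>v. grad \<phi> x \<bullet> v)) (at x within UNIV)" for x
      using has_derivative_grad[OF diff] by simp
    show "onorm (\<lambda>v. grad \<phi> x \<bullet> v) \<le> B" for x
    proof (rule onorm_le)
      fix v
      have "norm (grad \<phi> x \<bullet> v) \<le> norm (grad \<phi> x) * norm v" by (simp add: Cauchy_Schwarz_ineq2)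
      also have "\<dots> \<le> B * norm v" by (intro mult_right_mono B) simp
      finally show "norm (grad \<phi> x \<bullet> v) \<le> B * norm v" .
    qed
  qed auto
  obtain R where R: "K \<subseteq> cball 0 R"
    using compact_imp_bounded[OF K(1)] by (auto simp: bounded_iff subset_iff)
  define G where "G k x = real (Suc k) * (\<phi> (inverse (real (Suc k)) *\<^sub>R axis i 1 + x) - \<phi> x)"
    for k :: nat and x
  have \<phi>_int: "integrable lborel \<phi>" by (rule integrable_continuous_compact_support[OF cont K])
  have G_int: "(LINT x | lborel. G k x) = 0" for k
  proof -
    let ?c = "inverse (real (Suc k)) *\<^sub>R axis i 1 :: real ^ 'n"
    have "integrable (distr lborel borel ((+) ?c)) \<phi>" using \<phi>_int by (simp add: lborel_distr_plus)
    then have "integrable lborel (\<lambda>x. \<phi> (?c + x))" using borel_measurable_continuous_onI[OF cont] by (subst (asm) integrable_distr_eq) auto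
    moreover have "(LINT x | lborel. \<phi> (?c + x)) = (LINT x | distr lborel borel ((+) ?c). \<phi> x)"
      using borel_measurable_continuous_onI[OF cont] by (subst integral_distr) auto
    ultimately show ?thesis using \<phi>_int by (simp add: G_def lborel_distr_plus)
  qed
  have "(\<lambda>k. LINT x | lborel. G k x) \<longlonglongrightarrow> (LINT x | lborel. grad \<phi> x $ i)"
  \<comment> \<open>The shift has length at most 1, so \<open>G k\<close> vanishes outside the ball
    of radius \<open>R + 1\<close>; inside it the Lipschitz constant \<open>B\<close> is a
    bound.\<close>
  proof (rule integral_dominated_convergence[where w = "\<lambda>x. indicator (cball 0 (R + 1)) x *\<^sub>R B"])
    show "(\<lambda>x. grad \<phi> x $ i) \<in> borel_measurable lborel"
      using \<phi> by (auto intro!: borel_measurable_continuous_onI)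
    show "G k \<in> borel_measurable lborel" for k
      unfolding G_def[abs_def]
      by (auto intro!: borel_measurable_continuous_onI continuous_intros continuous_on_compose2[OF cont])
    show "integrable lborel (\<lambda>x. indicator (cball 0 (R + 1)) x *\<^sub>R B)"
      by (intro borel_integrable_compact) auto
    show "AE x in lborel. (\<lambda>k. G k x) \<longlonglongrightarrow> grad \<phi> x $ i"
    proof (rule AE_I2)
      fix x :: "real ^ 'n"
      have "((\<lambda>t. \<phi> (t *\<^sub>R axis i 1 + x)) has_derivative (\<lambda>t. grad \<phi> (0 *\<^sub>R axis i 1 + x) \<bullet> (t *\<^sub>R axis i 1))) (at 0)"
        by (rule has_derivative_compose[where g = \<phi>])
          (auto intro!: derivative_eq_intros has_derivative_grad diff)
      then have "((\<lambda>t. \<phi> (t *\<^sub>R axis i 1 + x)) has_real_derivative (grad \<phi> x $ i)) (at 0)"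
        by (simp add: has_field_derivative_def mult_commute_abs cart_eq_inner_axis)
      then have "((\<lambda>t. (\<phi> (t *\<^sub>R axis i 1 + x) - \<phi> x) / t) \<longlongrightarrow> grad \<phi> x $ i) (at 0)"
        by (simp add: DERIV_def)
      moreover have "filterlim (\<lambda>k. inverse (real (Suc k))) (at 0) sequentially"
        using LIMSEQ_inverse_real_of_nat by (simp add: filterlim_at)
      ultimately have "(\<lambda>k. (\<phi> (inverse (real (Suc k)) *\<^sub>R axis i 1 + x) - \<phi> x) / inverse (real (Suc k)))
          \<longlonglongrightarrow> grad \<phi> x $ i"
        by (rule filterlim_compose)
      then show "(\<lambda>k. G k x) \<longlonglongrightarrow> grad \<phi> x $ i"
        by (simp add: G_def divide_inverse mult.commute)
    qed
    show "AE x in lborel. norm (G k x) \<le> indicator (cball 0 (R + 1)) x *\<^sub>R B" for k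
    proof (rule AE_I2)
      fix x :: "real ^ 'n"
      let ?c = "inverse (real (Suc k)) *\<^sub>R axis i 1 :: real ^ 'n"
      have c: "norm ?c = inverse (real (Suc k))" "norm ?c \<le> 1" by (auto simp: field_simps)
      show "norm (G k x) \<le> indicator (cball 0 (R + 1)) x *\<^sub>R B"
      proof (cases "x \<in> cball 0 (R + 1)")
        case True
        have "norm (G k x) = real (Suc k) * norm (\<phi> (?c + x) - \<phi> x)" by (simp add: G_def abs_mult)
        also have "\<dots> \<le> real (Suc k) * (B * norm ?c)"
          using lip[of "?c + x" x] by (intro mult_left_mono) auto
        also have "\<dots> = B" using c by (simp add: field_simps)
        finally show ?thesis using True by simp
      next
        case False
        then have "norm x > R + 1" by simp
        moreover have "norm x \<le> norm (?c + x) + norm ?c" using norm_triangle_ineq4[of "?c + x" ?c] by simp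
        ultimately have "?c + x \<notin> K" "x \<notin> K" using R c by (force, force)
        then show ?thesis using K False by (simp add: G_def)
      qed
    qed
  qed
  then show ?thesis by (simp add: G_int LIMSEQ_const_iff)
qed

text \<open>Integrals over the domain refer to the completed measure, while translation invariance
  is exploited for \<open>lborel\<close>.\<close>

lemma integral_lebesgue_on_eq_lborel:
  fixes f :: "real ^ 'n \<Rightarrow> 'b::{banach, second_countable_topology}"
  assumes "\<Omega> \<in> sets lebesgue" "f \<in> borel_measurable borel" "\<And>x. x \<notin> \<Omega> \<Longrightarrow> f x = 0"
  shows "(LINT x | lebesgue_on \<Omega>. f x) = (LINT x | lborel. f x)"
proof -
  have "(LINT x | lebesgue_on \<Omega>. f x) = (LINT x | lebesgue. indicator \<Omega> x *\<^sub>R f x)"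
    using assms by (intro integral_restrict_space) auto
  also have "(\<lambda>x. indicator \<Omega> x *\<^sub>R f x) = f" using assms by (auto simp: indicator_def)
  finally show ?thesis using assms by (simp add: integral_completion)
qed

section \<open>Test functions on a bounded open set\<close>

text \<open>Dynkin's argument: boxes are closed under intersection and generate the Borel sets, and
  the vanishing total integral takes care of complements.\<close>

lemma sigma_sets_box_integral_zero:
  fixes f :: "real ^ 'n \<Rightarrow> real"
  assumes f: "integrable lebesgue f"
    and total: "(LINT x | lebesgue. f x) = 0"
    and box: "\<And>a b. (LINT x : box a b | lebesgue. f x) = 0"
    and A: "A \<in> sets borel"
  shows "(LINT x : A | lebesgue. f x) = 0"
proof -
  have borel: "sets borel = sigma_sets UNIV (range (\<lambda>(a, b). box a b :: (real ^ 'n) set))"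
    by (simp add: borel_eq_box)
  have si: "set_integrable lebesgue A f" if "A \<in> sets borel" for A
    using f that unfolding set_integrable_def by (intro integrable_mult_indicator) auto
  have stable: "Int_stable (range (\<lambda>(a, b). box a b :: (real ^ 'n) set))"
    by (auto simp: Int_stable_def box_Int_box)
  have "range (\<lambda>(a, b). box a b :: (real ^ 'n) set) \<subseteq> Pow UNIV" by simp
  moreover have "A \<in> sigma_sets UNIV (range (\<lambda>(a, b). box a b :: (real ^ 'n) set))" using A borel by simp
  ultimately show ?thesis
  proof (induction A rule: sigma_sets_induct_disjoint[OF stable, consumes 2, case_names basic empty compl union])
    case (compl A)
    then have A: "A \<in> sets borel" using borel by simp
    have "(LINT x : A \<union> (UNIV - A) | lebesgue. f x) = (LINT x : A | lebesgue. f x) + (LINT x : UNIV - A | lebesgue. f x)"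
      using A by (intro set_integral_Un si) auto
    then show ?case using compl total by (simp add: set_lebesgue_integral_def)
  next
    case (union A)
    then have A: "A i \<in> sets borel" for i using borel by auto
    have "(LINT x : (\<Union>i. A i) | lebesgue. f x) = (\<Sum>i. LINT x : A i | lebesgue. f x)"
      using A union(1) by (intro lebesgue_integral_countable_add si) (auto simp: disjoint_family_on_def)
    then show ?case using union by simp
  next
    case (basic A)
    then show ?case using box by auto
  next
    case empty
    then show ?case by (simp add: set_lebesgue_integral_def)
  qed
qed

text \<open>A Lebesgue set differs from a Borel set by a null set, so the Borel case decides all set
  integrals, and these determine a density almost everywhere.\<close>

lemma AE_zero_of_box_integrals:
  fixes f :: "real ^ 'n \<Rightarrow> real"
  assumes f: "integrable lebesgue f"
    and total: "(LINT x | lebesgue. f x) = 0"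
    and box: "\<And>a b. (LINT x : box a b | lebesgue. f x) = 0"
  shows "AE x in lebesgue. f x = 0"
proof (rule density_unique_real[OF f])
  show "integrable lebesgue (\<lambda>x :: real ^ 'n. 0 :: real)" by simp
  fix A :: "(real ^ 'n) set"
  assume A: "A \<in> sets lebesgue"
  then obtain S N N' where S: "A = S \<union> N" "N \<subseteq> N'" "N' \<in> null_sets lborel" "S \<in> sets lborel"
    by (rule sets_completionE)
  have "AE x in lebesgue. x \<notin> N'" using S(3) by (intro AE_completion AE_not_in)
  then have "(LINT x : A | lebesgue. f x) = (LINT x : S | lebesgue. f x)"
    unfolding set_lebesgue_integral_def
  proof (intro integral_cong_AE)
    show "(\<lambda>x. indicator A x *\<^sub>R f x) \<in> borel_measurable lebesgue"
      "(\<lambda>x. indicator S x *\<^sub>R f x) \<in> borel_measurable lebesgue"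
      using A sets_completionI_sets[OF S(4)] f
      by (auto intro!: borel_measurable_scaleR borel_measurable_indicator simp del: indicator_simps)
    show "AE x in lebesgue. indicator A x *\<^sub>R f x = indicator S x *\<^sub>R f x"
      using \<open>AE x in lebesgue. x \<notin> N'\<close> by eventually_elim (use S(1,2) in \<open>auto simp: indicator_def\<close>)
  qed
  then show "(LINT x : A | lebesgue. f x) = (LINT x : A | lebesgue. 0)"
    using sigma_sets_box_integral_zero[OF f total box] S(4) by simp
qed

locale bounded_open =
  fixes \<Omega> :: "(real ^ 'n) set"
  assumes open_domain: "open \<Omega>" and bounded_domain: "bounded \<Omega>"
begin

abbreviation "M \<equiv> lebesgue_on \<Omega>"

lemma domain_lmeasurable [simp]: "\<Omega> \<in> lmeasurable"
  using open_domain bounded_domain by (simp add: lmeasurable_open)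

lemma domain_sets [simp]: "\<Omega> \<in> sets lebesgue"
  using domain_lmeasurable by (rule fmeasurableD)

sublocale finite_measure M
  by (rule finite_measure_lebesgue_on[OF domain_lmeasurable])

lemma borel_measurable_on_domain [simp]: "f \<in> borel_measurable borel \<Longrightarrow> f \<in> borel_measurable M"
  by (intro measurable_restrict_space1 measurable_completion) auto

lemma bounded_imp_L2:
  assumes "f \<in> borel_measurable M" "\<And>x. norm (f x) \<le> B"
  shows "f \<in> L2_space \<Omega>"
proof (rule L2_spaceI_bound[OF assms(1)])
  show "AE x in M. (norm (f x))\<^sup>2 \<le> B\<^sup>2" using assms(2) by (intro AE_I2 power_mono) auto
qed simp

lemma continuous_compact_support_imp_L2:
  assumes "continuous_on UNIV f" "compact K" "\<And>x. x \<notin> K \<Longrightarrow> f x = 0"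
  shows "f \<in> L2_space \<Omega>"
proof -
  obtain B where "\<And>x. norm (f x) \<le> B" using continuous_compact_support_bounded[OF assms] by blast
  then show ?thesis using assms(1) by (intro bounded_imp_L2 borel_measurable_on_domain borel_measurable_continuous_onI) auto
qed

lemma test_function_support:
  assumes "\<phi> \<in> test_functions \<Omega>"
  shows "\<exists>K. compact K \<and> K \<subseteq> \<Omega> \<and> (\<forall>x. x \<notin> K \<longrightarrow> \<phi> x = 0 \<and> grad \<phi> x = 0)"
proof -
  have K: "compact (closure {x. \<phi> x \<noteq> 0})" "closure {x. \<phi> x \<noteq> 0} \<subseteq> \<Omega>"
    using assms by (auto simp: test_functions_def)
  have z: "x \<notin> closure {x. \<phi> x \<noteq> 0} \<Longrightarrow> \<phi> x = 0" for x
    using closure_subset[of "{x. \<phi> x \<noteq> 0}"] by auto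
  have "x \<notin> closure {x. \<phi> x \<noteq> 0} \<Longrightarrow> grad \<phi> x = 0" for x
    by (rule grad_eq_0_outside[OF closed_closure z])
  with K z show ?thesis by blast
qed

lemma test_function_C1: "\<phi> \<in> test_functions \<Omega> \<Longrightarrow> C_k (Suc 0) \<phi>"
  by (simp only: test_functions_def mem_Collect_eq)

lemma C1_continuous: "C_k (Suc 0) \<phi> \<Longrightarrow> continuous_on UNIV \<phi>"
  using C_k_Suc[of 0 \<phi>] by simp

lemma test_L2: assumes "\<phi> \<in> test_functions \<Omega>" shows "\<phi> \<in> L2_space \<Omega>" "grad \<phi> \<in> L2_space \<Omega>"
proof -
  obtain K where K: "compact K" "K \<subseteq> \<Omega>" "\<And>x. x \<notin> K \<Longrightarrow> \<phi> x = 0" "\<And>x. x \<notin> K \<Longrightarrow> grad \<phi> x = 0"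
    using test_function_support[OF assms] by blast
  show "\<phi> \<in> L2_space \<Omega>" "grad \<phi> \<in> L2_space \<Omega>"
    using K test_function_C1[OF assms]
    by (intro continuous_compact_support_imp_L2[of _ K] C1_continuous continuous_on_grad; simp)+
qed

lemma test_linear:
  assumes "\<phi> \<in> test_functions \<Omega>" "\<psi> \<in> test_functions \<Omega>"
  shows "(\<lambda>x. a * \<phi> x + b * \<psi> x) \<in> test_functions \<Omega>"
proof -
  let ?S = "\<lambda>\<phi>. {x. \<phi> x \<noteq> (0 :: real)}"
  have "closure (?S (\<lambda>x. a * \<phi> x + b * \<psi> x)) \<subseteq> closure (?S \<phi>) \<union> closure (?S \<psi>)"
    unfolding closure_Un[symmetric] by (rule closure_mono) auto
  moreover have "compact (closure (?S \<phi>) \<union> closure (?S \<psi>))" "closure (?S \<phi>) \<union> closure (?S \<psi>) \<subseteq> \<Omega>"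
    using assms by (auto simp: test_functions_def)
  ultimately have "compact (closure (?S (\<lambda>x. a * \<phi> x + b * \<psi> x)))"
    "closure (?S (\<lambda>x. a * \<phi> x + b * \<psi> x)) \<subseteq> \<Omega>"
    by (meson bounded_closure bounded_subset closed_closure compact_eq_bounded_closed, blast)
  moreover have "\<And>k. C_k k (\<lambda>x. a * \<phi> x + b * \<psi> x)"
    using assms by (intro C_k_linear) (auto simp: test_functions_def)
  ultimately show ?thesis unfolding test_functions_def by blast
qed

lemma zero_test [simp]: "(\<lambda>_. 0) \<in> test_functions \<Omega>"
  by (simp add: test_functions_def)

lemma subspace_test: "subspace (test_functions \<Omega>)"
proof (rule subspaceI)
  show "0 \<in> test_functions \<Omega>" using zero_test by (simp add: zero_fun_def)
  show "\<phi> + \<psi> \<in> test_functions \<Omega>" if "\<phi> \<in> test_functions \<Omega>" "\<psi> \<in> test_functions \<Omega>" for \<phi> \<psi>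
    using test_linear[OF that, of 1 1] by (simp add: plus_fun_def)
  show "c *\<^sub>R \<phi> \<in> test_functions \<Omega>" if "\<phi> \<in> test_functions \<Omega>" for c \<phi>
    using test_linear[OF that that, of c 0] by (simp add: scaleR_fun_def)
qed

lemma integral_grad_eq_0_on:
  assumes \<phi>: "C_k (Suc 0) \<phi>" and K: "compact K" "K \<subseteq> \<Omega>" "\<And>x. x \<notin> K \<Longrightarrow> \<phi> x = 0"
  shows "(LINT x | M. grad \<phi> x $ i) = 0"
proof -
  have "(LINT x | M. grad \<phi> x $ i) = (LINT x | lborel. grad \<phi> x $ i)"
  proof (rule integral_lebesgue_on_eq_lborel)
    show "(\<lambda>x. grad \<phi> x $ i) \<in> borel_measurable borel"
      using \<phi> by (auto intro!: borel_measurable_continuous_onI)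
    show "grad \<phi> x $ i = 0" if "x \<notin> \<Omega>" for x
    proof -
      have "grad \<phi> x = 0"
        by (rule grad_eq_0_outside[OF compact_imp_closed[OF K(1)] K(3)]) (use K(2) that in auto)
      then show ?thesis by simp
    qed
  qed simp
  with integral_grad_eq_0[OF \<phi> K(1) K(3)] show ?thesis by simp
qed

lemma integration_by_parts:
  assumes \<phi>: "\<phi> \<in> test_functions \<Omega>" and \<psi>: "\<psi> \<in> test_functions \<Omega>"
  shows "(LINT x | M. \<phi> x * grad \<psi> x $ i) = - (LINT x | M. \<psi> x * grad \<phi> x $ i)"
proof -
  obtain K where K: "compact K" "K \<subseteq> \<Omega>" "\<And>x. x \<notin> K \<Longrightarrow> \<phi> x = 0"
    "\<And>x. x \<notin> K \<Longrightarrow> grad \<phi> x = 0"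
    using test_function_support[OF \<phi>] by blast
  note C = test_function_C1[OF \<phi>] test_function_C1[OF \<psi>]
  have int: "integrable M (\<lambda>x. f x * grad g x $ i)"
    if "f \<in> test_functions \<Omega>" "g \<in> test_functions \<Omega>" for f g
    using integrable_L2_inner[OF test_L2(1)[OF that(1)] L2_norm_component_sum(2)[OF test_L2(2)[OF that(2)], of i]]
    by simp
  have "(LINT x | M. \<phi> x * grad \<psi> x $ i) + (LINT x | M. \<psi> x * grad \<phi> x $ i)
      = (LINT x | M. grad (\<lambda>x. \<phi> x * \<psi> x) x $ i)"
    using C by (simp add: grad_mult flip: Bochner_Integration.integral_add[OF int[OF \<phi> \<psi>] int[OF \<psi> \<phi>]])
  also have "\<dots> = 0"
    by (rule integral_grad_eq_0_on[OF C_k_mult[OF C] K(1,2)]) (simp add: K)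
  finally show ?thesis by simp
qed

lemma vec_nth_integral:
  fixes f :: "real ^ 'n \<Rightarrow> real ^ 'n"
  assumes "integrable M f"
  shows "(LINT x | M. f x) $ i = (LINT x | M. f x $ i)"
  by (rule integral_bounded_linear[OF bounded_linear_vec_nth assms, symmetric])

lemma integrable_scaleR_L2:
  fixes f :: "real ^ 'n \<Rightarrow> real" and g :: "real ^ 'n \<Rightarrow> real ^ 'n"
  assumes f: "f \<in> L2_space \<Omega>" and g: "g \<in> L2_space \<Omega>"
  shows "integrable M (\<lambda>x. f x *\<^sub>R g x)"
proof -
  have "integrable M (\<lambda>x. norm (f x) \<bullet> norm (g x))"
    by (rule integrable_L2_inner) (use L2_spaceD[OF f] L2_spaceD[OF g] in \<open>auto simp: L2_space_def\<close>)
  then show ?thesis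
    using L2_spaceD(1)[OF f] L2_spaceD(1)[OF g]
    by (subst integrable_norm_iff[symmetric]) auto
qed

text \<open>Splitting the vector-valued identity into components expresses it by scalar inner
  products, to which the rules of \<open>semi_inner\<close> apply.\<close>

lemma has_weak_grad_iff:
  "has_weak_grad \<Omega> u g \<longleftrightarrow> u \<in> L2_space \<Omega> \<and> g \<in> L2_space \<Omega> \<and>
     (\<forall>\<phi>\<in>test_functions \<Omega>. \<forall>i. L2_inner \<Omega> u (\<lambda>x. grad \<phi> x $ i) = - L2_inner \<Omega> (\<lambda>x. g x $ i) \<phi>)"
proof -
  have "(LINT x | M. u x *\<^sub>R grad \<phi> x) = - (LINT x | M. \<phi> x *\<^sub>R g x) \<longleftrightarrow>
      (\<forall>i. L2_inner \<Omega> u (\<lambda>x. grad \<phi> x $ i) = - L2_inner \<Omega> (\<lambda>x. g x $ i) \<phi>)"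
    if "u \<in> L2_space \<Omega>" "g \<in> L2_space \<Omega>" "\<phi> \<in> test_functions \<Omega>" for \<phi>
    using integrable_scaleR_L2[OF that(1) test_L2(2)[OF that(3)]]
      integrable_scaleR_L2[OF test_L2(1)[OF that(3)] that(2)]
    by (simp add: vec_eq_iff vec_nth_integral L2_inner_def mult.commute)
  then show ?thesis unfolding has_weak_grad_def by blast
qed

lemma test_has_weak_grad:
  assumes "\<phi> \<in> test_functions \<Omega>"
  shows "has_weak_grad \<Omega> \<phi> (grad \<phi>)"
  unfolding has_weak_grad_iff
proof (intro conjI ballI allI)
  fix \<psi> i
  assume "\<psi> \<in> test_functions \<Omega>"
  from integration_by_parts[OF assms this, of i]
  show "L2_inner \<Omega> \<phi> (\<lambda>x. grad \<psi> x $ i) = - L2_inner \<Omega> (\<lambda>x. grad \<phi> x $ i) \<psi>"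
    by (simp add: L2_inner_def mult.commute)
qed (rule test_L2[OF assms])+

text \<open>Integrating the derivative of \<open>x\<^sub>i \<phi>\<^sup>2\<close> gives \<open>\<parallel>\<phi>\<parallel>\<^sup>2 = - 2 (x\<^sub>i \<phi>, \<partial>\<^sub>i \<phi>)\<close>.\<close>

lemma Poincare_test:
  "\<exists>C>0. \<forall>\<phi>\<in>test_functions \<Omega>. L2_norm \<Omega> \<phi> \<le> C * L2_norm \<Omega> (grad \<phi>)"
proof -
  obtain R where R: "R > 0" "\<And>x. x \<in> \<Omega> \<Longrightarrow> norm x \<le> R"
    using bounded_domain by (auto simp: bounded_pos)
  have "L2_norm \<Omega> \<phi> \<le> 2 * R * L2_norm \<Omega> (grad \<phi>)" if \<phi>: "\<phi> \<in> test_functions \<Omega>" for \<phi>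
  proof -
    \<comment> \<open>A single coordinate direction suffices. The factor \<open>R\<close> in the
      constant bounds this coordinate on the domain; the factor 2 comes from differentiating the
      square.\<close>
    fix i :: 'n
    obtain K where K: "compact K" "K \<subseteq> \<Omega>" "\<And>x. x \<notin> K \<Longrightarrow> \<phi> x = 0"
    "\<And>x. x \<notin> K \<Longrightarrow> grad \<phi> x = 0"
      using test_function_support[OF \<phi>] by blast
    note C = test_function_C1[OF \<phi>]
    have d: "\<phi> differentiable (at x)" "(\<lambda>x. x $ i) differentiable (at x)" for x
      using C C_k_component[of "Suc 0" i] by auto
    have gi: "grad (\<lambda>x. x $ i) x $ i = 1" for x :: "real ^ 'n"
    proof -
      have "grad (\<lambda>x. x $ i) x = axis i 1" for x :: "real ^ 'n"
        by (rule grad_eqI)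
          (auto intro!: derivative_eq_intros bounded_linear.has_derivative[OF bounded_linear_vec_nth]
            simp: inner_commute cart_eq_inner_axis)
      then show ?thesis by simp
    qed
    note \<phi>2 = test_L2(1)[OF \<phi>]
    have w_le: "\<bar>x $ i * grad \<phi> x $ i\<bar> \<le> R * norm (grad \<phi> x)" for x
    proof (cases "x \<in> \<Omega>")
      case True
      then show ?thesis
        unfolding abs_mult
        by (intro mult_mono order_trans[OF component_le_norm_cart R(2)] component_le_norm_cart) (use R in auto)
    next
      case False
      then have "x \<notin> K" using K(2) by blast
      then show ?thesis using K(4)[of x] by simp
    qed
    have w_meas: "(\<lambda>x. x $ i * grad \<phi> x $ i) \<in> borel_measurable M"
      by (intro borel_measurable_on_domain borel_measurable_continuous_onI continuous_on_mult
          continuous_on_component continuous_on_grad[OF C] continuous_on_id)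
    have w_sq: "(norm (x $ i * grad \<phi> x $ i))\<^sup>2 \<le> R\<^sup>2 * (norm (grad \<phi> x))\<^sup>2" for x
      using power_mono[OF w_le[of x] abs_ge_zero, of 2] by (simp add: power_mult_distrib)
    have gsq: "integrable M (\<lambda>x. R\<^sup>2 * (norm (grad \<phi> x))\<^sup>2)"
      using L2_spaceD(2)[OF test_L2(2)[OF \<phi>]] by simp
    have w: "(\<lambda>x. x $ i * grad \<phi> x $ i) \<in> L2_space \<Omega>"
      by (rule L2_spaceI_bound[OF w_meas gsq]) (use w_sq in simp)
    have w_norm: "L2_norm \<Omega> (\<lambda>x. x $ i * grad \<phi> x $ i) \<le> R * L2_norm \<Omega> (grad \<phi>)"
    proof (rule power2_le_imp_le)
      show "(L2_norm \<Omega> (\<lambda>x. x $ i * grad \<phi> x $ i))\<^sup>2 \<le> (R * L2_norm \<Omega> (grad \<phi>))\<^sup>2"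
        unfolding power_mult_distrib L2_norm_sq
        using integral_mono[OF L2_spaceD(2)[OF w] gsq w_sq] by simp
    qed (use R(1) L2.nrm_nonneg[OF test_L2(2)[OF \<phi>]] in simp)
    have "0 = (LINT x | M. grad (\<lambda>x. x $ i * (\<phi> x * \<phi> x)) x $ i)"
      by (rule integral_grad_eq_0_on[OF C_k_mult[OF C_k_component C_k_mult[OF C C]] K(1,2), symmetric])
        (simp add: K)
    also have "\<dots> = (LINT x | M. \<phi> x \<bullet> \<phi> x + 2 * (\<phi> x \<bullet> (x $ i * grad \<phi> x $ i)))"
      using d by (simp add: grad_mult gi differentiable_mult algebra_simps)
    also have "\<dots> = L2_inner \<Omega> \<phi> \<phi> + 2 * L2_inner \<Omega> \<phi> (\<lambda>x. x $ i * grad \<phi> x $ i)"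
      using integrable_L2_inner[OF \<phi>2 \<phi>2] integrable_L2_inner[OF \<phi>2 w]
      unfolding L2_inner_def by simp
    finally have "(L2_norm \<Omega> \<phi>)\<^sup>2 \<le> 2 * \<bar>L2_inner \<Omega> \<phi> (\<lambda>x. x $ i * grad \<phi> x $ i)\<bar>"
      by (simp add: L2.nrm_sq \<phi>2)
    also have "\<dots> \<le> 2 * (L2_norm \<Omega> \<phi> * (R * L2_norm \<Omega> (grad \<phi>)))"
    proof -
      have "L2_norm \<Omega> \<phi> * L2_norm \<Omega> (\<lambda>x. x $ i * grad \<phi> x $ i)
          \<le> L2_norm \<Omega> \<phi> * (R * L2_norm \<Omega> (grad \<phi>))"
        by (intro mult_left_mono w_norm L2.nrm_nonneg \<phi>2)
      then show ?thesis using L2.Cauchy_Schwarz[OF \<phi>2 w] by simp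
    qed
    finally have "L2_norm \<Omega> \<phi> * L2_norm \<Omega> \<phi> \<le> L2_norm \<Omega> \<phi> * (2 * R * L2_norm \<Omega> (grad \<phi>))"
      by (simp add: power2_eq_square)
    then show ?thesis
      using L2.nrm_nonneg[OF \<phi>2] L2.nrm_nonneg[OF test_L2(2)[OF \<phi>]] R(1)
      by (cases "L2_norm \<Omega> \<phi> = 0") (auto simp: mult_le_cancel_left)
  qed
  then show ?thesis using R(1) by (intro exI[of _ "2 * R"]) auto
qed

text \<open>Boxes suffice because the functions \<open>bump a b m\<close> converge boundedly to the indicator
  of a box.\<close>

lemma du_Bois_Reymond:
  fixes z :: "real ^ 'n \<Rightarrow> real"
  assumes z: "integrable M z" and orth: "\<And>\<phi>. \<phi> \<in> test_functions \<Omega> \<Longrightarrow> (LINT x | M. z x * \<phi> x) = 0"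
  shows "AE x in M. z x = 0"
proof -
  \<comment> \<open>Extension by zero, so that integrals over boxes can be taken in the whole
    space.\<close>
  define w where "w x = indicator \<Omega> x *\<^sub>R z x" for x
  have w: "integrable lebesgue w"
    using z unfolding w_def by (subst (asm) integrable_restrict_space) auto
  have box0: "(LINT x : box a b | lebesgue. w x) = 0" if ab: "cbox a b \<subseteq> \<Omega>" for a b
  proof -
    have "(\<lambda>k. LINT x | lebesgue. bump a b (real (Suc k)) x * w x) \<longlonglongrightarrow> (LINT x | lebesgue. indicator (box a b) x * w x)"
    proof (rule integral_dominated_convergence[where w = "\<lambda>x. norm (w x)"])
      show "AE x in lebesgue. (\<lambda>k. bump a b (real (Suc k)) x * w x) \<longlonglongrightarrow> indicator (box a b) x * w x"
        by (intro AE_I2 tendsto_intros bump_tendsto)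
      show "AE x in lebesgue. norm (bump a b (real (Suc k)) x * w x) \<le> norm (w x)" for k
        using bump_bounds[of a b "real (Suc k)"] by (intro AE_I2) (simp add: abs_mult mult_left_le_one_le)
      have "bump a b (real (Suc k)) \<in> borel_measurable borel" for k
        using bump_test_function[OF ab, of "real (Suc k)"]
        by (auto intro!: borel_measurable_continuous_onI C1_continuous test_function_C1)
      then have "bump a b (real (Suc k)) \<in> borel_measurable lebesgue" for k
        by (intro measurable_completion) simp
      then show "(\<lambda>x. bump a b (real (Suc k)) x * w x) \<in> borel_measurable lebesgue" for k
        using w by (intro borel_measurable_times) auto
      show "(\<lambda>x. indicator (box a b) x * w x) \<in> borel_measurable lebesgue"
        using borel_measurable_integrable[OF w] by (intro borel_measurable_times borel_measurable_indicator) auto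
    qed (use w in auto)
    moreover have "(LINT x | lebesgue. bump a b (real (Suc k)) x * w x) = 0" for k
    proof -
      have "(LINT x | M. z x * bump a b (real (Suc k)) x)
          = (LINT x | lebesgue. indicator \<Omega> x *\<^sub>R (z x * bump a b (real (Suc k)) x))"
        by (rule integral_restrict_space) simp
      with orth[OF bump_test_function[OF ab, of "real (Suc k)"]] show ?thesis
        by (simp add: w_def mult_ac)
    qed
    ultimately show ?thesis by (simp add: set_lebesgue_integral_def LIMSEQ_const_iff)
  qed
  \<comment> \<open>Cutting \<open>w\<close> off to \<open>box a b\<close> turns the integral over
    an arbitrary box into one over an intersection, which is again a box and lies in the
    domain.\<close>
  have on_box: "AE x in lebesgue. x \<in> cbox a b \<longrightarrow> w x = 0" if ab: "cbox a b \<subseteq> \<Omega>" for a b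
  proof -
    have "AE x in lebesgue. indicator (box a b) x *\<^sub>R w x = 0"
    proof (rule AE_zero_of_box_integrals)
      show "integrable lebesgue (\<lambda>x. indicator (box a b) x *\<^sub>R w x)"
        using w by (intro integrable_mult_indicator) auto
      show "(LINT x | lebesgue. indicator (box a b) x *\<^sub>R w x) = 0"
        using box0[OF ab] by (simp add: set_lebesgue_integral_def)
      fix c d
      obtain e f where ef: "box a b \<inter> box c d = box e f" by (auto simp: box_Int_box)
      show "(LINT x : box c d | lebesgue. indicator (box a b) x *\<^sub>R w x) = 0"
      \<comment> \<open>An empty open box may belong to a nonempty closed one, so the inclusion of
        \<open>cbox e f\<close> in \<open>cbox a b\<close> is available only in the second
        case.\<close>
      proof (cases "box e f = {}")
        case True
        then have "indicator (box c d) x *\<^sub>R indicator (box a b) x *\<^sub>R w x = 0" for x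
          using ef by (auto simp: indicator_def)
        then show ?thesis by (simp only: set_lebesgue_integral_def Bochner_Integration.integral_zero)
      next
        case False
        have "closure (box e f) \<subseteq> closure (box a b)" using ef by (intro closure_mono) auto
        then have "cbox e f \<subseteq> cbox a b"
          using False ef closure_box[of e f] closure_box[of a b] by (cases "box a b = {}") auto
        with ab box0[of e f] have "(LINT x : box e f | lebesgue. w x) = 0" by blast
        moreover have "indicator (box c d) x *\<^sub>R indicator (box a b) x *\<^sub>R w x = indicator (box e f) x *\<^sub>R w x" for x
          unfolding ef[symmetric] by (simp add: indicator_inter_arith)
        ultimately show ?thesis by (simp only: set_lebesgue_integral_def)
      qed
    qed
    moreover have "AE x in lebesgue. x \<notin> cbox a b - box a b"
      using negligible_frontier_interval[of a b] by (intro AE_not_in) (simp add: negligible_iff_null_sets)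
    ultimately show ?thesis by eventually_elim (auto simp: indicator_def)
  qed
  \<comment> \<open>The domain is a countable union of closed boxes, so the exceptional sets add up
    to a null set.\<close>
  obtain D where D: "countable D" "D \<subseteq> Pow \<Omega>" "\<And>X. X \<in> D \<Longrightarrow> \<exists>a b. X = cbox a b" "\<Union>D = \<Omega>"
    using open_countable_Union_open_cbox[OF open_domain] by metis
  have "AE x in lebesgue. \<forall>X\<in>D. x \<in> X \<longrightarrow> w x = 0"
    unfolding AE_ball_countable[OF D(1)]
  proof
    fix X assume "X \<in> D"
    then obtain a b where "X = cbox a b" "cbox a b \<subseteq> \<Omega>" using D by blast
    then show "AE x in lebesgue. x \<in> X \<longrightarrow> w x = 0" using on_box by simp
  qed
  then have "AE x in lebesgue. x \<in> \<Omega> \<longrightarrow> z x = 0"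
    by eventually_elim (use D(4) in \<open>force simp: w_def\<close>)
  then show ?thesis by (simp add: AE_restrict_space_iff)
qed

lemma L2_orthogonal_test_AE_zero:
  fixes z :: "real ^ 'n \<Rightarrow> real"
  assumes "z \<in> L2_space \<Omega>" "\<And>\<phi>. \<phi> \<in> test_functions \<Omega> \<Longrightarrow> L2_inner \<Omega> z \<phi> = 0"
  shows "AE x in M. z x = 0"
  using assms by (intro du_Bois_Reymond L2_imp_integrable) (auto simp: L2_inner_def)

end

section \<open>Weak derivatives and the Poisson problem\<close>

lemma L2_norm_component_le:
  fixes f :: "real ^ 'n \<Rightarrow> real ^ 'm"
  assumes f: "f \<in> L2_space \<Omega>"
  shows "L2_norm \<Omega> (\<lambda>x. f x $ i) \<le> L2_norm \<Omega> f"
proof (rule power2_le_imp_le)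
  show "(L2_norm \<Omega> (\<lambda>x. f x $ i))\<^sup>2 \<le> (L2_norm \<Omega> f)\<^sup>2"
    unfolding L2_norm_component_sum(1)[OF f] by (rule member_le_sum) auto
qed (use f in simp)

lemma L2_inner_component_sum:
  fixes f g :: "real ^ 'n \<Rightarrow> real ^ 'm"
  assumes f: "f \<in> L2_space \<Omega>" and g: "g \<in> L2_space \<Omega>"
  shows "L2_inner \<Omega> f g = (\<Sum>i\<in>UNIV. L2_inner \<Omega> (\<lambda>x. f x $ i) (\<lambda>x. g x $ i))"
  using integrable_L2_inner[OF L2_norm_component_sum(2)[OF f] L2_norm_component_sum(2)[OF g]]
  by (simp add: L2_inner_def inner_vec_def)

context bounded_open
begin

section \<open>Weak gradients: uniqueness, linearity, closedness\<close>

lemma has_weak_gradD: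
  assumes "has_weak_grad \<Omega> u g"
  shows "u \<in> L2_space \<Omega>" "g \<in> L2_space \<Omega>"
    "\<phi> \<in> test_functions \<Omega> \<Longrightarrow> L2_inner \<Omega> u (\<lambda>x. grad \<phi> x $ i) = - L2_inner \<Omega> (\<lambda>x. g x $ i) \<phi>"
  using assms by (auto simp: has_weak_grad_iff)

text \<open>Componentwise the difference of the gradients is orthogonal to every test function.
  Letting \<open>u\<close> and \<open>u'\<close> differ on a null set serves the Poisson problem,
  whose solutions are unique only in that sense.\<close>

lemma has_weak_grad_unique:
  assumes "has_weak_grad \<Omega> u g" "has_weak_grad \<Omega> u' g'" and eq: "AE x in M. u x = u' x"
  shows "AE x in M. g x = g' x"
proof -
  note u = has_weak_gradD[OF assms(1)] and u' = has_weak_gradD[OF assms(2)]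
  have "AE x in M. g x $ i - g' x $ i = 0" for i
  proof (rule L2_orthogonal_test_AE_zero)
    have c: "(\<lambda>x. g x $ i) \<in> L2_space \<Omega>" "(\<lambda>x. g' x $ i) \<in> L2_space \<Omega>"
      using u u' by (auto intro: L2_norm_component_sum)
    then show "(\<lambda>x. g x $ i - g' x $ i) \<in> L2_space \<Omega>"
      using L2.mem(2)[OF c] by (simp add: fun_diff_def)
    fix \<phi> assume \<phi>: "\<phi> \<in> test_functions \<Omega>"
    have "L2_inner \<Omega> u (\<lambda>x. grad \<phi> x $ i) = L2_inner \<Omega> u' (\<lambda>x. grad \<phi> x $ i)"
      using L2_norm_component_sum(2)[OF test_L2(2)[OF \<phi>]] eq u(1) u'(1)
      by (intro L2_inner_cong_AE) (auto dest: L2_spaceD)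
    then show "L2_inner \<Omega> (\<lambda>x. g x $ i - g' x $ i) \<phi> = 0"
      using L2.diff_left[OF c test_L2(1)[OF \<phi>]] u(3)[OF \<phi>, of i] u'(3)[OF \<phi>, of i]
      by (simp add: fun_diff_def)
  qed
  then have "AE x in M. \<forall>i. g x $ i - g' x $ i = 0" by (simp add: AE_all_countable)
  then show ?thesis by eventually_elim (simp add: vec_eq_iff)
qed

lemma has_weak_grad_cong_AE:
  assumes "has_weak_grad \<Omega> u g" "u' \<in> L2_space \<Omega>" "AE x in M. u x = u' x"
  shows "has_weak_grad \<Omega> u' g"
  unfolding has_weak_grad_iff
proof (intro conjI ballI allI)
  note u = has_weak_gradD[OF assms(1)]
  show "g \<in> L2_space \<Omega>" by (rule u)
  fix \<phi> i assume \<phi>: "\<phi> \<in> test_functions \<Omega>"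
  have "L2_inner \<Omega> u' (\<lambda>x. grad \<phi> x $ i) = L2_inner \<Omega> u (\<lambda>x. grad \<phi> x $ i)"
    using L2_norm_component_sum(2)[OF test_L2(2)[OF \<phi>]] assms(2,3) u(1)
    by (intro L2_inner_cong_AE) (auto dest: L2_spaceD)
  then show "L2_inner \<Omega> u' (\<lambda>x. grad \<phi> x $ i) = - L2_inner \<Omega> (\<lambda>x. g x $ i) \<phi>"
    using u(3)[OF \<phi>] by simp
qed (rule assms)

lemma has_weak_grad_linear:
  assumes "has_weak_grad \<Omega> u g" "has_weak_grad \<Omega> v k"
  shows "has_weak_grad \<Omega> (a *\<^sub>R u + b *\<^sub>R v) (a *\<^sub>R g + b *\<^sub>R k)"
  unfolding has_weak_grad_iff
proof (intro conjI ballI allI)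
  note u = has_weak_gradD[OF assms(1)] and v = has_weak_gradD[OF assms(2)]
  show "a *\<^sub>R u + b *\<^sub>R v \<in> L2_space \<Omega>" "a *\<^sub>R g + b *\<^sub>R k \<in> L2_space \<Omega>" using u v by auto
  fix \<phi> i assume \<phi>: "\<phi> \<in> test_functions \<Omega>"
  note t = test_L2(1)[OF \<phi>] L2_norm_component_sum(2)[OF test_L2(2)[OF \<phi>], of i]
  note c = L2_norm_component_sum(2)[OF u(2), of i] L2_norm_component_sum(2)[OF v(2), of i]
  have eq: "(\<lambda>x. (a *\<^sub>R g + b *\<^sub>R k) x $ i) = a *\<^sub>R (\<lambda>x. g x $ i) + b *\<^sub>R (\<lambda>x. k x $ i)"
    by (simp add: fun_eq_iff)
  show "L2_inner \<Omega> (a *\<^sub>R u + b *\<^sub>R v) (\<lambda>x. grad \<phi> x $ i)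
      = - L2_inner \<Omega> (\<lambda>x. (a *\<^sub>R g + b *\<^sub>R k) x $ i) \<phi>"
    unfolding eq using u v c t by (simp add: L2.add_left L2.scale_left \<phi>)
qed

lemma has_weak_grad_diff:
  "has_weak_grad \<Omega> u g \<Longrightarrow> has_weak_grad \<Omega> v k \<Longrightarrow> has_weak_grad \<Omega> (u - v) (g - k)"
  using has_weak_grad_linear[of u g v k 1 "-1"] by simp

text \<open>The weak gradient is a closed operator: for a fixed test function both sides of its
  defining identity are continuous in L2.\<close>

lemma has_weak_grad_limit:
  assumes f: "\<And>k. has_weak_grad \<Omega> (f k) (g k)" and F: "F \<in> L2_space \<Omega>" "G \<in> L2_space \<Omega>"
    and lim: "(\<lambda>k. L2_norm \<Omega> (f k - F)) \<longlonglongrightarrow> 0" "(\<lambda>k. L2_norm \<Omega> (g k - G)) \<longlonglongrightarrow> 0"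
  shows "has_weak_grad \<Omega> F G"
  unfolding has_weak_grad_iff
proof (intro conjI ballI allI)
  note f' = has_weak_gradD[OF f]
  fix \<phi> i assume \<phi>: "\<phi> \<in> test_functions \<Omega>"
  have "(\<lambda>k. L2_inner \<Omega> (f k) (\<lambda>x. grad \<phi> x $ i)) \<longlonglongrightarrow> L2_inner \<Omega> F (\<lambda>x. grad \<phi> x $ i)"
    by (intro L2.tendsto_ip f' F lim L2_norm_component_sum test_L2 \<phi>)
  moreover have "(\<lambda>k. L2_inner \<Omega> (\<lambda>x. g k x $ i) \<phi>) \<longlonglongrightarrow> L2_inner \<Omega> (\<lambda>x. G x $ i) \<phi>"
  proof (intro L2.tendsto_ip f' F L2_norm_component_sum test_L2 \<phi>)
    show "(\<lambda>k. L2_norm \<Omega> ((\<lambda>x. g k x $ i) - (\<lambda>x. G x $ i))) \<longlonglongrightarrow> 0"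
    proof (rule Lim_null_comparison[OF _ lim(2)])
      have "L2_norm \<Omega> ((\<lambda>x. g k x $ i) - (\<lambda>x. G x $ i)) \<le> L2_norm \<Omega> (g k - G)" for k
        using L2_norm_component_le[OF L2.mem(2)[OF f'(2)[of k] F(2)], of i] by (simp add: fun_diff_def)
      moreover have "0 \<le> L2_norm \<Omega> ((\<lambda>x. g k x $ i) - (\<lambda>x. G x $ i))" for k
        using f'(2)[of k] F by (intro L2.nrm_nonneg L2.mem L2_norm_component_sum)
      ultimately show "\<forall>\<^sub>F k in sequentially. norm (L2_norm \<Omega> ((\<lambda>x. g k x $ i) - (\<lambda>x. G x $ i))) \<le> L2_norm \<Omega> (g k - G)"
        by simp
    qed
  qed
  ultimately show "L2_inner \<Omega> F (\<lambda>x. grad \<phi> x $ i) = - L2_inner \<Omega> (\<lambda>x. G x $ i) \<phi>"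
    using f'(3)[OF \<phi>, of _ i] by (auto dest: tendsto_minus intro: LIMSEQ_unique)
qed (rule F)+

lemma has_weak_grad_weak_grad: "has_weak_grad \<Omega> u g \<Longrightarrow> has_weak_grad \<Omega> u (weak_grad \<Omega> u)"
  unfolding weak_grad_def by (rule someI[where P = "has_weak_grad \<Omega> u"])

text \<open>The choice behind \<open>weak_grad\<close> need not respect sums or multiples pointwise.
  This lemma and the two that follow exchange it for whichever weak gradient is at hand.\<close>

lemma weak_grad_AE: "has_weak_grad \<Omega> u g \<Longrightarrow> AE x in M. weak_grad \<Omega> u x = g x"
  by (rule has_weak_grad_unique[OF has_weak_grad_weak_grad]) auto

lemma L2_norm_weak_grad: "has_weak_grad \<Omega> u g \<Longrightarrow> L2_norm \<Omega> (weak_grad \<Omega> u) = L2_norm \<Omega> g"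
  by (rule L2_norm_cong_AE[OF L2_spaceD(1) L2_spaceD(1) weak_grad_AE])
    (auto intro: has_weak_gradD(2) has_weak_grad_weak_grad)

lemma L2_inner_weak_grad:
  "has_weak_grad \<Omega> u g \<Longrightarrow> \<tau> \<in> L2_space \<Omega> \<Longrightarrow> L2_inner \<Omega> (weak_grad \<Omega> u) \<tau> = L2_inner \<Omega> g \<tau>"
  by (rule L2_inner_cong_AE[OF L2_spaceD(1) L2_spaceD(1) L2_spaceD(1) L2_spaceD(1) weak_grad_AE])
    (auto intro: has_weak_gradD(2) has_weak_grad_weak_grad)

lemma sobolev_1_iff: "u \<in> sobolev \<Omega> 1 \<longleftrightarrow> (\<exists>g. has_weak_grad \<Omega> u g)"
proof -
  have "(\<lambda>x. weak_grad \<Omega> u x $ i) \<in> L2_space \<Omega>" if "has_weak_grad \<Omega> u g" for g i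
    using has_weak_gradD(2)[OF has_weak_grad_weak_grad[OF that]] by (rule L2_norm_component_sum)
  then show ?thesis by (auto simp: sobolev_def)
qed

lemma sobolev_norm_1:
  assumes "has_weak_grad \<Omega> u g"
  shows "sobolev_norm \<Omega> 1 u = sqrt ((L2_norm \<Omega> u)\<^sup>2 + (L2_norm \<Omega> g)\<^sup>2)"
proof -
  have "(L2_norm \<Omega> (weak_grad \<Omega> u))\<^sup>2 = (\<Sum>i\<in>UNIV. (L2_norm \<Omega> (\<lambda>x. weak_grad \<Omega> u x $ i))\<^sup>2)"
    using has_weak_gradD(2)[OF has_weak_grad_weak_grad[OF assms]] by (rule L2_norm_component_sum)
  then show ?thesis
    by (simp add: sobolev_norm_def flip: L2_norm_weak_grad[OF assms])
qed

section \<open>Functions with zero boundary values as a Hilbert space under the Dirichlet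
  form\<close>

lemma H10_weak_grad: "u \<in> H10 \<Omega> \<Longrightarrow> has_weak_grad \<Omega> u (weak_grad \<Omega> u)"
  unfolding H10_def sobolev_1_iff by (auto intro: has_weak_grad_weak_grad)

lemma H10_L2: "u \<in> H10 \<Omega> \<Longrightarrow> u \<in> L2_space \<Omega>" "u \<in> H10 \<Omega> \<Longrightarrow> weak_grad \<Omega> u \<in> L2_space \<Omega>"
  using has_weak_gradD[OF H10_weak_grad] by auto

text \<open>A sequential form of the closure in which functions and gradients converge separately.
  Any weak gradient \<open>g\<close> may be used, so that limits and linear combinations can be
  tested with the gradient that their construction provides.\<close>

lemma H10_iff:
  assumes g: "has_weak_grad \<Omega> u g"
  shows "u \<in> H10 \<Omega> \<longleftrightarrow> (\<exists>\<phi> :: nat \<Rightarrow> _. (\<forall>k. \<phi> k \<in> test_functions \<Omega>) \<and>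
    (\<lambda>k. L2_norm \<Omega> (\<phi> k - u)) \<longlonglongrightarrow> 0 \<and> (\<lambda>k. L2_norm \<Omega> (grad (\<phi> k) - g)) \<longlonglongrightarrow> 0)"
    (is "_ \<longleftrightarrow> (\<exists>\<phi>. ?P \<phi>)")
proof -
  note u = has_weak_gradD[OF g]
  have nrm: "sobolev_norm \<Omega> 1 (\<lambda>x. u x - \<phi> x)
      = sqrt ((L2_norm \<Omega> (\<phi> - u))\<^sup>2 + (L2_norm \<Omega> (grad \<phi> - g))\<^sup>2)" if \<phi>: "\<phi> \<in> test_functions \<Omega>" for \<phi>
    using sobolev_norm_1[OF has_weak_grad_diff[OF g test_has_weak_grad[OF \<phi>]]]
      L2.nrm_minus_commute[OF u(1) test_L2(1)[OF \<phi>]] L2.nrm_minus_commute[OF u(2) test_L2(2)[OF \<phi>]]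
    by (simp add: fun_diff_def)
  show ?thesis
  proof
    assume "u \<in> H10 \<Omega>"
    then have "\<exists>\<phi>\<in>test_functions \<Omega>. sobolev_norm \<Omega> 1 (\<lambda>x. u x - \<phi> x) < inverse (real (Suc k))" for k
      by (simp add: H10_def)
    then obtain \<phi> where \<phi>: "\<And>k. \<phi> k \<in> test_functions \<Omega>"
      "\<And>k. sobolev_norm \<Omega> 1 (\<lambda>x. u x - \<phi> k x) < inverse (real (Suc k))" by metis
    have "norm (L2_norm \<Omega> (\<phi> k - u)) \<le> inverse (real (Suc k))"
      "norm (L2_norm \<Omega> (grad (\<phi> k) - g)) \<le> inverse (real (Suc k))" for k
    proof -
      have p: "\<phi> k - u \<in> L2_space \<Omega>" "grad (\<phi> k) - g \<in> L2_space \<Omega>" using test_L2[OF \<phi>(1)[of k]] u by auto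
      note lt = \<phi>(2)[of k, unfolded nrm[OF \<phi>(1)]]
      show "norm (L2_norm \<Omega> (\<phi> k - u)) \<le> inverse (real (Suc k))"
        using order_trans[OF real_sqrt_sum_squares_ge1 less_imp_le[OF lt]] L2.nrm_nonneg[OF p(1)] by simp
      show "norm (L2_norm \<Omega> (grad (\<phi> k) - g)) \<le> inverse (real (Suc k))"
        using order_trans[OF real_sqrt_sum_squares_ge2 less_imp_le[OF lt]] L2.nrm_nonneg[OF p(2)] by simp
    qed
    then have "?P \<phi>"
      using \<phi>(1) by (auto intro!: Lim_null_comparison[OF _ LIMSEQ_inverse_real_of_nat])
    then show "\<exists>\<phi>. ?P \<phi>" by (rule exI[of ?P \<phi>])
  next
    assume "\<exists>\<phi>. ?P \<phi>"
    then obtain \<phi> where \<phi>: "\<And>k. \<phi> k \<in> test_functions \<Omega>"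
      and lim: "(\<lambda>k. L2_norm \<Omega> (\<phi> k - u)) \<longlonglongrightarrow> 0" "(\<lambda>k. L2_norm \<Omega> (grad (\<phi> k) - g)) \<longlonglongrightarrow> 0" by blast
    have "(\<lambda>k. sqrt ((L2_norm \<Omega> (\<phi> k - u))\<^sup>2 + (L2_norm \<Omega> (grad (\<phi> k) - g))\<^sup>2)) \<longlonglongrightarrow> sqrt (0\<^sup>2 + 0\<^sup>2)"
      by (intro tendsto_intros lim)
    then have lim': "(\<lambda>k. sobolev_norm \<Omega> 1 (\<lambda>x. u x - \<phi> k x)) \<longlonglongrightarrow> 0" by (simp add: nrm[OF \<phi>])
    then have "\<exists>k. sobolev_norm \<Omega> 1 (\<lambda>x. u x - \<phi> k x) < \<epsilon>" if "\<epsilon> > 0" for \<epsilon>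
      using order_tendstoD(2)[OF lim' that] by (auto simp: eventually_sequentially)
    with \<phi> g show "u \<in> H10 \<Omega>" unfolding H10_def sobolev_1_iff by blast
  qed
qed

lemma H10_approx:
  assumes "u \<in> H10 \<Omega>"
  shows "\<exists>\<phi> :: nat \<Rightarrow> _. (\<forall>k. \<phi> k \<in> test_functions \<Omega>) \<and> (\<lambda>k. L2_norm \<Omega> (\<phi> k - u)) \<longlonglongrightarrow> 0 \<and>
    (\<lambda>k. L2_norm \<Omega> (grad (\<phi> k) - weak_grad \<Omega> u)) \<longlonglongrightarrow> 0"
  using H10_iff[OF H10_weak_grad[OF assms]] assms by blast

lemma test_H10: "\<phi> \<in> test_functions \<Omega> \<Longrightarrow> \<phi> \<in> H10 \<Omega>"
  unfolding H10_iff[OF test_has_weak_grad] by (rule exI[of _ "\<lambda>_. \<phi>"]) auto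

lemma H10_cong_AE:
  assumes u: "u \<in> H10 \<Omega>" and v: "v \<in> L2_space \<Omega>" and eq: "AE x in M. u x = v x"
  shows "v \<in> H10 \<Omega>"
proof -
  have g: "has_weak_grad \<Omega> v (weak_grad \<Omega> u)"
    by (rule has_weak_grad_cong_AE[OF H10_weak_grad[OF u] v eq])
  obtain \<phi> :: "nat \<Rightarrow> _" where \<phi>: "\<And>k. \<phi> k \<in> test_functions \<Omega>" "(\<lambda>k. L2_norm \<Omega> (\<phi> k - u)) \<longlonglongrightarrow> 0"
    "(\<lambda>k. L2_norm \<Omega> (grad (\<phi> k) - weak_grad \<Omega> u)) \<longlonglongrightarrow> 0" using H10_approx[OF u] by blast
  have "L2_norm \<Omega> (\<phi> k - u) = L2_norm \<Omega> (\<phi> k - v)" for k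
    using eq L2_spaceD(1)[OF L2.mem(2)[OF test_L2(1)[OF \<phi>(1)[of k]] v]]
      L2_spaceD(1)[OF L2.mem(2)[OF test_L2(1)[OF \<phi>(1)[of k]] H10_L2(1)[OF u]]]
    by (intro L2_norm_cong_AE) auto
  with \<phi> show ?thesis unfolding H10_iff[OF g] by auto
qed

lemma L2_norm_linear_le:
  assumes "f \<in> L2_space \<Omega>" "g \<in> L2_space \<Omega>"
  shows "L2_norm \<Omega> (a *\<^sub>R f + b *\<^sub>R g) \<le> \<bar>a\<bar> * L2_norm \<Omega> f + \<bar>b\<bar> * L2_norm \<Omega> g"
  using L2.nrm_triangle[of "a *\<^sub>R f" \<Omega> "b *\<^sub>R g"] assms by (simp add: L2.nrm_scale)

lemma H10_linear:
  assumes u: "u \<in> H10 \<Omega>" and v: "v \<in> H10 \<Omega>"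
  shows "a *\<^sub>R u + b *\<^sub>R v \<in> H10 \<Omega>"
proof -
  note g = has_weak_grad_linear[OF H10_weak_grad[OF u] H10_weak_grad[OF v], of a b]
  obtain \<phi> :: "nat \<Rightarrow> _" where \<phi>: "\<And>k. \<phi> k \<in> test_functions \<Omega>" "(\<lambda>k. L2_norm \<Omega> (\<phi> k - u)) \<longlonglongrightarrow> 0"
    "(\<lambda>k. L2_norm \<Omega> (grad (\<phi> k) - weak_grad \<Omega> u)) \<longlonglongrightarrow> 0" using H10_approx[OF u] by blast
  obtain \<psi> :: "nat \<Rightarrow> _" where \<psi>: "\<And>k. \<psi> k \<in> test_functions \<Omega>" "(\<lambda>k. L2_norm \<Omega> (\<psi> k - v)) \<longlonglongrightarrow> 0"
    "(\<lambda>k. L2_norm \<Omega> (grad (\<psi> k) - weak_grad \<Omega> v)) \<longlonglongrightarrow> 0" using H10_approx[OF v] by blast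
  have lim0: "(\<lambda>k. L2_norm \<Omega> (p k)) \<longlonglongrightarrow> 0"
    if "(\<lambda>k. L2_norm \<Omega> (q k)) \<longlonglongrightarrow> 0" "(\<lambda>k. L2_norm \<Omega> (r k)) \<longlonglongrightarrow> 0"
      "\<And>k. q k \<in> L2_space \<Omega>" "\<And>k. r k \<in> L2_space \<Omega>" "\<And>k. p k = a *\<^sub>R q k + b *\<^sub>R r k"
    for p q r :: "nat \<Rightarrow> real ^ 'n \<Rightarrow> 'b :: euclidean_space"
  proof (rule Lim_null_comparison)
    show "\<forall>\<^sub>F k in sequentially. norm (L2_norm \<Omega> (p k)) \<le> \<bar>a\<bar> * L2_norm \<Omega> (q k) + \<bar>b\<bar> * L2_norm \<Omega> (r k)"
      using L2_norm_linear_le[OF that(3,4)] that(3-5) by simp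
    show "(\<lambda>k. \<bar>a\<bar> * L2_norm \<Omega> (q k) + \<bar>b\<bar> * L2_norm \<Omega> (r k)) \<longlonglongrightarrow> 0"
      using that(1,2) by (auto intro!: tendsto_eq_intros)
  qed
  define \<theta> where "\<theta> k = (\<lambda>x. a * \<phi> k x + b * \<psi> k x)" for k
  have "\<theta> k \<in> test_functions \<Omega>" for k unfolding \<theta>_def by (rule test_linear[OF \<phi>(1) \<psi>(1)])
  moreover have "(\<lambda>k. L2_norm \<Omega> (\<theta> k - (a *\<^sub>R u + b *\<^sub>R v))) \<longlonglongrightarrow> 0"
    by (rule lim0[OF \<phi>(2) \<psi>(2)])
      (use H10_L2[OF u] H10_L2[OF v] test_L2 \<phi> \<psi> in \<open>auto simp: \<theta>_def fun_eq_iff algebra_simps\<close>)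
  moreover have "(\<lambda>k. L2_norm \<Omega> (grad (\<theta> k) - (a *\<^sub>R weak_grad \<Omega> u + b *\<^sub>R weak_grad \<Omega> v))) \<longlonglongrightarrow> 0"
  proof (rule lim0[OF \<phi>(3) \<psi>(3)])
    fix k
    have "grad (\<theta> k) = a *\<^sub>R grad (\<phi> k) + b *\<^sub>R grad (\<psi> k)"
      using test_function_C1[OF \<phi>(1)] test_function_C1[OF \<psi>(1)]
      unfolding \<theta>_def by (simp add: fun_eq_iff grad_linear)
    then show "grad (\<theta> k) - (a *\<^sub>R weak_grad \<Omega> u + b *\<^sub>R weak_grad \<Omega> v)
        = a *\<^sub>R (grad (\<phi> k) - weak_grad \<Omega> u) + b *\<^sub>R (grad (\<psi> k) - weak_grad \<Omega> v)"
      by (simp add: algebra_simps)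
  qed (use H10_L2[OF u] H10_L2[OF v] test_L2 \<phi> \<psi> in auto)
  ultimately show ?thesis unfolding H10_iff[OF g] by blast
qed

lemma subspace_H10: "subspace (H10 \<Omega>)"
proof (rule subspaceI)
  have "(0 :: real ^ 'n \<Rightarrow> real) \<in> test_functions \<Omega>" by (rule subspace_0[OF subspace_test])
  then show "0 \<in> H10 \<Omega>" by (rule test_H10)
  show "u + v \<in> H10 \<Omega>" if "u \<in> H10 \<Omega>" "v \<in> H10 \<Omega>" for u v
    using H10_linear[OF that, of 1 1] by simp
  show "c *\<^sub>R u \<in> H10 \<Omega>" if "u \<in> H10 \<Omega>" for c u
    using H10_linear[OF that that, of c 0] by simp
qed

lemma weak_grad_linear_inner:
  assumes u: "u \<in> H10 \<Omega>" and v: "v \<in> H10 \<Omega>" and \<tau>: "\<tau> \<in> L2_space \<Omega>"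
  shows "L2_inner \<Omega> (weak_grad \<Omega> (a *\<^sub>R u + b *\<^sub>R v)) \<tau>
    = a * L2_inner \<Omega> (weak_grad \<Omega> u) \<tau> + b * L2_inner \<Omega> (weak_grad \<Omega> v) \<tau>"
  using L2_inner_weak_grad[OF has_weak_grad_linear[OF H10_weak_grad[OF u] H10_weak_grad[OF v]] \<tau>]
    H10_L2(2)[OF u] H10_L2(2)[OF v] \<tau>
  by (simp add: L2.add_left L2.scale_left)

lemma Poincare: "\<exists>C>0. \<forall>u\<in>H10 \<Omega>. L2_norm \<Omega> u \<le> C * L2_norm \<Omega> (weak_grad \<Omega> u)"
proof -
  obtain C where C: "C > 0" "\<And>\<phi>. \<phi> \<in> test_functions \<Omega> \<Longrightarrow> L2_norm \<Omega> \<phi> \<le> C * L2_norm \<Omega> (grad \<phi>)"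
    using Poincare_test by blast
  have "L2_norm \<Omega> u \<le> C * L2_norm \<Omega> (weak_grad \<Omega> u)" if u: "u \<in> H10 \<Omega>" for u
  proof -
    obtain \<phi> :: "nat \<Rightarrow> _" where \<phi>: "\<And>k. \<phi> k \<in> test_functions \<Omega>" "(\<lambda>k. L2_norm \<Omega> (\<phi> k - u)) \<longlonglongrightarrow> 0"
      "(\<lambda>k. L2_norm \<Omega> (grad (\<phi> k) - weak_grad \<Omega> u)) \<longlonglongrightarrow> 0" using H10_approx[OF u] by blast
    have "(\<lambda>k. L2_norm \<Omega> (\<phi> k)) \<longlonglongrightarrow> L2_norm \<Omega> u"
      by (intro L2.tendsto_nrm test_L2 \<phi> H10_L2 u)
    moreover have "(\<lambda>k. C * L2_norm \<Omega> (grad (\<phi> k))) \<longlonglongrightarrow> C * L2_norm \<Omega> (weak_grad \<Omega> u)"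
      by (intro tendsto_intros L2.tendsto_nrm test_L2 \<phi> H10_L2 u)
    ultimately show ?thesis using C(2)[OF \<phi>(1)] by (auto intro: LIMSEQ_le)
  qed
  with C(1) show ?thesis by blast
qed

definition Dirichlet :: "(real ^ 'n \<Rightarrow> real) \<Rightarrow> (real ^ 'n \<Rightarrow> real) \<Rightarrow> real" where
  "Dirichlet u v = L2_inner \<Omega> (weak_grad \<Omega> u) (weak_grad \<Omega> v)"

text \<open>By the Poincare inequality a sequence that is Cauchy for gradients is Cauchy in L2 as
  well, and closedness of the weak gradient ties the two limits together. Test functions picked ever
  closer to the \<open>f k\<close> share these limits, which keeps the limit in
  \<open>H10 \<Omega>\<close>.\<close>

lemma H10_complete:
  assumes f: "\<And>k. f k \<in> H10 \<Omega>"
    and cauchy: "\<And>e. e > 0 \<Longrightarrow> \<exists>N. \<forall>m\<ge>N. \<forall>n\<ge>N. L2_norm \<Omega> (weak_grad \<Omega> (f m - f n)) < e"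
  shows "\<exists>F\<in>H10 \<Omega>. (\<lambda>k. L2_norm \<Omega> (weak_grad \<Omega> (f k - F))) \<longlonglongrightarrow> 0"
proof -
  obtain C where C: "C > 0" "\<And>u. u \<in> H10 \<Omega> \<Longrightarrow> L2_norm \<Omega> u \<le> C * L2_norm \<Omega> (weak_grad \<Omega> u)"
    using Poincare by blast
  have diff: "f m - f n \<in> H10 \<Omega>" for m n using f subspace_H10 by (simp add: subspace_diff)
  have "\<exists>N. \<forall>m\<ge>N. \<forall>n\<ge>N. L2_norm \<Omega> (f m - f n) < e" if "e > 0" for e
  proof -
    have "e / C > 0" using that C(1) by simp
    from cauchy[OF this] obtain N where N: "\<forall>m\<ge>N. \<forall>n\<ge>N. L2_norm \<Omega> (weak_grad \<Omega> (f m - f n)) < e / C" ..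
    have "L2_norm \<Omega> (f m - f n) < e" if "m \<ge> N" "n \<ge> N" for m n
      using C(2)[OF diff[of m n]] N that C(1) by (auto simp: field_simps intro: le_less_trans)
    then show ?thesis by blast
  qed
  then obtain F where F: "F \<in> L2_space \<Omega>" "(\<lambda>k. L2_norm \<Omega> (f k - F)) \<longlonglongrightarrow> 0"
    using L2_complete[OF domain_lmeasurable, of f] H10_L2(1)[OF f] by blast
  have wg: "L2_norm \<Omega> (weak_grad \<Omega> (f m - f n)) = L2_norm \<Omega> (weak_grad \<Omega> (f m) - weak_grad \<Omega> (f n))" for m n
    by (rule L2_norm_weak_grad[OF has_weak_grad_diff[OF H10_weak_grad[OF f] H10_weak_grad[OF f]]])
  obtain G where G: "G \<in> L2_space \<Omega>" "(\<lambda>k. L2_norm \<Omega> (weak_grad \<Omega> (f k) - G)) \<longlonglongrightarrow> 0"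
    using L2_complete[OF domain_lmeasurable, of "\<lambda>k. weak_grad \<Omega> (f k)"] H10_L2(2)[OF f] cauchy
    unfolding wg by blast
  have FG: "has_weak_grad \<Omega> F G" by (rule has_weak_grad_limit[OF H10_weak_grad[OF f] F(1) G(1) F(2) G(2)])
  have "\<exists>\<phi>\<in>test_functions \<Omega>. L2_norm \<Omega> (\<phi> - f k) < inverse (real (Suc k)) \<and>
      L2_norm \<Omega> (grad \<phi> - weak_grad \<Omega> (f k)) < inverse (real (Suc k))" for k
  proof -
    obtain \<phi> :: "nat \<Rightarrow> _" where \<phi>: "\<And>j. \<phi> j \<in> test_functions \<Omega>" "(\<lambda>j. L2_norm \<Omega> (\<phi> j - f k)) \<longlonglongrightarrow> 0"
      "(\<lambda>j. L2_norm \<Omega> (grad (\<phi> j) - weak_grad \<Omega> (f k))) \<longlonglongrightarrow> 0" using H10_approx[OF f] by blast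
    have "\<forall>\<^sub>F j in sequentially. L2_norm \<Omega> (\<phi> j - f k) < inverse (real (Suc k)) \<and>
        L2_norm \<Omega> (grad (\<phi> j) - weak_grad \<Omega> (f k)) < inverse (real (Suc k))"
      by (intro eventually_conj order_tendstoD(2)[OF \<phi>(2)] order_tendstoD(2)[OF \<phi>(3)]) auto
    then show ?thesis using \<phi>(1) by (auto simp: eventually_sequentially)
  qed
  then obtain \<phi> where \<phi>: "\<And>k. \<phi> k \<in> test_functions \<Omega>"
    and close: "\<And>k. L2_norm \<Omega> (\<phi> k - f k) < inverse (real (Suc k))"
      "\<And>k. L2_norm \<Omega> (grad (\<phi> k) - weak_grad \<Omega> (f k)) < inverse (real (Suc k))" by metis
  have lim0: "(\<lambda>k. L2_norm \<Omega> (p k - r)) \<longlonglongrightarrow> 0"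
    if "\<And>k. p k \<in> L2_space \<Omega>" "\<And>k. q k \<in> L2_space \<Omega>" "r \<in> L2_space \<Omega>"
      "\<And>k. L2_norm \<Omega> (p k - q k) < inverse (real (Suc k))" "(\<lambda>k. L2_norm \<Omega> (q k - r)) \<longlonglongrightarrow> 0"
    for p q :: "nat \<Rightarrow> real ^ 'n \<Rightarrow> 'b :: euclidean_space" and r
  proof (rule Lim_null_comparison)
    have "norm (L2_norm \<Omega> (p k - r)) \<le> inverse (real (Suc k)) + L2_norm \<Omega> (q k - r)" for k
      using L2.nrm_triangle_diff[OF that(1)[of k] that(2)[of k] that(3)] that(4)[of k] that(1)[of k] that(3)
      by simp
    then show "\<forall>\<^sub>F k in sequentially. norm (L2_norm \<Omega> (p k - r)) \<le> inverse (real (Suc k)) + L2_norm \<Omega> (q k - r)"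
      by simp
    show "(\<lambda>k. inverse (real (Suc k)) + L2_norm \<Omega> (q k - r)) \<longlonglongrightarrow> 0"
      using tendsto_add[OF LIMSEQ_inverse_real_of_nat that(5)] by simp
  qed
  have "(\<lambda>k. L2_norm \<Omega> (\<phi> k - F)) \<longlonglongrightarrow> 0"
    by (rule lim0[OF test_L2(1)[OF \<phi>] H10_L2(1)[OF f] F(1) close(1) F(2)])
  moreover have "(\<lambda>k. L2_norm \<Omega> (grad (\<phi> k) - G)) \<longlonglongrightarrow> 0"
    by (rule lim0[OF test_L2(2)[OF \<phi>] H10_L2(2)[OF f] G(1) close(2) G(2)])
  ultimately have "F \<in> H10 \<Omega>" unfolding H10_iff[OF FG] using \<phi> by blast
  moreover have "(\<lambda>k. L2_norm \<Omega> (weak_grad \<Omega> (f k - F))) \<longlonglongrightarrow> 0"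
    using G(2) L2_norm_weak_grad[OF has_weak_grad_diff[OF H10_weak_grad[OF f] FG]] by simp
  ultimately show ?thesis by blast
qed

sublocale H10: semi_hilbert "H10 \<Omega>" Dirichlet
  rewrites "semi_inner.nrm Dirichlet = (\<lambda>u. L2_norm \<Omega> (weak_grad \<Omega> u))"
proof -
  interpret H10: semi_inner "H10 \<Omega>" Dirichlet
  proof
    show "subspace (H10 \<Omega>)" by (rule subspace_H10)
    show "Dirichlet (u + v) w = Dirichlet u w + Dirichlet v w"
      if "u \<in> H10 \<Omega>" "v \<in> H10 \<Omega>" "w \<in> H10 \<Omega>" for u v w
      using weak_grad_linear_inner[OF that(1,2) H10_L2(2)[OF that(3)], of 1 1] by (simp add: Dirichlet_def)
    show "Dirichlet (c *\<^sub>R u) w = c * Dirichlet u w" if "u \<in> H10 \<Omega>" "w \<in> H10 \<Omega>" for c u w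
      using weak_grad_linear_inner[OF that(1,1) H10_L2(2)[OF that(2)], of c 0] by (simp add: Dirichlet_def)
    show "Dirichlet u v = Dirichlet v u" if "u \<in> H10 \<Omega>" "v \<in> H10 \<Omega>" for u v
      using that by (simp add: Dirichlet_def L2.commute H10_L2)
    show "0 \<le> Dirichlet u u" if "u \<in> H10 \<Omega>" for u
      using that by (simp add: Dirichlet_def L2.nonneg H10_L2)
  qed
  have nrm: "sqrt (Dirichlet u u) = L2_norm \<Omega> (weak_grad \<Omega> u)" for u
    by (simp add: Dirichlet_def L2_norm_def)
  show *: "semi_hilbert (H10 \<Omega>) Dirichlet"
    by unfold_locales (use H10_complete in \<open>simp add: nrm\<close>)
  show "semi_inner.nrm Dirichlet = (\<lambda>u. L2_norm \<Omega> (weak_grad \<Omega> u))"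
    by (simp add: fun_eq_iff H10.nrm_def nrm)
qed

section \<open>The weak Poisson problem: existence, linearity, energy bounds, uniqueness\<close>

lemma poisson_solutionD:
  assumes "poisson_solution \<Omega> f u"
  shows "u \<in> H10 \<Omega>" "v \<in> H10 \<Omega> \<Longrightarrow> Dirichlet u v = L2_inner \<Omega> f v"
  using assms by (auto simp: poisson_solution_def Dirichlet_def)

text \<open>Riesz representation for the Dirichlet form; the Poincare inequality makes pairing with
  \<open>f\<close> a bounded functional.\<close>

lemma poisson_exists:
  assumes f: "f \<in> L2_space \<Omega>"
  shows "\<exists>u. poisson_solution \<Omega> f u"
proof -
  obtain C where C: "C > 0" "\<And>u. u \<in> H10 \<Omega> \<Longrightarrow> L2_norm \<Omega> u \<le> C * L2_norm \<Omega> (weak_grad \<Omega> u)"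
    using Poincare by blast
  have "\<exists>z. z \<in> H10 \<Omega> \<and> (\<forall>v\<in>H10 \<Omega>. Dirichlet z v = L2_inner \<Omega> f v)"
  proof (rule H10.Riesz_representation[OF subspace_H10 subset_refl])
    fix v assume v: "v \<in> H10 \<Omega>"
    have "\<bar>L2_inner \<Omega> f v\<bar> \<le> L2_norm \<Omega> f * L2_norm \<Omega> v"
      by (rule L2.Cauchy_Schwarz[OF f H10_L2(1)[OF v]])
    also have "\<dots> \<le> L2_norm \<Omega> f * (C * L2_norm \<Omega> (weak_grad \<Omega> v))"
      by (intro mult_left_mono C v L2.nrm_nonneg f)
    finally show "\<bar>L2_inner \<Omega> f v\<bar> \<le> (L2_norm \<Omega> f * C) * L2_norm \<Omega> (weak_grad \<Omega> v)" by simp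
  qed (use f in \<open>auto simp: L2.add_right L2.scale_right H10_L2\<close>)
  then show ?thesis by (auto simp: poisson_solution_def Dirichlet_def)
qed

lemma poisson_linear:
  assumes "poisson_solution \<Omega> f u" "poisson_solution \<Omega> g v" "f \<in> L2_space \<Omega>" "g \<in> L2_space \<Omega>"
  shows "poisson_solution \<Omega> (a *\<^sub>R f + b *\<^sub>R g) (a *\<^sub>R u + b *\<^sub>R v)"
  unfolding poisson_solution_def
proof (intro conjI ballI)
  note u = poisson_solutionD[OF assms(1)] and v = poisson_solutionD[OF assms(2)]
  show "a *\<^sub>R u + b *\<^sub>R v \<in> H10 \<Omega>" by (rule H10_linear[OF u(1) v(1)])
  show "L2_inner \<Omega> (weak_grad \<Omega> (a *\<^sub>R u + b *\<^sub>R v)) (weak_grad \<Omega> w) = L2_inner \<Omega> (a *\<^sub>R f + b *\<^sub>R g) w"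
    if w: "w \<in> H10 \<Omega>" for w
    using weak_grad_linear_inner[OF u(1) v(1) H10_L2(2)[OF w], of a b] u(2)[OF w] v(2)[OF w] assms(3,4) H10_L2(1)[OF w]
    by (simp add: Dirichlet_def L2.add_left L2.scale_left)
qed

text \<open>Needed for \<open>weak_div\<close>: the chosen divergence of the dual flux agrees with
  the known solution only almost everywhere.\<close>

lemma poisson_cong_AE:
  assumes "poisson_solution \<Omega> f u" "v \<in> L2_space \<Omega>" "AE x in M. u x = v x"
  shows "poisson_solution \<Omega> f v"
proof -
  note u = poisson_solutionD[OF assms(1)]
  have v: "v \<in> H10 \<Omega>" by (rule H10_cong_AE[OF u(1) assms(2,3)])
  have "L2_inner \<Omega> (weak_grad \<Omega> v) (weak_grad \<Omega> w) = L2_inner \<Omega> (weak_grad \<Omega> u) (weak_grad \<Omega> w)"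
    if "w \<in> H10 \<Omega>" for w
    by (rule L2_inner_weak_grad[OF has_weak_grad_cong_AE[OF H10_weak_grad[OF u(1)] assms(2,3)] H10_L2(2)[OF that]])
  then show ?thesis using u v by (simp add: poisson_solution_def Dirichlet_def)
qed

lemma poisson_bound:
  "\<exists>C>0. \<forall>f u. f \<in> L2_space \<Omega> \<longrightarrow> poisson_solution \<Omega> f u \<longrightarrow>
    L2_norm \<Omega> u \<le> C * L2_norm \<Omega> f \<and> L2_norm \<Omega> (weak_grad \<Omega> u) \<le> C * L2_norm \<Omega> f"
proof -
  obtain C where C: "C > 0" "\<And>u. u \<in> H10 \<Omega> \<Longrightarrow> L2_norm \<Omega> u \<le> C * L2_norm \<Omega> (weak_grad \<Omega> u)"
    using Poincare by blast
  have bound: "L2_norm \<Omega> (weak_grad \<Omega> u) \<le> C * L2_norm \<Omega> f" if f: "f \<in> L2_space \<Omega>" and "poisson_solution \<Omega> f u" for f u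
  proof -
    note u = poisson_solutionD[OF that(2)]
    have "(L2_norm \<Omega> (weak_grad \<Omega> u))\<^sup>2 = L2_inner \<Omega> f u"
      using u H10.nrm_sq[OF u(1)] by simp
    also have "\<dots> \<le> L2_norm \<Omega> f * L2_norm \<Omega> u"
      using L2.Cauchy_Schwarz[OF f H10_L2(1)[OF u(1)]] by simp
    also have "\<dots> \<le> L2_norm \<Omega> f * (C * L2_norm \<Omega> (weak_grad \<Omega> u))"
      by (intro mult_left_mono C u L2.nrm_nonneg f)
    finally have "L2_norm \<Omega> (weak_grad \<Omega> u) * L2_norm \<Omega> (weak_grad \<Omega> u)
        \<le> (C * L2_norm \<Omega> f) * L2_norm \<Omega> (weak_grad \<Omega> u)" by (simp add: power2_eq_square mult_ac)
    then show ?thesis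
      using L2.nrm_nonneg[OF H10_L2(2)[OF u(1)]] C(1) L2.nrm_nonneg[OF f]
      by (cases "L2_norm \<Omega> (weak_grad \<Omega> u) = 0") (auto simp: mult_le_cancel_right)
  qed
  show ?thesis
  \<comment> \<open>\<open>C\<close> serves for the gradient and \<open>C * C\<close> for the
    function itself; the sum covers both.\<close>
  proof (intro exI[of _ "C + C * C"] conjI allI impI)
    show "C + C * C > 0" using C(1) by (simp add: add_pos_pos)
    fix f u assume f: "f \<in> L2_space \<Omega>" and u: "poisson_solution \<Omega> f u"
    have "L2_norm \<Omega> u \<le> C * (C * L2_norm \<Omega> f)"
      by (rule order_trans[OF C(2)[OF poisson_solutionD(1)[OF u]]]) (use bound[OF f u] C(1) in simp)
    moreover have "0 \<le> C * L2_norm \<Omega> f" "0 \<le> C * (C * L2_norm \<Omega> f)"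
      using C(1) L2.nrm_nonneg[OF f] by simp_all
    ultimately show "L2_norm \<Omega> u \<le> (C + C * C) * L2_norm \<Omega> f"
        "L2_norm \<Omega> (weak_grad \<Omega> u) \<le> (C + C * C) * L2_norm \<Omega> f"
      using bound[OF f u] by (simp_all add: algebra_simps)
  qed
qed

lemma poisson_unique:
  assumes "poisson_solution \<Omega> f u" "poisson_solution \<Omega> f v" "f \<in> L2_space \<Omega>"
  shows "AE x in M. u x = v x"
proof -
  obtain C where C: "C > 0" "\<And>f u. f \<in> L2_space \<Omega> \<Longrightarrow> poisson_solution \<Omega> f u \<Longrightarrow>
    L2_norm \<Omega> u \<le> C * L2_norm \<Omega> f \<and> L2_norm \<Omega> (weak_grad \<Omega> u) \<le> C * L2_norm \<Omega> f"
    using poisson_bound by blast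
  have "poisson_solution \<Omega> (f - f) (u - v)"
    using poisson_linear[OF assms(1,2,3,3), of 1 "-1"] by simp
  with C(2)[of "f - f" "u - v"] assms(3) have "L2_norm \<Omega> (u - v) \<le> 0" by (metis L2.mem(2) L2.nrm_zero cancel_comm_monoid_add_class.diff_cancel mult_zero_right)
  moreover have uv: "u - v \<in> L2_space \<Omega>"
    using H10_L2(1)[OF poisson_solutionD(1)[OF assms(1)]] H10_L2(1)[OF poisson_solutionD(1)[OF assms(2)]] by simp
  ultimately have "L2_norm \<Omega> (u - v) = 0" using L2.nrm_nonneg[OF uv] by simp
  from L2_norm_eq_0_AE[OF uv this] show ?thesis by simp
qed

section \<open>Weak divergence and Green's formula\<close>

lemma has_weak_divD:
  assumes "has_weak_div \<Omega> \<tau> w"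
  shows "\<tau> \<in> L2_space \<Omega>" "w \<in> L2_space \<Omega>"
    "\<phi> \<in> test_functions \<Omega> \<Longrightarrow> L2_inner \<Omega> \<tau> (grad \<phi>) = - L2_inner \<Omega> w \<phi>"
  using assms by (auto simp: has_weak_div_def)

lemma has_weak_div_unique:
  assumes "has_weak_div \<Omega> \<tau> w" "has_weak_div \<Omega> \<tau> w'"
  shows "AE x in M. w x = w' x"
proof -
  note w = has_weak_divD[OF assms(1)] and w' = has_weak_divD[OF assms(2)]
  have "AE x in M. (w - w') x = 0"
  proof (rule L2_orthogonal_test_AE_zero)
    show "w - w' \<in> L2_space \<Omega>" using w w' by simp
    show "L2_inner \<Omega> (w - w') \<phi> = 0" if "\<phi> \<in> test_functions \<Omega>" for \<phi>
      using L2.diff_left[OF w(2) w'(2) test_L2(1)[OF that]] w(3)[OF that] w'(3)[OF that] by simp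
  qed
  then show ?thesis by simp
qed

lemma has_weak_div_diff:
  assumes "has_weak_div \<Omega> \<tau> w" "has_weak_div \<Omega> \<tau>' w'"
  shows "has_weak_div \<Omega> (\<tau> - \<tau>') (w - w')"
  using has_weak_divD[OF assms(1)] has_weak_divD[OF assms(2)] test_L2
  by (auto simp: has_weak_div_def L2.diff_left)

lemma Hdiv_weak_div: "\<tau> \<in> Hdiv \<Omega> \<Longrightarrow> has_weak_div \<Omega> \<tau> (weak_div \<Omega> \<tau>)"
  unfolding Hdiv_def weak_div_def by (auto intro: someI[where P = "has_weak_div \<Omega> \<tau>"])

lemma Hdiv_L2: "\<tau> \<in> Hdiv \<Omega> \<Longrightarrow> \<tau> \<in> L2_space \<Omega>" "\<tau> \<in> Hdiv \<Omega> \<Longrightarrow> weak_div \<Omega> \<tau> \<in> L2_space \<Omega>"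
  using has_weak_divD[OF Hdiv_weak_div] by auto

lemma Hdiv_diff: "\<tau> \<in> Hdiv \<Omega> \<Longrightarrow> \<tau>' \<in> Hdiv \<Omega> \<Longrightarrow> \<tau> - \<tau>' \<in> Hdiv \<Omega>"
  using has_weak_div_diff unfolding Hdiv_def by blast

lemma L2_inner_weak_div:
  assumes "has_weak_div \<Omega> \<tau> w" "v \<in> L2_space \<Omega>"
  shows "L2_inner \<Omega> (weak_div \<Omega> \<tau>) v = L2_inner \<Omega> w v"
proof -
  have d: "has_weak_div \<Omega> \<tau> (weak_div \<Omega> \<tau>)" using assms(1) by (intro Hdiv_weak_div) (auto simp: Hdiv_def)
  show ?thesis
    using has_weak_div_unique[OF d assms(1)] L2_spaceD(1)[OF has_weak_divD(2)[OF d]]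
      L2_spaceD(1)[OF has_weak_divD(2)[OF assms(1)]] L2_spaceD(1)[OF assms(2)]
    by (intro L2_inner_cong_AE) auto
qed

text \<open>The defining identity of the weak divergence extends by continuity from test functions
  to their closure; this is why no boundary term appears.\<close>

lemma Green:
  assumes v: "v \<in> H10 \<Omega>" and \<tau>: "has_weak_div \<Omega> \<tau> w"
  shows "L2_inner \<Omega> \<tau> (weak_grad \<Omega> v) = - L2_inner \<Omega> w v"
proof -
  note t = has_weak_divD[OF \<tau>] and v2 = H10_L2[OF v]
  obtain \<phi> :: "nat \<Rightarrow> _" where \<phi>: "\<And>k. \<phi> k \<in> test_functions \<Omega>" "(\<lambda>k. L2_norm \<Omega> (\<phi> k - v)) \<longlonglongrightarrow> 0"
    "(\<lambda>k. L2_norm \<Omega> (grad (\<phi> k) - weak_grad \<Omega> v)) \<longlonglongrightarrow> 0" using H10_approx[OF v] by blast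
  have "(\<lambda>k. L2_inner \<Omega> (grad (\<phi> k)) \<tau>) \<longlonglongrightarrow> L2_inner \<Omega> (weak_grad \<Omega> v) \<tau>"
    by (intro L2.tendsto_ip test_L2 \<phi> v2 t)
  moreover have "(\<lambda>k. - L2_inner \<Omega> (\<phi> k) w) \<longlonglongrightarrow> - L2_inner \<Omega> v w"
    by (intro tendsto_intros L2.tendsto_ip test_L2 \<phi> v2 t)
  moreover have "L2_inner \<Omega> (grad (\<phi> k)) \<tau> = - L2_inner \<Omega> (\<phi> k) w" for k
    using t(3)[OF \<phi>(1)] L2.commute[OF t(1) test_L2(2)[OF \<phi>(1)]] L2.commute[OF t(2) test_L2(1)[OF \<phi>(1)]]
    by simp
  ultimately have "L2_inner \<Omega> (weak_grad \<Omega> v) \<tau> = - L2_inner \<Omega> v w" by (auto intro: LIMSEQ_unique)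
  then show ?thesis using L2.commute[OF t(1) v2(2)] L2.commute[OF t(2) v2(1)] by simp
qed

end

lemma nrm_L2: "semi_inner.nrm (L2_inner \<Omega> :: (real ^ 'n \<Rightarrow> 'b :: euclidean_space) \<Rightarrow> _) = L2_norm \<Omega>"
  by (simp add: fun_eq_iff semi_inner.nrm_def[OF L2.semi_inner_axioms] L2_norm_def)

context bounded_open
begin

section \<open>The fractional seminorm\<close>

lemma slobodeckij_kernel_measurable:
  assumes u: "u \<in> borel_measurable M"
  shows "(\<lambda>(x, y). ennreal ((u x - u y)\<^sup>2 / norm (x - y) powr c)) \<in> borel_measurable (M \<Otimes>\<^sub>M M)"
proof -
  have [measurable]: "(\<lambda>x. x) \<in> borel_measurable M" by simp
  note u [measurable]
  show ?thesis by measurable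
qed

lemma slobodeckij_section_measurable:
  assumes u: "u \<in> borel_measurable M"
  shows "(\<lambda>y. ennreal ((u x - u y)\<^sup>2 / norm (x - y) powr c)) \<in> borel_measurable M"
    "(\<lambda>x. \<integral>\<^sup>+ y. ennreal ((u x - u y)\<^sup>2 / norm (x - y) powr c) \<partial>M) \<in> borel_measurable M"
proof -
  have [measurable]: "(\<lambda>x. x) \<in> borel_measurable M" by simp
  note u [measurable]
  show "(\<lambda>y. ennreal ((u x - u y)\<^sup>2 / norm (x - y) powr c)) \<in> borel_measurable M" by measurable
  show "(\<lambda>x. \<integral>\<^sup>+ y. ennreal ((u x - u y)\<^sup>2 / norm (x - y) powr c) \<partial>M) \<in> borel_measurable M"
    using borel_measurable_nn_integral[OF slobodeckij_kernel_measurable[OF u]] by simp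
qed

lemma slobodeckij_scale:
  assumes u: "u \<in> borel_measurable M"
  shows "slobodeckij \<Omega> \<theta> (a *\<^sub>R u) = ennreal (a\<^sup>2) * slobodeckij \<Omega> \<theta> u"
proof -
  let ?c = "real CARD('n) + 2 * \<theta>"
  have eq: "ennreal (((a *\<^sub>R u) x - (a *\<^sub>R u) y)\<^sup>2 / norm (x - y) powr ?c)
      = ennreal (a\<^sup>2) * ennreal ((u x - u y)\<^sup>2 / norm (x - y) powr ?c)" for x y
    by (simp add: power_mult_distrib flip: ennreal_mult right_diff_distrib)
  show ?thesis
    unfolding slobodeckij_def eq
    by (simp add: nn_integral_cmult slobodeckij_section_measurable[OF u])
qed

text \<open>Pointwise (a - b)^2 \<le> 2 (a^2 + b^2). The crude factor 2 is all that
  \<open>lower_semicontinuous_quadratic_bounded\<close> asks for, which spares a proof of the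
  triangle inequality.\<close>

lemma slobodeckij_diff:
  assumes u: "u \<in> borel_measurable M" and v: "v \<in> borel_measurable M"
  shows "slobodeckij \<Omega> \<theta> (u - v) \<le> 2 * (slobodeckij \<Omega> \<theta> u + slobodeckij \<Omega> \<theta> v)"
proof -
  let ?c = "real CARD('n) + 2 * \<theta>"
  let ?k = "\<lambda>u x y. ennreal ((u x - u y)\<^sup>2 / norm (x - y) powr ?c)"
  have double: "ennreal (2 * (a + b)) = 2 * (ennreal a + ennreal b)" if "0 \<le> a" "0 \<le> b" for a b
    by (subst ennreal_mult, use that in simp, use that in simp, subst ennreal_plus) (use that in auto)
  have le: "?k (u - v) x y \<le> 2 * (?k u x y + ?k v x y)" for x y
  proof -
    have "((u x - v x) - (u y - v y))\<^sup>2 \<le> 2 * ((u x - u y)\<^sup>2 + (v x - v y)\<^sup>2)"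
      using sum_squares_bound[of "u x - u y" "- (v x - v y)"] by (simp add: power2_eq_square algebra_simps)
    then have "((u x - v x) - (u y - v y))\<^sup>2 / norm (x - y) powr ?c
        \<le> (2 * ((u x - u y)\<^sup>2 + (v x - v y)\<^sup>2)) / norm (x - y) powr ?c"
      by (rule divide_right_mono) simp
    also have "\<dots> = 2 * ((u x - u y)\<^sup>2 / norm (x - y) powr ?c + (v x - v y)\<^sup>2 / norm (x - y) powr ?c)"
      by (simp add: add_divide_distrib)
    finally have "((u - v) x - (u - v) y)\<^sup>2 / norm (x - y) powr ?c
        \<le> 2 * ((u x - u y)\<^sup>2 / norm (x - y) powr ?c + (v x - v y)\<^sup>2 / norm (x - y) powr ?c)"
      by simp
    then have "?k (u - v) x y \<le> ennreal (2 * ((u x - u y)\<^sup>2 / norm (x - y) powr ?c + (v x - v y)\<^sup>2 / norm (x - y) powr ?c))"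
      by (rule ennreal_leI)
    also have "\<dots> = 2 * (?k u x y + ?k v x y)" by (rule double) simp_all
    finally show ?thesis .
  qed
  have "slobodeckij \<Omega> \<theta> (u - v) \<le> (\<integral>\<^sup>+x. (\<integral>\<^sup>+y. 2 * (?k u x y + ?k v x y) \<partial>M) \<partial>M)"
    unfolding slobodeckij_def by (intro nn_integral_mono le)
  also have "\<dots> = 2 * (slobodeckij \<Omega> \<theta> u + slobodeckij \<Omega> \<theta> v)"
    unfolding slobodeckij_def
    by (simp add: nn_integral_cmult nn_integral_add borel_measurable_add slobodeckij_section_measurable[OF u]
        slobodeckij_section_measurable[OF v] del: distrib_left_numeral)
  finally show ?thesis .
qed

lemma slobodeckij_cong_AE:
  assumes "AE x in M. u x = v x"
  shows "slobodeckij \<Omega> \<theta> u = slobodeckij \<Omega> \<theta> v"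
  unfolding slobodeckij_def
proof (rule nn_integral_cong_AE, use assms in eventually_elim)
  case (elim x)
  then show ?case by (intro nn_integral_cong_AE, use assms in eventually_elim) simp
qed

text \<open>Fatou's lemma is applied twice: in \<open>y\<close> for almost every fixed
  \<open>x\<close>, then in \<open>x\<close>.\<close>

lemma slobodeckij_Fatou:
  assumes w: "\<And>k. w k \<in> borel_measurable M" "u \<in> borel_measurable M"
    and lim: "AE x in M. (\<lambda>k. w k x) \<longlonglongrightarrow> u x"
    and bound: "\<And>k :: nat. slobodeckij \<Omega> \<theta> (w k) \<le> c"
  shows "slobodeckij \<Omega> \<theta> u \<le> c"
proof -
  let ?c = "real CARD('n) + 2 * \<theta>"
  let ?k = "\<lambda>u x y. ennreal ((u x - u y)\<^sup>2 / norm (x - y) powr ?c)"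
  have inner: "(\<integral>\<^sup>+y. ?k u x y \<partial>M) \<le> liminf (\<lambda>k. \<integral>\<^sup>+y. ?k (w k) x y \<partial>M)"
    if x: "(\<lambda>k. w k x) \<longlonglongrightarrow> u x" for x
  proof -
    have "(\<integral>\<^sup>+y. ?k u x y \<partial>M) = (\<integral>\<^sup>+y. liminf (\<lambda>k. ?k (w k) x y) \<partial>M)"
    proof (rule nn_integral_cong_AE, use lim in eventually_elim)
      case (elim y)
      have "(\<lambda>k. ?k (w k) x y) \<longlonglongrightarrow> ?k u x y"
        \<comment> \<open>As a product with a fixed weight the kernel converges on the diagonal too,
          where the denominator is 0.\<close>
        unfolding divide_inverse by (intro tendsto_intros x elim)
      then show ?case by (rule lim_imp_Liminf[OF trivial_limit_sequentially, symmetric])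
    qed
    also have "\<dots> \<le> liminf (\<lambda>k. \<integral>\<^sup>+y. ?k (w k) x y \<partial>M)"
      by (rule nn_integral_liminf) (rule slobodeckij_section_measurable[OF w(1)])
    finally show ?thesis .
  qed
  have "slobodeckij \<Omega> \<theta> u \<le> (\<integral>\<^sup>+x. liminf (\<lambda>k. \<integral>\<^sup>+y. ?k (w k) x y \<partial>M) \<partial>M)"
    unfolding slobodeckij_def by (rule nn_integral_mono_AE, use lim in eventually_elim) (rule inner)
  also have "\<dots> \<le> liminf (\<lambda>k. slobodeckij \<Omega> \<theta> (w k))"
    unfolding slobodeckij_def
    by (rule nn_integral_liminf) (rule slobodeckij_section_measurable[OF w(1)])
  also have "\<dots> \<le> liminf (\<lambda>k::nat. c)" by (intro Liminf_mono always_eventually allI bound)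
  finally show ?thesis by (simp add: Liminf_const)
qed

text \<open>Only the functions converge, the gradients are merely bounded. Tested with a smooth
  field \<open>\<Phi>\<close>, the gradient moves onto \<open>\<Phi>\<close>, so (G, \<Phi>) is the
  limit of (g k, \<Phi>) and is at most \<open>c\<close> times the norm of \<open>\<Phi>\<close>.
  Such fields have a null orthogonal complement, so \<open>nrm_le_of_dense\<close>
  concludes.\<close>

lemma weak_grad_lower_semicontinuous:
  assumes f: "\<And>k. has_weak_grad \<Omega> (f k) (g k)" and F: "has_weak_grad \<Omega> F G"
    and lim: "(\<lambda>k. L2_norm \<Omega> (f k - F)) \<longlonglongrightarrow> 0" and bound: "\<And>k. L2_norm \<Omega> (g k) \<le> c"
  shows "L2_norm \<Omega> G \<le> c"
proof -
  interpret V: semi_hilbert "L2_space \<Omega> :: (real ^ 'n \<Rightarrow> real ^ 'n) set" "L2_inner \<Omega>"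
    rewrites "semi_inner.nrm (L2_inner \<Omega> :: (real ^ 'n \<Rightarrow> real ^ 'n) \<Rightarrow> _) = L2_norm \<Omega>"
    by (rule semi_hilbert_L2[OF domain_lmeasurable]) (rule nrm_L2)
  define T :: "(real ^ 'n \<Rightarrow> real ^ 'n) set" where "T = {\<Phi>. \<forall>i. (\<lambda>x. \<Phi> x $ i) \<in> test_functions \<Omega>}"
  note f' = has_weak_gradD[OF f] and F' = has_weak_gradD[OF F]
  have c: "0 \<le> c" using bound[of 0] L2.nrm_nonneg[OF f'(2)[of 0]] by linarith
  have comp: "(\<lambda>x. \<Phi> x $ i) \<in> test_functions \<Omega>" if "\<Phi> \<in> T" for \<Phi> i using that by (simp add: T_def)
  have T_L2: "\<Phi> \<in> L2_space \<Omega>" if "\<Phi> \<in> T" for \<Phi>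
  proof -
    have "(\<lambda>x. \<Phi> x $ i) \<in> L2_space \<Omega>" for i by (rule test_L2(1)[OF comp[OF that]])
    note c = L2_spaceD[OF this]
    have "\<Phi> \<in> borel_measurable M"
      by (subst borel_measurable_euclidean_space)
        (use c(1) in \<open>auto simp: Basis_vec_def cart_eq_inner_axis\<close>)
    moreover have "integrable M (\<lambda>x. \<Sum>i\<in>UNIV. (norm (\<Phi> x $ i))\<^sup>2)" using c(2) by (intro Bochner_Integration.integrable_sum) auto
    moreover have "(\<lambda>x. \<Sum>i\<in>UNIV. (norm (\<Phi> x $ i))\<^sup>2) = (\<lambda>x. (norm (\<Phi> x))\<^sup>2)"
      by (simp add: norm_vec_def L2_set_def sum_nonneg)
    ultimately show ?thesis by (simp add: L2_space_def)
  qed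
  have sub: "subspace T"
  proof (rule subspaceI)
    show "0 \<in> T" by (simp add: T_def)
    show "\<Phi> + \<Psi> \<in> T" if "\<Phi> \<in> T" "\<Psi> \<in> T" for \<Phi> \<Psi>
      using test_linear[OF comp[OF that(1)] comp[OF that(2)], where a = 1 and b = 1] by (simp add: T_def)
    show "a *\<^sub>R \<Phi> \<in> T" if "\<Phi> \<in> T" for a \<Phi>
      using test_linear[OF comp[OF that] comp[OF that], where a = a and b = 0] by (simp add: T_def)
  qed
  have "L2_norm \<Omega> G \<le> \<bar>c\<bar>"
  proof (rule V.nrm_le_of_dense[OF sub])
    show "T \<subseteq> L2_space \<Omega>" using T_L2 by blast
    show "G \<in> L2_space \<Omega>" by (rule F')
  next
    fix z assume z: "z \<in> L2_space \<Omega>" and orth: "\<And>\<Phi>. \<Phi> \<in> T \<Longrightarrow> L2_inner \<Omega> z \<Phi> = 0"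
    have "AE x in M. z x $ i = 0" for i
    proof (rule L2_orthogonal_test_AE_zero[OF L2_norm_component_sum(2)[OF z]])
      fix \<phi> assume \<phi>: "\<phi> \<in> test_functions \<Omega>"
      have "(\<lambda>x. \<phi> x *\<^sub>R axis i 1) \<in> T"
      proof -
        have "(\<lambda>x. \<phi> x * (axis i 1 :: real ^ 'n) $ j) \<in> test_functions \<Omega>" for j
          using test_linear[OF \<phi> \<phi>, of "axis i 1 $ j" 0] by (simp add: mult.commute)
        then show ?thesis by (simp add: T_def)
      qed
      from orth[OF this] show "L2_inner \<Omega> (\<lambda>x. z x $ i) \<phi> = 0"
        by (simp add: L2_inner_def inner_axis mult.commute)
    qed
    then have "AE x in M. \<forall>i. z x $ i = 0" by (simp add: AE_all_countable)
    then have "AE x in M. z x = 0" by eventually_elim (simp add: vec_eq_iff)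
    then have "L2_norm \<Omega> z = L2_norm \<Omega> (\<lambda>_. 0 :: real ^ 'n)"
      using L2_spaceD(1)[OF z] by (intro L2_norm_cong_AE) auto
    then show "L2_norm \<Omega> z = 0" by (simp add: L2_norm_def L2_inner_def)
  next
    fix \<Phi> assume \<Phi>: "\<Phi> \<in> T"
    \<comment> \<open>The sum on the right is the pairing of \<open>u\<close> with the divergence of
      \<open>\<Phi>\<close>.\<close>
    have ibp: "L2_inner \<Omega> v \<Phi> = - (\<Sum>i\<in>UNIV. L2_inner \<Omega> u (\<lambda>x. grad (\<lambda>x. \<Phi> x $ i) x $ i))"
      if "has_weak_grad \<Omega> u v" for u v
      using L2_inner_component_sum[OF has_weak_gradD(2)[OF that] T_L2[OF \<Phi>]]
        has_weak_gradD(3)[OF that comp[OF \<Phi>]] by (simp add: sum_negf)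
    have "(\<lambda>k. - (\<Sum>i\<in>UNIV. L2_inner \<Omega> (f k) (\<lambda>x. grad (\<lambda>x. \<Phi> x $ i) x $ i)))
        \<longlonglongrightarrow> - (\<Sum>i\<in>UNIV. L2_inner \<Omega> F (\<lambda>x. grad (\<lambda>x. \<Phi> x $ i) x $ i))"
      by (intro tendsto_intros L2.tendsto_ip f' F' lim L2_norm_component_sum test_L2 comp[OF \<Phi>])
    then have "(\<lambda>k. L2_inner \<Omega> (g k) \<Phi>) \<longlonglongrightarrow> L2_inner \<Omega> G \<Phi>" by (simp add: ibp[OF f] ibp[OF F])
    then have "(\<lambda>k. \<bar>L2_inner \<Omega> (g k) \<Phi>\<bar>) \<longlonglongrightarrow> \<bar>L2_inner \<Omega> G \<Phi>\<bar>" by (rule tendsto_rabs)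
    moreover have "\<bar>L2_inner \<Omega> (g k) \<Phi>\<bar> \<le> c * L2_norm \<Omega> \<Phi>" for k
      using L2.Cauchy_Schwarz[OF f'(2)[of k] T_L2[OF \<Phi>]] mult_right_mono[OF bound[of k] L2.nrm_nonneg[OF T_L2[OF \<Phi>]]]
      by linarith
    ultimately show "\<bar>L2_inner \<Omega> G \<Phi>\<bar> \<le> c * L2_norm \<Omega> \<Phi>"
      by (intro LIMSEQ_le_const2) auto
  qed
  with c show ?thesis by simp
qed

section \<open>The regularity estimate\<close>

text \<open>The square of the norm of order \<open>s\<close> without its L2 part. It gives the
  fractional case and the case \<open>s = 1\<close> one interface; the L2 part is already controlled
  by \<open>poisson_bound\<close>.\<close>

definition sobolev_top :: "real \<Rightarrow> (real ^ 'n \<Rightarrow> real) \<Rightarrow> real" where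
  "sobolev_top s w = (if s < 1 then enn2real (slobodeckij \<Omega> s w) else (L2_norm \<Omega> (weak_grad \<Omega> w))\<^sup>2)"

lemma sobolev_le_1_iff:
  assumes "0 < s" "s \<le> 1"
  shows "w \<in> sobolev \<Omega> s \<longleftrightarrow>
    w \<in> L2_space \<Omega> \<and> (if s < 1 then slobodeckij \<Omega> s w < \<infinity> else \<exists>g. has_weak_grad \<Omega> w g)"
proof (cases "s < 1")
  case True
  then have "\<lfloor>s\<rfloor> = 0" "frac s = s" using assms by (auto simp: floor_eq_iff frac_eq)
  then show ?thesis using True assms by (simp add: sobolev_def)
next
  case False
  then have "s = 1" using assms by simp
  then show ?thesis using sobolev_1_iff[of w] has_weak_gradD(1) by auto
qed

lemma sobolev_norm_le_1:
  assumes "0 < s" "s \<le> 1" "w \<in> sobolev \<Omega> s"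
  shows "(sobolev_norm \<Omega> s w)\<^sup>2 = (L2_norm \<Omega> w)\<^sup>2 + sobolev_top s w"
proof (cases "s < 1")
  case True
  then have "\<lfloor>s\<rfloor> = 0" "frac s = s" using assms by (auto simp: floor_eq_iff frac_eq)
  then show ?thesis using True assms(1) by (simp add: sobolev_norm_def sobolev_top_def)
next
  case False
  then have s: "s = 1" using assms by simp
  then obtain g where "has_weak_grad \<Omega> w g" using assms(3) sobolev_1_iff by auto
  from sobolev_norm_1[OF has_weak_grad_weak_grad[OF this]] s show ?thesis
    by (simp add: sobolev_top_def)
qed

text \<open>Raising the order by 1 adds one level to the recursion and keeps the fractional part;
  this includes \<open>s = 1\<close>, where order 2 has fractional part 0.\<close>

lemma sobolev_add_1:
  assumes "0 < s" "u \<in> sobolev \<Omega> (1 + s)"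
  shows "\<exists>g. has_weak_grad \<Omega> u g" "(\<lambda>x. weak_grad \<Omega> u x $ i) \<in> sobolev \<Omega> s"
    "0 \<le> sobolev_norm \<Omega> (1 + s) u"
    "(sobolev_norm \<Omega> (1 + s) u)\<^sup>2
      = (L2_norm \<Omega> u)\<^sup>2 + (\<Sum>i\<in>UNIV. (sobolev_norm \<Omega> s (\<lambda>x. weak_grad \<Omega> u x $ i))\<^sup>2)"
proof -
  have eq: "nat \<lfloor>1 + s\<rfloor> = Suc (nat \<lfloor>s\<rfloor>)" "frac (1 + s) = frac s"
    using assms(1) by (auto simp: frac_def Suc_nat_eq_nat_zadd1)
  have nn: "0 \<le> sobolev_normsq \<Omega> m \<theta> w" for m \<theta> w
    by (induction m arbitrary: w) (auto intro!: add_nonneg_nonneg sum_nonneg)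
  show "\<exists>g. has_weak_grad \<Omega> u g" "(\<lambda>x. weak_grad \<Omega> u x $ i) \<in> sobolev \<Omega> s"
    using assms(2)[unfolded sobolev_def mem_Collect_eq eq sobolev_mem.simps] by (auto simp: sobolev_def)
  show "0 \<le> sobolev_norm \<Omega> (1 + s) u" by (simp add: sobolev_norm_def nn)
  show "(sobolev_norm \<Omega> (1 + s) u)\<^sup>2
      = (L2_norm \<Omega> u)\<^sup>2 + (\<Sum>i\<in>UNIV. (sobolev_norm \<Omega> s (\<lambda>x. weak_grad \<Omega> u x $ i))\<^sup>2)"
    unfolding sobolev_norm_def eq using nn by (simp add: add_nonneg_nonneg sum_nonneg)
qed

lemma sobolev_top_nonneg: "0 \<le> sobolev_top s w"
  by (simp add: sobolev_top_def)

lemma sobolev_le_1_cong_AE: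
  assumes s: "0 < s" "s \<le> 1" and v: "v \<in> sobolev \<Omega> s" and w: "w \<in> L2_space \<Omega>"
    and eq: "AE x in M. v x = w x"
  shows "w \<in> sobolev \<Omega> s"
  using v w slobodeckij_cong_AE[OF eq] has_weak_grad_cong_AE[OF _ w eq]
  by (auto simp: sobolev_le_1_iff[OF s] split: if_splits)

lemma sobolev_top_cong_AE:
  assumes "0 < s" "s \<le> 1" "v \<in> sobolev \<Omega> s" "w \<in> sobolev \<Omega> s" "AE x in M. v x = w x"
  shows "sobolev_top s v = sobolev_top s w"
proof (cases "s < 1")
  case True
  then show ?thesis using slobodeckij_cong_AE[OF assms(5)] by (simp add: sobolev_top_def)
next
  case False
  then obtain g where g: "has_weak_grad \<Omega> v g" using assms by (auto simp: sobolev_le_1_iff)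
  have "has_weak_grad \<Omega> w g" using assms g by (intro has_weak_grad_cong_AE[OF g]) (auto simp: sobolev_le_1_iff)
  with g False show ?thesis by (simp add: sobolev_top_def L2_norm_weak_grad)
qed

lemma sobolev_top_diff:
  assumes "0 < s" "s \<le> 1" "v \<in> sobolev \<Omega> s" "w \<in> sobolev \<Omega> s"
  shows "sobolev_top s (v - w) \<le> 2 * (sobolev_top s v + sobolev_top s w)"
proof (cases "s < 1")
  case True
  then have fin: "slobodeckij \<Omega> s v < \<infinity>" "slobodeckij \<Omega> s w < \<infinity>"
    and "v \<in> L2_space \<Omega>" "w \<in> L2_space \<Omega>" using assms by (auto simp: sobolev_le_1_iff)
  then have "slobodeckij \<Omega> s (v - w) \<le> 2 * (slobodeckij \<Omega> s v + slobodeckij \<Omega> s w)"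
    by (intro slobodeckij_diff L2_spaceD)
  then have "enn2real (slobodeckij \<Omega> s (v - w)) \<le> enn2real (2 * (slobodeckij \<Omega> s v + slobodeckij \<Omega> s w))"
    using fin by (intro enn2real_mono) (auto simp: ennreal_mult_less_top)
  also have "\<dots> = 2 * (enn2real (slobodeckij \<Omega> s v) + enn2real (slobodeckij \<Omega> s w))"
    using fin by (subst enn2real_mult, subst enn2real_plus) auto
  finally show ?thesis using True by (simp add: sobolev_top_def)
next
  case False
  then obtain g k where g: "has_weak_grad \<Omega> v g" and k: "has_weak_grad \<Omega> w k"
    using assms by (auto simp: sobolev_le_1_iff)
  have gk: "g \<in> L2_space \<Omega>" "k \<in> L2_space \<Omega>" using g k has_weak_gradD by auto
  have "(L2_norm \<Omega> (g - k))\<^sup>2 \<le> (L2_norm \<Omega> g + L2_norm \<Omega> k)\<^sup>2"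
    using L2_norm_linear_le[OF gk, of 1 "-1"] gk by (intro power_mono) auto
  also have "\<dots> \<le> 2 * ((L2_norm \<Omega> g)\<^sup>2 + (L2_norm \<Omega> k)\<^sup>2)"
    using sum_squares_bound[of "L2_norm \<Omega> g" "L2_norm \<Omega> k"] by (simp add: power2_sum)
  finally show ?thesis
    using False by (simp add: sobolev_top_def L2_norm_weak_grad[OF g] L2_norm_weak_grad[OF k]
        L2_norm_weak_grad[OF has_weak_grad_diff[OF g k]])
qed

lemma sobolev_top_scale:
  assumes "0 < s" "s \<le> 1" "w \<in> sobolev \<Omega> s"
  shows "sobolev_top s (c *\<^sub>R w) = c\<^sup>2 * sobolev_top s w"
proof (cases "s < 1")
  case True
  then have "w \<in> L2_space \<Omega>" using assms by (auto simp: sobolev_le_1_iff)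
  then show ?thesis using True by (simp add: sobolev_top_def slobodeckij_scale L2_spaceD enn2real_mult)
next
  case False
  then obtain g where g: "has_weak_grad \<Omega> w g" using assms by (auto simp: sobolev_le_1_iff)
  then have "has_weak_grad \<Omega> (c *\<^sub>R w) (c *\<^sub>R g)" using has_weak_grad_linear[OF g g, of c 0] by simp
  with g False show ?thesis
    by (simp add: sobolev_top_def L2_norm_weak_grad L2.nrm_scale has_weak_gradD(2)[OF g] power_mult_distrib)
qed

text \<open>For \<open>s < 1\<close> an almost everywhere convergent subsequence feeds Fatou's
  lemma; for \<open>s = 1\<close> the duality lemma applies. Membership of the limit is a premise,
  which the regularity hypothesis will provide.\<close>

lemma sobolev_top_lower_semicontinuous:
  assumes "0 < s" "s \<le> 1" and w: "\<And>k. w k \<in> sobolev \<Omega> s" "u \<in> sobolev \<Omega> s"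
    and lim: "(\<lambda>k. L2_norm \<Omega> (w k - u)) \<longlonglongrightarrow> 0" and bound: "\<And>k. sobolev_top s (w k) \<le> c"
  shows "sobolev_top s u \<le> c"
proof -
  have c: "0 \<le> c" using bound[of 0] sobolev_top_nonneg[of s "w 0"] by linarith
  have L2: "w k \<in> L2_space \<Omega>" "u \<in> L2_space \<Omega>" for k using assms by (auto simp: sobolev_le_1_iff)
  show ?thesis
  proof (cases "s < 1")
    case True
    obtain r :: "nat \<Rightarrow> nat" where r: "AE x in M. (\<lambda>k. w (r k) x) \<longlonglongrightarrow> u x"
      using L2_tendsto_AE_subseq[OF domain_lmeasurable L2 lim] by metis
    have "slobodeckij \<Omega> s (w k) \<le> ennreal c" for k
    proof -
      have "slobodeckij \<Omega> s (w k) < top" using w(1)[of k] True assms by (auto simp: sobolev_le_1_iff)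
      then have "slobodeckij \<Omega> s (w k) = ennreal (enn2real (slobodeckij \<Omega> s (w k)))" by simp
      also have "\<dots> \<le> ennreal c" using bound[of k] True by (intro ennreal_leI) (simp add: sobolev_top_def)
      finally show ?thesis .
    qed
    then have "slobodeckij \<Omega> s u \<le> ennreal c"
      using L2 by (intro slobodeckij_Fatou[OF _ _ r]) (auto intro: L2_spaceD)
    then have "enn2real (slobodeckij \<Omega> s u) \<le> c" using c by (intro enn2real_leI)
    then show ?thesis using True by (simp add: sobolev_top_def)
  next
    case False
    then have g: "has_weak_grad \<Omega> (w k) (weak_grad \<Omega> (w k))" "has_weak_grad \<Omega> u (weak_grad \<Omega> u)" for k
      using assms by (auto simp: sobolev_le_1_iff intro: has_weak_grad_weak_grad)
    have "L2_norm \<Omega> (weak_grad \<Omega> (w k)) \<le> sqrt c" for k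
      using bound[of k] False by (intro real_le_rsqrt) (simp add: sobolev_top_def)
    then have "L2_norm \<Omega> (weak_grad \<Omega> u) \<le> sqrt c"
      by (rule weak_grad_lower_semicontinuous[OF g(1) g(2) lim])
    then have "(L2_norm \<Omega> (weak_grad \<Omega> u))\<^sup>2 \<le> (sqrt c)\<^sup>2"
      using L2.nrm_nonneg[OF has_weak_gradD(2)[OF g(2)]] by (intro power_mono) auto
    then show ?thesis using False c by (simp add: sobolev_top_def)
  qed
qed

text \<open>Regularity is assumed only as a membership; the corresponding a priori estimate follows from
  Gelfand's lemma, applied for each \<open>i\<close> to \<open>f \<mapsto> sobolev_top s (\<partial>\<^sub>i u)\<close> with \<open>u\<close> the solution for \<open>f\<close>.\<close>

lemma regularity_estimate:
  assumes s: "0 < s" "s \<le> 1"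
    and regularity: "\<And>f u. f \<in> L2_space \<Omega> \<Longrightarrow> poisson_solution \<Omega> f u \<Longrightarrow> u \<in> sobolev \<Omega> (1 + s)"
  shows "\<exists>C>0. \<forall>f u. f \<in> L2_space \<Omega> \<longrightarrow> poisson_solution \<Omega> f u \<longrightarrow>
    sobolev_norm \<Omega> (1 + s) u \<le> C * L2_norm \<Omega> f"
proof -
  interpret S: semi_hilbert "L2_space \<Omega> :: (real ^ 'n \<Rightarrow> real) set" "L2_inner \<Omega>"
    rewrites "semi_inner.nrm (L2_inner \<Omega> :: (real ^ 'n \<Rightarrow> real) \<Rightarrow> _) = L2_norm \<Omega>"
    by (rule semi_hilbert_L2[OF domain_lmeasurable]) (rule nrm_L2)
  obtain C where C: "C > 0" "\<And>f u. f \<in> L2_space \<Omega> \<Longrightarrow> poisson_solution \<Omega> f u \<Longrightarrow>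
    L2_norm \<Omega> u \<le> C * L2_norm \<Omega> f \<and> L2_norm \<Omega> (weak_grad \<Omega> u) \<le> C * L2_norm \<Omega> f"
    using poisson_bound by blast
  \<comment> \<open>A solution operator made of arbitrary choices: it is linear only almost
    everywhere, which \<open>D_AE\<close> and \<open>D_T\<close> have to bridge.\<close>
  define T where "T f = (SOME u. poisson_solution \<Omega> f u)" for f
  have T: "poisson_solution \<Omega> f (T f)" if "f \<in> L2_space \<Omega>" for f
    unfolding T_def using poisson_exists[OF that] by (rule someI_ex)
  define D where "D i u x = weak_grad \<Omega> u x $ i" for i u x
  have D_sob: "D i u \<in> sobolev \<Omega> s" if "f \<in> L2_space \<Omega>" "poisson_solution \<Omega> f u" for f u i
    using sobolev_add_1(2)[OF s(1) regularity[OF that]] unfolding D_def[abs_def] .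
  have D_AE: "AE x in M. D i w x = (a *\<^sub>R D i u + b *\<^sub>R D i v) x"
    if u: "f \<in> L2_space \<Omega>" "poisson_solution \<Omega> f u" and v: "g \<in> L2_space \<Omega>" "poisson_solution \<Omega> g v"
      and w: "poisson_solution \<Omega> (a *\<^sub>R f + b *\<^sub>R g) w" for f g u v w a b i
  proof -
    note lin = poisson_linear[OF u(2) v(2) u(1) v(1), of a b]
    have "AE x in M. w x = (a *\<^sub>R u + b *\<^sub>R v) x"
      using poisson_unique[OF w lin] u v by simp
    moreover have "has_weak_grad \<Omega> (a *\<^sub>R u + b *\<^sub>R v) (a *\<^sub>R weak_grad \<Omega> u + b *\<^sub>R weak_grad \<Omega> v)"
      using u v by (intro has_weak_grad_linear H10_weak_grad poisson_solutionD)
    ultimately have "AE x in M. weak_grad \<Omega> w x = (a *\<^sub>R weak_grad \<Omega> u + b *\<^sub>R weak_grad \<Omega> v) x"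
      using H10_weak_grad[OF poisson_solutionD(1)[OF w]] by (intro has_weak_grad_unique)
    then show ?thesis by eventually_elim (simp add: D_def)
  qed
  \<comment> \<open>Membership comes from regularity of the solution for the combined datum, carried
    along equality almost everywhere.\<close>
  have D_lin_sob: "a *\<^sub>R D i u + b *\<^sub>R D i v \<in> sobolev \<Omega> s"
    if u: "f \<in> L2_space \<Omega>" "poisson_solution \<Omega> f u" and v: "g \<in> L2_space \<Omega>" "poisson_solution \<Omega> g v"
    for f g u v a b i
  proof (rule sobolev_le_1_cong_AE[OF s])
    note lin = poisson_linear[OF u(2) v(2) u(1) v(1), of a b]
    have fg: "a *\<^sub>R f + b *\<^sub>R g \<in> L2_space \<Omega>" using u v by simp
    show "D i (a *\<^sub>R u + b *\<^sub>R v) \<in> sobolev \<Omega> s" by (rule D_sob[OF fg lin])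
    show "AE x in M. D i (a *\<^sub>R u + b *\<^sub>R v) x = (a *\<^sub>R D i u + b *\<^sub>R D i v) x"
      by (rule D_AE[OF u v lin])
    have "D i u \<in> L2_space \<Omega>" "D i v \<in> L2_space \<Omega>"
      using D_sob[OF u, of i] D_sob[OF v, of i] by (auto simp: sobolev_le_1_iff[OF s])
    then show "a *\<^sub>R D i u + b *\<^sub>R D i v \<in> L2_space \<Omega>" by simp
  qed
  have D_T: "sobolev_top s (D i (T (a *\<^sub>R f + b *\<^sub>R g))) = sobolev_top s (a *\<^sub>R D i (T f) + b *\<^sub>R D i (T g))"
    if f: "f \<in> L2_space \<Omega>" and g: "g \<in> L2_space \<Omega>" for f g a b i
  proof -
    have fg: "a *\<^sub>R f + b *\<^sub>R g \<in> L2_space \<Omega>" using f g by simp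
    show ?thesis
      by (rule sobolev_top_cong_AE[OF s D_sob[OF fg T[OF fg]] D_lin_sob[OF f T[OF f] g T[OF g]]
            D_AE[OF f T[OF f] g T[OF g] T[OF fg]]])
  qed
  have "\<exists>K\<ge>0. \<forall>f\<in>L2_space \<Omega>. sobolev_top s (D i (T f)) \<le> K * (L2_norm \<Omega> f)\<^sup>2" for i
  proof (rule S.lower_semicontinuous_quadratic_bounded[of "\<lambda>f. sobolev_top s (D i (T f))"])
    show "0 \<le> sobolev_top s (D i (T f))" for f by (rule sobolev_top_nonneg)
    show "sobolev_top s (D i (T (f - g))) \<le> 2 * (sobolev_top s (D i (T f)) + sobolev_top s (D i (T g)))"
      if f: "f \<in> L2_space \<Omega>" and g: "g \<in> L2_space \<Omega>" for f g
      using D_T[OF f g, of i 1 "-1"] sobolev_top_diff[OF s D_sob[OF f T[OF f]] D_sob[OF g T[OF g]], of i i]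
      by simp
    show "sobolev_top s (D i (T (c *\<^sub>R f))) = c\<^sup>2 * sobolev_top s (D i (T f))" if f: "f \<in> L2_space \<Omega>" for c f
      using D_T[OF f f, of i c 0] sobolev_top_scale[OF s D_sob[OF f T[OF f]], of c i] by simp
    show "sobolev_top s (D i (T x)) \<le> c"
      if f: "\<And>n. f n \<in> L2_space \<Omega>" and x: "x \<in> L2_space \<Omega>"
        and lim: "(\<lambda>n. L2_norm \<Omega> (f n - x)) \<longlonglongrightarrow> 0" and bound: "\<And>n. sobolev_top s (D i (T (f n))) \<le> c"
      for f :: "nat \<Rightarrow> real ^ 'n \<Rightarrow> real" and x c
    proof (rule sobolev_top_lower_semicontinuous[OF s D_sob[OF f T[OF f]] D_sob[OF x T[OF x]] _ bound])
      \<comment> \<open>By linearity and the energy bound the derivatives of the solution depend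
        continuously in L2 on the datum, so lower semicontinuity of \<open>sobolev_top\<close>
        passes to the datum.\<close>
      note u = H10_weak_grad[OF poisson_solutionD(1)[OF T]]
      have "norm (L2_norm \<Omega> (D i (T (f n)) - D i (T x))) \<le> C * L2_norm \<Omega> (f n - x)" for n
      proof -
        note wd = has_weak_grad_diff[OF u[OF f[of n]] u[OF x]]
        have "poisson_solution \<Omega> (f n - x) (T (f n) - T x)"
          using poisson_linear[OF T[OF f[of n]] T[OF x] f[of n] x, of 1 "-1"] by simp
        then have "L2_norm \<Omega> (weak_grad \<Omega> (T (f n)) - weak_grad \<Omega> (T x)) \<le> C * L2_norm \<Omega> (f n - x)"
          using C(2)[of "f n - x" "T (f n) - T x"] f x L2_norm_weak_grad[OF wd] by simp
        moreover have eq: "D i (T (f n)) - D i (T x) = (\<lambda>y. (weak_grad \<Omega> (T (f n)) - weak_grad \<Omega> (T x)) y $ i)"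
          by (simp add: fun_eq_iff D_def)
        moreover note L2_norm_component_le[OF has_weak_gradD(2)[OF wd], of i]
          L2.nrm_nonneg[OF L2_norm_component_sum(2)[OF has_weak_gradD(2)[OF wd], of i]]
        ultimately show ?thesis by (simp only: eq real_norm_def abs_of_nonneg)
      qed
      then show "(\<lambda>n. L2_norm \<Omega> (D i (T (f n)) - D i (T x))) \<longlonglongrightarrow> 0"
        by (intro Lim_null_comparison[OF _ tendsto_mult_right_zero[OF lim]] always_eventually allI)
    qed
  qed blast
  then obtain K where K: "\<And>i. K i \<ge> 0" "\<And>i f. f \<in> L2_space \<Omega> \<Longrightarrow> sobolev_top s (D i (T f)) \<le> K i * (L2_norm \<Omega> f)\<^sup>2"
    by metis
  show ?thesis
  \<comment> \<open>\<open>2 * C\<^sup>2\<close> covers the L2 norms of the solution and of its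
    gradient, and each \<open>K i\<close> the top order part of one derivative.\<close>
  proof (intro exI[of _ "sqrt (2 * C\<^sup>2 + (\<Sum>i\<in>UNIV. K i))"] conjI allI impI)
    show "sqrt (2 * C\<^sup>2 + (\<Sum>i\<in>UNIV. K i)) > 0"
      using C(1) K(1) by (simp add: add_pos_nonneg sum_nonneg)
    fix f u assume f: "f \<in> L2_space \<Omega>" and u: "poisson_solution \<Omega> f u"
    have "(sobolev_norm \<Omega> (1 + s) u)\<^sup>2 = (L2_norm \<Omega> u)\<^sup>2 + (\<Sum>i\<in>UNIV. (sobolev_norm \<Omega> s (D i u))\<^sup>2)"
      using sobolev_add_1(4)[OF s(1) regularity[OF f u]] by (simp add: D_def[abs_def])
    also have "\<dots> = (L2_norm \<Omega> u)\<^sup>2 + (L2_norm \<Omega> (weak_grad \<Omega> u))\<^sup>2 + (\<Sum>i\<in>UNIV. sobolev_top s (D i u))"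
    proof -
      have "(L2_norm \<Omega> (weak_grad \<Omega> u))\<^sup>2 = (\<Sum>i\<in>UNIV. (L2_norm \<Omega> (D i u))\<^sup>2)"
        using L2_norm_component_sum(1)[OF H10_L2(2)[OF poisson_solutionD(1)[OF u]]]
        by (simp add: D_def[abs_def])
      then show ?thesis by (simp add: sobolev_norm_le_1[OF s D_sob[OF f u]] sum.distrib)
    qed
    also have "\<dots> \<le> (C * L2_norm \<Omega> f)\<^sup>2 + (C * L2_norm \<Omega> f)\<^sup>2 + (\<Sum>i\<in>UNIV. K i * (L2_norm \<Omega> f)\<^sup>2)"
    proof (intro add_mono power_mono sum_mono)
      fix i
      \<comment> \<open>The bound is known for the chosen solution \<open>T f\<close>; uniqueness
        transfers it to any \<open>u\<close>.\<close>
      have "AE x in M. D i u x = D i (T f) x"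
        using D_AE[OF f T[OF f] f T[OF f], of 1 0 u i] u by simp
      from sobolev_top_cong_AE[OF s D_sob[OF f u] D_sob[OF f T[OF f]] this]
      show "sobolev_top s (D i u) \<le> K i * (L2_norm \<Omega> f)\<^sup>2" using K(2)[OF f] by simp
    qed (use C(2)[OF f u] H10_L2[OF poisson_solutionD(1)[OF u]] in auto)
    also have "\<dots> = (sqrt (2 * C\<^sup>2 + (\<Sum>i\<in>UNIV. K i)) * L2_norm \<Omega> f)\<^sup>2"
      using K(1) by (simp add: power_mult_distrib sum_nonneg add_nonneg_nonneg sum_distrib_right algebra_simps)
    finally show "sobolev_norm \<Omega> (1 + s) u \<le> sqrt (2 * C\<^sup>2 + (\<Sum>i\<in>UNIV. K i)) * L2_norm \<Omega> f"
      by (rule power2_le_imp_le) (use f K(1) in \<open>simp add: sum_nonneg add_nonneg_nonneg\<close>)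
  qed
qed

end

section \<open>The duality argument\<close>

text \<open>The infimum of a set of reals is meaningful only if the set is nonempty and bounded
  below; nonnegativity supplies the latter.\<close>

lemma INF_less_witness:
  fixes F :: "'a \<Rightarrow> real"
  assumes "A \<noteq> {}" "\<And>x. x \<in> A \<Longrightarrow> 0 \<le> F x" "(INF x\<in>A. F x) < c"
  shows "\<exists>x\<in>A. F x < c"
proof -
  have "bdd_below (F ` A)" using assms(2) by (rule bdd_belowI2)
  then show ?thesis using assms(1,3) by (simp add: cINF_less_iff)
qed

context bounded_open
begin

text \<open>The two left-hand sides of the system added up. Regrouped, this is (\<sigma> - grad u,
  \<tau> - grad v) + (div \<sigma>, div \<tau>), which explains its symmetry.\<close>

definition fosls_form ::
  "(real ^ 'n \<Rightarrow> real ^ 'n) \<Rightarrow> (real ^ 'n \<Rightarrow> real) \<Rightarrow> (real ^ 'n \<Rightarrow> real ^ 'n) \<Rightarrow> (real ^ 'n \<Rightarrow> real) \<Rightarrow> real" where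
  "fosls_form \<sigma> u \<tau> v = L2_inner \<Omega> \<sigma> \<tau> + L2_inner \<Omega> (weak_div \<Omega> \<sigma>) (weak_div \<Omega> \<tau>)
     - L2_inner \<Omega> (weak_grad \<Omega> u) \<tau> - L2_inner \<Omega> \<sigma> (weak_grad \<Omega> v)
     + L2_inner \<Omega> (weak_grad \<Omega> u) (weak_grad \<Omega> v)"

lemma Hdiv_norm_ge:
  "L2_norm \<Omega> \<tau> \<le> Hdiv_norm \<Omega> \<tau>" "L2_norm \<Omega> (weak_div \<Omega> \<tau>) \<le> Hdiv_norm \<Omega> \<tau>" "0 \<le> Hdiv_norm \<Omega> \<tau>"
  unfolding Hdiv_norm_def by (auto simp: real_sqrt_sum_squares_ge1 real_sqrt_sum_squares_ge2)

lemma H10_norm_ge: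
  assumes "u \<in> H10 \<Omega>"
  shows "L2_norm \<Omega> (weak_grad \<Omega> u) \<le> sobolev_norm \<Omega> 1 u" "0 \<le> sobolev_norm \<Omega> 1 u"
  unfolding sobolev_norm_1[OF H10_weak_grad[OF assms]] by (auto simp: real_sqrt_sum_squares_ge2)

lemma fosls_form_commute:
  assumes "\<sigma> \<in> Hdiv \<Omega>" "u \<in> H10 \<Omega>" "\<tau> \<in> Hdiv \<Omega>" "v \<in> H10 \<Omega>"
  shows "fosls_form \<sigma> u \<tau> v = fosls_form \<tau> v \<sigma> u"
  using assms
  by (simp add: fosls_form_def Hdiv_L2 H10_L2 L2.commute[of \<sigma> \<Omega> \<tau>] L2.commute[of "weak_div \<Omega> \<sigma>" \<Omega> "weak_div \<Omega> \<tau>"]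
      L2.commute[of "weak_grad \<Omega> u" \<Omega> \<tau>] L2.commute[of \<sigma> \<Omega> "weak_grad \<Omega> v"]
      L2.commute[of "weak_grad \<Omega> u" \<Omega> "weak_grad \<Omega> v"])

lemma fosls_form_diff:
  assumes \<sigma>: "\<sigma> \<in> Hdiv \<Omega>" "\<sigma>' \<in> Hdiv \<Omega>" and u: "u \<in> H10 \<Omega>" "u' \<in> H10 \<Omega>"
    and \<tau>: "\<tau> \<in> Hdiv \<Omega>" and v: "v \<in> H10 \<Omega>"
  shows "fosls_form (\<sigma> - \<sigma>') (u - u') \<tau> v = fosls_form \<sigma> u \<tau> v - fosls_form \<sigma>' u' \<tau> v"
  unfolding fosls_form_def
  using L2_inner_weak_div[OF has_weak_div_diff[OF Hdiv_weak_div[OF \<sigma>(1)] Hdiv_weak_div[OF \<sigma>(2)]] Hdiv_L2(2)[OF \<tau>]]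
    L2_inner_weak_grad[OF has_weak_grad_diff[OF H10_weak_grad[OF u(1)] H10_weak_grad[OF u(2)]] Hdiv_L2(1)[OF \<tau>]]
    L2_inner_weak_grad[OF has_weak_grad_diff[OF H10_weak_grad[OF u(1)] H10_weak_grad[OF u(2)]] H10_L2(2)[OF v]]
    assms
  by (simp add: L2.diff_left Hdiv_L2 H10_L2)

lemma fosls_form_bound:
  assumes \<sigma>: "\<sigma> \<in> Hdiv \<Omega>" and u: "u \<in> H10 \<Omega>" and \<tau>: "\<tau> \<in> Hdiv \<Omega>" and v: "v \<in> H10 \<Omega>"
  shows "\<bar>fosls_form \<sigma> u \<tau> v\<bar>
    \<le> 2 * (Hdiv_norm \<Omega> \<sigma> + sobolev_norm \<Omega> 1 u) * (Hdiv_norm \<Omega> \<tau> + sobolev_norm \<Omega> 1 v)"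
proof -
  have ip: "\<bar>L2_inner \<Omega> f g\<bar> \<le> a * b"
    if "f \<in> L2_space \<Omega>" "g \<in> L2_space \<Omega>" "L2_norm \<Omega> f \<le> a" "L2_norm \<Omega> g \<le> b"
    for f g :: "real ^ 'n \<Rightarrow> 'b :: euclidean_space" and a b
    by (rule order_trans[OF L2.Cauchy_Schwarz[OF that(1,2)]])
      (intro mult_mono that order_trans[OF L2.nrm_nonneg[OF that(1)] that(3)] L2.nrm_nonneg)
  note le = Hdiv_norm_ge[of \<sigma>] Hdiv_norm_ge[of \<tau>] H10_norm_ge[OF u] H10_norm_ge[OF v]
  note mem = Hdiv_L2[OF \<sigma>] Hdiv_L2[OF \<tau>] H10_L2[OF u] H10_L2[OF v]
  define a where "a = Hdiv_norm \<Omega> \<sigma>"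
  define b where "b = sobolev_norm \<Omega> 1 u"
  define c where "c = Hdiv_norm \<Omega> \<tau>"
  define d where "d = sobolev_norm \<Omega> 1 v"
  have "\<bar>fosls_form \<sigma> u \<tau> v\<bar> \<le> a * c + a * c + b * c + a * d + b * d"
    using ip[OF mem(1,3) le(1,4)] ip[OF mem(2,4) le(2,5)] ip[OF mem(6,3) le(7,4)]
      ip[OF mem(1,8) le(1,9)] ip[OF mem(6,8) le(7,9)]
    unfolding fosls_form_def a_def b_def c_def d_def by linarith
  \<comment> \<open>\<open>a * c\<close> occurs twice, from the fluxes and from their divergences,
    hence the factor 2.\<close>
  also have "\<dots> \<le> 2 * (a + b) * (c + d)"
  proof -
    have "0 \<le> b * c" "0 \<le> a * d" "0 \<le> b * d" using le by (simp_all add: a_def b_def c_def d_def)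
    then show ?thesis by (simp add: algebra_simps)
  qed
  finally show ?thesis by (simp add: a_def b_def c_def d_def)
qed

lemma Galerkin_orthogonality:
  assumes sol: "fosls_solution \<Omega> (Hdiv \<Omega>) (H10 \<Omega>) f \<sigma> u" and solh: "fosls_solution \<Omega> S V f \<sigma>h uh"
    and sub: "S \<subseteq> Hdiv \<Omega>" "V \<subseteq> H10 \<Omega>" and test: "\<tau> \<in> S" "v \<in> V"
  shows "fosls_form (\<sigma> - \<sigma>h) (u - uh) \<tau> v = 0"
proof -
  have mem: "\<sigma> \<in> Hdiv \<Omega>" "u \<in> H10 \<Omega>" "\<sigma>h \<in> Hdiv \<Omega>" "uh \<in> H10 \<Omega>" "\<tau> \<in> Hdiv \<Omega>" "v \<in> H10 \<Omega>"
    using assms by (auto simp: fosls_solution_def)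
  have "fosls_form \<sigma> u \<tau> v = - L2_inner \<Omega> f (weak_div \<Omega> \<tau>)"
  proof -
    have "L2_inner \<Omega> \<sigma> \<tau> + L2_inner \<Omega> (weak_div \<Omega> \<sigma>) (weak_div \<Omega> \<tau>) - L2_inner \<Omega> (weak_grad \<Omega> u) \<tau>
        = - L2_inner \<Omega> f (weak_div \<Omega> \<tau>)"
      "- L2_inner \<Omega> \<sigma> (weak_grad \<Omega> v) + L2_inner \<Omega> (weak_grad \<Omega> u) (weak_grad \<Omega> v) = 0"
      using sol mem(5,6) unfolding fosls_solution_def by blast+
    then show ?thesis by (simp add: fosls_form_def)
  qed
  moreover have "fosls_form \<sigma>h uh \<tau> v = - L2_inner \<Omega> f (weak_div \<Omega> \<tau>)"
  proof -
    have "L2_inner \<Omega> \<sigma>h \<tau> + L2_inner \<Omega> (weak_div \<Omega> \<sigma>h) (weak_div \<Omega> \<tau>) - L2_inner \<Omega> (weak_grad \<Omega> uh) \<tau>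
        = - L2_inner \<Omega> f (weak_div \<Omega> \<tau>)"
      "- L2_inner \<Omega> \<sigma>h (weak_grad \<Omega> v) + L2_inner \<Omega> (weak_grad \<Omega> uh) (weak_grad \<Omega> v) = 0"
      using solh test unfolding fosls_solution_def by blast+
    then show ?thesis by (simp add: fosls_form_def)
  qed
  ultimately show ?thesis by (simp add: fosls_form_diff mem)
qed

text \<open>With \<eta> = grad q and p = q + \<psi> one has \<eta> - grad p = - grad \<psi>. Paired
  with \<tau> this is (\<psi>, div \<tau>) by Green's formula and cancels against (div \<eta>, div
  \<tau>); paired with grad v it leaves the Poisson equation of \<psi>. The second and third
  conclusions exist so that the regularity estimate can be applied to div \<eta> and p.\<close>

lemma dual_problem:
  assumes g: "g \<in> L2_space \<Omega>" and \<psi>: "poisson_solution \<Omega> g \<psi>" and q: "poisson_solution \<Omega> \<psi> q"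
  shows "weak_grad \<Omega> q \<in> Hdiv \<Omega>"
    and "poisson_solution \<Omega> (- g) (weak_div \<Omega> (weak_grad \<Omega> q))"
    and "poisson_solution \<Omega> (\<psi> + g) (q + \<psi>)"
    and "\<tau> \<in> Hdiv \<Omega> \<Longrightarrow> v \<in> H10 \<Omega> \<Longrightarrow>
      fosls_form (weak_grad \<Omega> q) (q + \<psi>) \<tau> v = L2_inner \<Omega> g v"
proof -
  have mem: "\<psi> \<in> H10 \<Omega>" "q \<in> H10 \<Omega>" using poisson_solutionD \<psi> q by auto
  note L2 = H10_L2[OF mem(1)] H10_L2[OF mem(2)]
  have div: "has_weak_div \<Omega> (weak_grad \<Omega> q) (- \<psi>)"
    unfolding has_weak_div_def
  proof (intro conjI ballI)
    fix \<phi> assume \<phi>: "\<phi> \<in> test_functions \<Omega>"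
    have "L2_inner \<Omega> (weak_grad \<Omega> q) (grad \<phi>) = L2_inner \<Omega> (weak_grad \<Omega> \<phi>) (weak_grad \<Omega> q)"
      using L2_inner_weak_grad[OF test_has_weak_grad[OF \<phi>] L2(4)] L2.commute[OF L2(4) test_L2(2)[OF \<phi>]] by simp
    also have "\<dots> = Dirichlet q \<phi>"
      unfolding Dirichlet_def by (rule L2.commute[OF H10_L2(2)[OF test_H10[OF \<phi>]] L2(4)])
    also have "\<dots> = - L2_inner \<Omega> (- \<psi>) \<phi>"
      using poisson_solutionD(2)[OF q test_H10[OF \<phi>]] L2.minus_left[OF L2(1) test_L2(1)[OF \<phi>]] by simp
    finally show "L2_inner \<Omega> (weak_grad \<Omega> q) (grad \<phi>) = - L2_inner \<Omega> (- \<psi>) \<phi>" .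
  qed (use L2 in auto)
  then show \<eta>: "weak_grad \<Omega> q \<in> Hdiv \<Omega>" by (auto simp: Hdiv_def)
  have "poisson_solution \<Omega> (- g) (- \<psi>)" using poisson_linear[OF \<psi> \<psi> g g, of "-1" 0] by simp
  then show "poisson_solution \<Omega> (- g) (weak_div \<Omega> (weak_grad \<Omega> q))"
    by (rule poisson_cong_AE[OF _ Hdiv_L2(2)[OF \<eta>] has_weak_div_unique[OF div Hdiv_weak_div[OF \<eta>]]])
  show p: "poisson_solution \<Omega> (\<psi> + g) (q + \<psi>)" using poisson_linear[OF q \<psi> L2(1) g, of 1 1] by simp
  assume \<tau>: "\<tau> \<in> Hdiv \<Omega>" and v: "v \<in> H10 \<Omega>"
  note \<tau>2 = Hdiv_L2[OF \<tau>] and v2 = H10_L2[OF v]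
  have grad_p: "L2_inner \<Omega> (weak_grad \<Omega> (q + \<psi>)) \<xi> = L2_inner \<Omega> (weak_grad \<Omega> q) \<xi> + L2_inner \<Omega> (weak_grad \<Omega> \<psi>) \<xi>"
    if "\<xi> \<in> L2_space \<Omega>" for \<xi>
    using weak_grad_linear_inner[OF mem(2,1) that, of 1 1] by simp
  have "L2_inner \<Omega> (weak_div \<Omega> (weak_grad \<Omega> q)) (weak_div \<Omega> \<tau>) = - L2_inner \<Omega> \<psi> (weak_div \<Omega> \<tau>)"
    using L2_inner_weak_div[OF div \<tau>2(2)] L2.minus_left[OF L2(1) \<tau>2(2)] by simp
  moreover have "L2_inner \<Omega> (weak_grad \<Omega> \<psi>) \<tau> = - L2_inner \<Omega> \<psi> (weak_div \<Omega> \<tau>)"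
    using Green[OF mem(1) Hdiv_weak_div[OF \<tau>]] L2.commute[OF L2(2) \<tau>2(1)] L2.commute[OF L2(1) \<tau>2(2)] by simp
  moreover have "L2_inner \<Omega> (weak_grad \<Omega> \<psi>) (weak_grad \<Omega> v) = L2_inner \<Omega> g v"
    using poisson_solutionD(2)[OF \<psi> v] by (simp add: Dirichlet_def)
  ultimately show "fosls_form (weak_grad \<Omega> q) (q + \<psi>) \<tau> v = L2_inner \<Omega> g v"
    unfolding fosls_form_def using grad_p[OF \<tau>2(1)] grad_p[OF v2(2)] by simp
qed

lemma dual_solution_bounds:
  assumes s: "0 < s" "s \<le> 1"
    and regularity: "\<And>f u. f \<in> L2_space \<Omega> \<Longrightarrow> poisson_solution \<Omega> f u \<Longrightarrow> u \<in> sobolev \<Omega> (1 + s)"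
  shows "\<exists>K>0. \<forall>g\<in>L2_space \<Omega>. \<exists>\<eta> p. \<eta> \<in> Hdiv \<Omega> \<and> \<eta> \<in> sobolev_vec \<Omega> s
    \<and> weak_div \<Omega> \<eta> \<in> sobolev \<Omega> (1 + s) \<and> p \<in> sobolev \<Omega> (1 + s) \<inter> H10 \<Omega>
    \<and> (\<forall>\<tau>\<in>Hdiv \<Omega>. \<forall>v\<in>H10 \<Omega>. fosls_form \<eta> p \<tau> v = L2_inner \<Omega> g v)
    \<and> sobolev_vec_norm \<Omega> s \<eta> + sobolev_norm \<Omega> (1 + s) (weak_div \<Omega> \<eta>) \<le> K * L2_norm \<Omega> g
    \<and> sobolev_norm \<Omega> (1 + s) p \<le> K * L2_norm \<Omega> g"
proof -
  have est: "\<exists>C>0. \<forall>f u. f \<in> L2_space \<Omega> \<longrightarrow> poisson_solution \<Omega> f u \<longrightarrow>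
      sobolev_norm \<Omega> (1 + s) u \<le> C * L2_norm \<Omega> f"
    by (rule regularity_estimate[OF s]) (rule regularity)
  obtain C where C: "C > 0" "\<And>f u. f \<in> L2_space \<Omega> \<Longrightarrow> poisson_solution \<Omega> f u \<Longrightarrow>
    sobolev_norm \<Omega> (1 + s) u \<le> C * L2_norm \<Omega> f"
    using est by blast
  obtain P where P: "P > 0" "\<And>f u. f \<in> L2_space \<Omega> \<Longrightarrow> poisson_solution \<Omega> f u \<Longrightarrow>
    L2_norm \<Omega> u \<le> P * L2_norm \<Omega> f \<and> L2_norm \<Omega> (weak_grad \<Omega> u) \<le> P * L2_norm \<Omega> f"
    using poisson_bound by blast
  show ?thesis
  \<comment> \<open>\<open>P\<close> bounds \<psi> by \<open>g\<close>. The data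
    \<open>\<psi>\<close> and \<open>- g\<close> belong to the two parts of the flux norm, and
    \<open>\<psi> + g\<close> to \<open>p\<close>; either way their norms add up to at most
    \<open>P + 1\<close> times that of \<open>g\<close>.\<close>
  proof (intro exI[of _ "C * (P + 1)"] conjI ballI)
    show "C * (P + 1) > 0" using C(1) P(1) by simp
    fix g :: "real ^ 'n \<Rightarrow> real" assume g: "g \<in> L2_space \<Omega>"
    obtain \<psi> where \<psi>: "poisson_solution \<Omega> g \<psi>" using poisson_exists[OF g] by blast
    have \<psi>2: "\<psi> \<in> L2_space \<Omega>" by (rule H10_L2(1)[OF poisson_solutionD(1)[OF \<psi>]])
    obtain q where q: "poisson_solution \<Omega> \<psi> q" using poisson_exists[OF \<psi>2] by blast
    note dual = dual_problem[OF g \<psi> q]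
    have mg: "- g \<in> L2_space \<Omega>" and \<psi>g: "\<psi> + g \<in> L2_space \<Omega>" using g \<psi>2 by auto
    have neg_norm: "L2_norm \<Omega> (- g) = L2_norm \<Omega> g" using L2.nrm_scale[OF g, of "-1"] by simp
    have \<psi>_le: "L2_norm \<Omega> \<psi> \<le> P * L2_norm \<Omega> g" by (rule P(2)[OF g \<psi>, THEN conjunct1])
    note q_sob = sobolev_add_1[OF s(1) regularity[OF \<psi>2 q]]
    \<comment> \<open>The derivative part of the norm of order \<open>1 + s\<close> is exactly the
      vector norm of order \<open>s\<close>.\<close>
    have vec: "sobolev_vec_norm \<Omega> s (weak_grad \<Omega> q) \<le> sobolev_norm \<Omega> (1 + s) q"
      unfolding sobolev_vec_norm_def using q_sob(3,4) by (intro real_le_lsqrt) (auto intro: sum_nonneg)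
    have "sobolev_vec_norm \<Omega> s (weak_grad \<Omega> q) \<le> C * (P * L2_norm \<Omega> g)"
      using vec C(2)[OF \<psi>2 q] mult_left_mono[OF \<psi>_le, of C] C(1) by linarith
    moreover have "sobolev_norm \<Omega> (1 + s) (weak_div \<Omega> (weak_grad \<Omega> q)) \<le> C * L2_norm \<Omega> g"
      using C(2)[OF mg dual(2)] neg_norm by simp
    ultimately have \<eta>_le: "sobolev_vec_norm \<Omega> s (weak_grad \<Omega> q) + sobolev_norm \<Omega> (1 + s) (weak_div \<Omega> (weak_grad \<Omega> q))
        \<le> C * (P + 1) * L2_norm \<Omega> g" by (simp add: algebra_simps)
    have "sobolev_norm \<Omega> (1 + s) (q + \<psi>) \<le> C * L2_norm \<Omega> (\<psi> + g)" by (rule C(2)[OF \<psi>g dual(3)])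
    also have "\<dots> \<le> C * (P * L2_norm \<Omega> g + L2_norm \<Omega> g)"
      using L2.nrm_triangle[OF \<psi>2 g] \<psi>_le C(1) by (intro mult_left_mono) auto
    finally have p_le: "sobolev_norm \<Omega> (1 + s) (q + \<psi>) \<le> C * (P + 1) * L2_norm \<Omega> g" by (simp add: algebra_simps)
    show "\<exists>\<eta> p. \<eta> \<in> Hdiv \<Omega> \<and> \<eta> \<in> sobolev_vec \<Omega> s
      \<and> weak_div \<Omega> \<eta> \<in> sobolev \<Omega> (1 + s) \<and> p \<in> sobolev \<Omega> (1 + s) \<inter> H10 \<Omega>
      \<and> (\<forall>\<tau>\<in>Hdiv \<Omega>. \<forall>v\<in>H10 \<Omega>. fosls_form \<eta> p \<tau> v = L2_inner \<Omega> g v)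
      \<and> sobolev_vec_norm \<Omega> s \<eta> + sobolev_norm \<Omega> (1 + s) (weak_div \<Omega> \<eta>) \<le> C * (P + 1) * L2_norm \<Omega> g
      \<and> sobolev_norm \<Omega> (1 + s) p \<le> C * (P + 1) * L2_norm \<Omega> g"
    proof (intro exI[of _ "weak_grad \<Omega> q"] exI[of _ "q + \<psi>"] conjI IntI ballI)
      show "weak_grad \<Omega> q \<in> sobolev_vec \<Omega> s" using q_sob(2) by (simp add: sobolev_vec_def)
      show "weak_grad \<Omega> q \<in> Hdiv \<Omega>" by (rule dual(1))
      show "weak_div \<Omega> (weak_grad \<Omega> q) \<in> sobolev \<Omega> (1 + s)" by (rule regularity[OF mg dual(2)])
      show "q + \<psi> \<in> sobolev \<Omega> (1 + s)" by (rule regularity[OF \<psi>g dual(3)])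
      show "q + \<psi> \<in> H10 \<Omega>" by (rule poisson_solutionD(1)[OF dual(3)])
      show "fosls_form (weak_grad \<Omega> q) (q + \<psi>) \<tau> v = L2_inner \<Omega> g v" if "\<tau> \<in> Hdiv \<Omega>" "v \<in> H10 \<Omega>" for \<tau> v
        by (rule dual(4)[OF that])
    qed (rule \<eta>_le p_le)+
  qed
qed

text \<open>The best approximation errors are given as infima, so approximants within
  \<open>\<epsilon>\<close> of them are inserted and \<open>\<epsilon>\<close> is sent to 0 at the
  end.\<close>

lemma duality_estimate:
  assumes sol: "fosls_solution \<Omega> (Hdiv \<Omega>) (H10 \<Omega>) f \<sigma> u" and solh: "fosls_solution \<Omega> S V f \<sigma>h uh"
    and sub: "S \<subseteq> Hdiv \<Omega>" "V \<subseteq> H10 \<Omega>"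
    and \<eta>: "\<eta> \<in> Hdiv \<Omega>" and p: "p \<in> H10 \<Omega>"
    and dual: "\<And>\<tau> v. \<tau> \<in> Hdiv \<Omega> \<Longrightarrow> v \<in> H10 \<Omega> \<Longrightarrow> fosls_form \<eta> p \<tau> v = L2_inner \<Omega> (u - uh) v"
    and approx: "(INF \<tau>\<in>S. Hdiv_norm \<Omega> (\<eta> - \<tau>)) \<le> a" "(INF v\<in>V. sobolev_norm \<Omega> 1 (p - v)) \<le> b"
  shows "(L2_norm \<Omega> (u - uh))\<^sup>2
    \<le> 2 * (a + b) * (Hdiv_norm \<Omega> (\<sigma> - \<sigma>h) + sobolev_norm \<Omega> 1 (u - uh))"
proof -
  have mem: "\<sigma> \<in> Hdiv \<Omega>" "u \<in> H10 \<Omega>" "\<sigma>h \<in> Hdiv \<Omega>" "uh \<in> H10 \<Omega>" and ne: "S \<noteq> {}" "V \<noteq> {}"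
    using assms by (auto simp: fosls_solution_def)
  have e\<sigma>: "\<sigma> - \<sigma>h \<in> Hdiv \<Omega>" and eu: "u - uh \<in> H10 \<Omega>" using mem by (auto intro: Hdiv_diff)
  define E where "E = Hdiv_norm \<Omega> (\<sigma> - \<sigma>h) + sobolev_norm \<Omega> 1 (u - uh)"
  have E: "0 \<le> E" using Hdiv_norm_ge[of "\<sigma> - \<sigma>h"] H10_norm_ge[OF eu] by (simp add: E_def)
  have step: "(L2_norm \<Omega> (u - uh))\<^sup>2 \<le> 2 * (a + b) * E + \<epsilon> * (4 * E)" if \<epsilon>: "\<epsilon> > 0" for \<epsilon>
  proof -
    have "\<exists>\<tau>\<in>S. Hdiv_norm \<Omega> (\<eta> - \<tau>) < a + \<epsilon>"
    proof (rule INF_less_witness[OF ne(1)])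
      show "0 \<le> Hdiv_norm \<Omega> (\<eta> - \<tau>)" for \<tau> by (rule Hdiv_norm_ge(3))
    qed (use approx(1) \<epsilon> in simp)
    then obtain \<tau> where \<tau>: "\<tau> \<in> S" "Hdiv_norm \<Omega> (\<eta> - \<tau>) < a + \<epsilon>" by blast
    have "\<exists>v\<in>V. sobolev_norm \<Omega> 1 (p - v) < b + \<epsilon>"
    proof (rule INF_less_witness[OF ne(2)])
      show "0 \<le> sobolev_norm \<Omega> 1 (p - v)" if "v \<in> V" for v
        using that sub(2) by (intro H10_norm_ge(2) H10.mem(2) p) auto
    qed (use approx(2) \<epsilon> in simp)
    then obtain v where v: "v \<in> V" "sobolev_norm \<Omega> 1 (p - v) < b + \<epsilon>" by blast
    have \<tau>v: "\<tau> \<in> Hdiv \<Omega>" "v \<in> H10 \<Omega>" using \<tau> v sub by auto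
    have "(L2_norm \<Omega> (u - uh))\<^sup>2 = fosls_form \<eta> p (\<sigma> - \<sigma>h) (u - uh)"
      using dual[OF e\<sigma> eu] L2.nrm_sq[OF H10_L2(1)[OF eu]] by simp
    \<comment> \<open>Orthogonality is available with the error in the first two arguments; symmetry
      moves it to the last two, where it removes \<open>\<tau>\<close> and \<open>v\<close>.\<close>
    also have "\<dots> = fosls_form (\<eta> - \<tau>) (p - v) (\<sigma> - \<sigma>h) (u - uh)"
      using fosls_form_diff[OF \<eta> \<tau>v(1) p \<tau>v(2) e\<sigma> eu] fosls_form_commute[OF \<tau>v e\<sigma> eu]
        Galerkin_orthogonality[OF sol solh sub \<tau>(1) v(1)] by simp
    also have "\<dots> \<le> 2 * (Hdiv_norm \<Omega> (\<eta> - \<tau>) + sobolev_norm \<Omega> 1 (p - v)) * E"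
      using fosls_form_bound[OF Hdiv_diff[OF \<eta> \<tau>v(1)] H10.mem(2)[OF p \<tau>v(2)] e\<sigma> eu] by (simp add: E_def)
    also have "\<dots> \<le> 2 * ((a + \<epsilon>) + (b + \<epsilon>)) * E"
      using \<tau>(2) v(2) E by (intro mult_right_mono mult_left_mono add_mono) auto
    finally show ?thesis by (simp add: algebra_simps)
  qed
  show ?thesis
    unfolding E_def[symmetric]
  proof (rule field_le_epsilon)
    fix e :: real assume "e > 0"
    \<comment> \<open>The summand 1 keeps the denominator positive when \<open>E\<close> is
      0.\<close>
    then have "e / (4 * E + 1) > 0" using E by simp
    from step[OF this] show "(L2_norm \<Omega> (u - uh))\<^sup>2 \<le> 2 * (a + b) * E + e"
    proof (rule order_trans)
      have "e / (4 * E + 1) * (4 * E) \<le> e" using \<open>e > 0\<close> E by (simp add: field_simps)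
      then show "2 * (a + b) * E + e / (4 * E + 1) * (4 * E) \<le> 2 * (a + b) * E + e" by simp
    qed
  qed
qed

end

theorem lemma9:
  fixes \<Omega> :: "(real ^ 'n) set" and s :: real
    and \<Sigma>h :: "real \<Rightarrow> (real ^ 'n \<Rightarrow> real ^ 'n) set"
    and Uh :: "real \<Rightarrow> (real ^ 'n \<Rightarrow> real) set"
  assumes dim: "CARD('n) = 2 \<or> CARD('n) = 3"
    and domain: "lipschitz_polyhedral_domain \<Omega>"
    and s: "1 / 2 < s" "s \<le> 1"
    and regularity: "\<And>f u. f \<in> L2_space \<Omega> \<Longrightarrow> poisson_solution \<Omega> f u \<Longrightarrow> u \<in> sobolev \<Omega> (1 + s)"
    and \<Sigma>h: "\<And>h. h > 0 \<Longrightarrow> \<Sigma>h h \<subseteq> Hdiv \<Omega> \<and> finite_dim_space (\<Sigma>h h)"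
    and Uh: "\<And>h. h > 0 \<Longrightarrow> Uh h \<subseteq> H10 \<Omega> \<and> finite_dim_space (Uh h)"
    and approximation: "\<exists>C. \<forall>h > 0.
      (\<forall>\<zeta>. \<zeta> \<in> Hdiv \<Omega> \<and> \<zeta> \<in> sobolev_vec \<Omega> s \<and> weak_div \<Omega> \<zeta> \<in> sobolev \<Omega> (1 + s) \<longrightarrow>
        (INF \<tau> \<in> \<Sigma>h h. Hdiv_norm \<Omega> (\<lambda>x. \<zeta> x - \<tau> x)) \<le>
          C * h powr s * (sobolev_vec_norm \<Omega> s \<zeta> + sobolev_norm \<Omega> (1 + s) (weak_div \<Omega> \<zeta>))) \<and>
      (\<forall>p \<in> sobolev \<Omega> (1 + s) \<inter> H10 \<Omega>.
        (INF v \<in> Uh h. sobolev_norm \<Omega> 1 (\<lambda>x. p x - v x)) \<le>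
          C * h powr s * sobolev_norm \<Omega> (1 + s) p)"
  shows "\<exists>C. \<forall>h > 0. \<forall>f \<in> L2_space \<Omega>. \<forall>\<sigma> u \<sigma>h uh.
      fosls_solution \<Omega> (Hdiv \<Omega>) (H10 \<Omega>) f \<sigma> u \<longrightarrow>
      fosls_solution \<Omega> (\<Sigma>h h) (Uh h) f \<sigma>h uh \<longrightarrow>
      L2_norm \<Omega> (\<lambda>x. u x - uh x) \<le>
        C * h powr s * (Hdiv_norm \<Omega> (\<lambda>x. \<sigma> x - \<sigma>h x) + sobolev_norm \<Omega> 1 (\<lambda>x. u x - uh x))"
proof -
  interpret bounded_open \<Omega>
    using domain by unfold_locales (auto simp: lipschitz_polyhedral_domain_def)
  have s0: "0 < s" using s by simp
  obtain C where "\<forall>h > 0.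
      (\<forall>\<zeta>. \<zeta> \<in> Hdiv \<Omega> \<and> \<zeta> \<in> sobolev_vec \<Omega> s \<and> weak_div \<Omega> \<zeta> \<in> sobolev \<Omega> (1 + s) \<longrightarrow>
        (INF \<tau> \<in> \<Sigma>h h. Hdiv_norm \<Omega> (\<zeta> - \<tau>)) \<le>
          C * h powr s * (sobolev_vec_norm \<Omega> s \<zeta> + sobolev_norm \<Omega> (1 + s) (weak_div \<Omega> \<zeta>))) \<and>
      (\<forall>p \<in> sobolev \<Omega> (1 + s) \<inter> H10 \<Omega>.
        (INF v \<in> Uh h. sobolev_norm \<Omega> 1 (p - v)) \<le> C * h powr s * sobolev_norm \<Omega> (1 + s) p)"
    using approximation unfolding fun_diff_def by (elim exE)
  then have C: "\<And>h \<zeta>. h > 0 \<Longrightarrow> \<zeta> \<in> Hdiv \<Omega> \<Longrightarrow> \<zeta> \<in> sobolev_vec \<Omega> s \<Longrightarrow>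
      weak_div \<Omega> \<zeta> \<in> sobolev \<Omega> (1 + s) \<Longrightarrow> (INF \<tau>\<in>\<Sigma>h h. Hdiv_norm \<Omega> (\<zeta> - \<tau>)) \<le>
          C * h powr s * (sobolev_vec_norm \<Omega> s \<zeta> + sobolev_norm \<Omega> (1 + s) (weak_div \<Omega> \<zeta>))"
    "\<And>h p. h > 0 \<Longrightarrow> p \<in> sobolev \<Omega> (1 + s) \<inter> H10 \<Omega> \<Longrightarrow> (INF v\<in>Uh h. sobolev_norm \<Omega> 1 (p - v)) \<le>
          C * h powr s * sobolev_norm \<Omega> (1 + s) p"
    by blast+
  have "\<exists>K>0. \<forall>g\<in>L2_space \<Omega>. \<exists>\<eta> p. \<eta> \<in> Hdiv \<Omega> \<and> \<eta> \<in> sobolev_vec \<Omega> s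
    \<and> weak_div \<Omega> \<eta> \<in> sobolev \<Omega> (1 + s) \<and> p \<in> sobolev \<Omega> (1 + s) \<inter> H10 \<Omega>
    \<and> (\<forall>\<tau>\<in>Hdiv \<Omega>. \<forall>v\<in>H10 \<Omega>. fosls_form \<eta> p \<tau> v = L2_inner \<Omega> g v)
    \<and> sobolev_vec_norm \<Omega> s \<eta> + sobolev_norm \<Omega> (1 + s) (weak_div \<Omega> \<eta>) \<le> K * L2_norm \<Omega> g
    \<and> sobolev_norm \<Omega> (1 + s) p \<le> K * L2_norm \<Omega> g"
    by (rule dual_solution_bounds[OF s0 s(2)]) (rule regularity)
  then obtain K where K: "K > 0" and dual: "\<forall>g\<in>L2_space \<Omega>. \<exists>\<eta> p. \<eta> \<in> Hdiv \<Omega> \<and> \<eta> \<in> sobolev_vec \<Omega> s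
    \<and> weak_div \<Omega> \<eta> \<in> sobolev \<Omega> (1 + s) \<and> p \<in> sobolev \<Omega> (1 + s) \<inter> H10 \<Omega>
    \<and> (\<forall>\<tau>\<in>Hdiv \<Omega>. \<forall>v\<in>H10 \<Omega>. fosls_form \<eta> p \<tau> v = L2_inner \<Omega> g v)
    \<and> sobolev_vec_norm \<Omega> s \<eta> + sobolev_norm \<Omega> (1 + s) (weak_div \<Omega> \<eta>) \<le> K * L2_norm \<Omega> g
    \<and> sobolev_norm \<Omega> (1 + s) p \<le> K * L2_norm \<Omega> g"
    by (elim exE conjE)
  have "L2_norm \<Omega> (u - uh) \<le>
      4 * \<bar>C\<bar> * K * h powr s * (Hdiv_norm \<Omega> (\<sigma> - \<sigma>h) + sobolev_norm \<Omega> 1 (u - uh))"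
    if h: "h > 0" and sol: "fosls_solution \<Omega> (Hdiv \<Omega>) (H10 \<Omega>) f \<sigma> u"
      and solh: "fosls_solution \<Omega> (\<Sigma>h h) (Uh h) f \<sigma>h uh" for h f \<sigma> u \<sigma>h uh
  proof -
    have sub: "\<Sigma>h h \<subseteq> Hdiv \<Omega>" "Uh h \<subseteq> H10 \<Omega>" using \<Sigma>h[OF h] Uh[OF h] by auto
    have mem: "\<sigma> - \<sigma>h \<in> Hdiv \<Omega>" "u - uh \<in> H10 \<Omega>"
      using sol solh sub by (auto simp: fosls_solution_def intro: Hdiv_diff)
    define N where "N = L2_norm \<Omega> (u - uh)"
    define E where "E = Hdiv_norm \<Omega> (\<sigma> - \<sigma>h) + sobolev_norm \<Omega> 1 (u - uh)"
    have N: "0 \<le> N" using H10_L2(1)[OF mem(2)] by (simp add: N_def)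
    have E: "0 \<le> E" using Hdiv_norm_ge[of "\<sigma> - \<sigma>h"] H10_norm_ge[OF mem(2)] by (simp add: E_def)
    obtain \<eta> p where \<eta>: "\<eta> \<in> Hdiv \<Omega>" "\<eta> \<in> sobolev_vec \<Omega> s" "weak_div \<Omega> \<eta> \<in> sobolev \<Omega> (1 + s)"
      and p: "p \<in> sobolev \<Omega> (1 + s) \<inter> H10 \<Omega>"
      and form: "\<And>\<tau> v. \<tau> \<in> Hdiv \<Omega> \<Longrightarrow> v \<in> H10 \<Omega> \<Longrightarrow> fosls_form \<eta> p \<tau> v = L2_inner \<Omega> (u - uh) v"
      and bounds: "sobolev_vec_norm \<Omega> s \<eta> + sobolev_norm \<Omega> (1 + s) (weak_div \<Omega> \<eta>) \<le> K * N"
        "sobolev_norm \<Omega> (1 + s) p \<le> K * N"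
      using bspec[OF dual H10_L2(1)[OF mem(2)]] unfolding N_def by blast
    have nn: "0 \<le> sobolev_vec_norm \<Omega> s \<eta> + sobolev_norm \<Omega> (1 + s) (weak_div \<Omega> \<eta>)" "0 \<le> sobolev_norm \<Omega> (1 + s) p"
      using sobolev_add_1(3)[OF s0] \<eta> p by (auto simp: sobolev_vec_norm_def sum_nonneg)
    \<comment> \<open>The hypothesis does not say that \<open>C\<close> is nonnegative, hence the
      absolute value.\<close>
    have scale: "C * h powr s * x \<le> \<bar>C\<bar> * h powr s * (K * N)" if "0 \<le> x" "x \<le> K * N" for x
      using that by (intro mult_mono mult_nonneg_nonneg) auto
    \<comment> \<open>Two approximation errors of equal size and the factor 2 of
      \<open>duality_estimate\<close> make the 4 in the final constant; each error is proportional
      to \<open>N\<close>, which cancels one power on the left.\<close>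
    have "N\<^sup>2 \<le> 2 * (\<bar>C\<bar> * h powr s * (K * N) + \<bar>C\<bar> * h powr s * (K * N)) * E"
      unfolding N_def[symmetric] E_def
      using duality_estimate[OF sol solh sub \<eta>(1) _ form
          order_trans[OF C(1)[OF h \<eta>] scale[OF nn(1) bounds(1)]]
          order_trans[OF C(2)[OF h p] scale[OF nn(2) bounds(2)]]] p
      by (simp add: N_def)
    then have "N * N \<le> (4 * \<bar>C\<bar> * K * h powr s * E) * N" by (simp add: power2_eq_square algebra_simps)
    then have "N \<le> 4 * \<bar>C\<bar> * K * h powr s * E"
      using N E K by (cases "N = 0") (auto simp: mult_le_cancel_right)
    then show ?thesis by (simp add: N_def E_def)
  qed
  then show ?thesis
    unfolding fun_diff_def by (intro exI[of _ "4 * \<bar>C\<bar> * K"]) blast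
qed

end
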